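(* Let $0<r<1/2$ and $s=\frac{2r}{1-2r}$ (so $r=\frac{s}{2+2s}$). With respect to the orthonormal system $\phi_j(t)=\sqrt2\cos(\pi jt)$, $j\ge1$, for every $P_0>0$ the body $\bar{\mathbb{B}}^s_{2\infty}(P_0)$ is a maxiset for the Cramér–von Mises test statistics.
   Context: Observations $X_1,\dots,X_n$ are i.i.d. on $(0,1)$ with density $1+f$, $f=\sum_{j\ge1}\theta_j\phi_j\in\mathbb{L}_2(0,1)$, $\phi_j(t)=\sqrt2\cos(\pi jt)$; $H_0: f=0$. With $\hat F_n$ the empirical distribution function, $F_0(x)=x$ and $T^2(G)=\int_0^1G^2$, a Cramér–von Mises test rejects $H_0$ iff $nT^2(\hat F_n-F_0)$ exceeds a threshold. $\alpha(K)$, $\beta(K,f)$ denote type I and type II error probabilities. For $n_i\to\infty$, a (sub)sequence of alternatives $f_{n_i}$ ($1+f_{n_i}$ densities) is consistent if for every $\alpha\in(0,1)$ and every sequence of Cramér–von Mises tests $K_{n_i}$ with $\alpha(K_{n_i})=\alpha(1+o(1))$, $\limsup_i\beta(K_{n_i},f_{n_i})<1-\alpha$; inconsistent if for every sequence of Cramér–von Mises tests $K_{n_i}$, $\liminf_i(\alpha(K_{n_i})+\beta(K_{n_i},f_{n_i}))\ge1$. $\bar{\mathbb{B}}^s_{2\infty}(P_0)=\{f=\sum_j\theta_j\phi_j:\ \sup_{\lambda>0}\lambda^{2s}\sum_{j>\lambda}\theta_j^2\le P_0\}$. A set $U$ is ortho-symmetric if $\sum_j\theta_j\phi_j\in U$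 implies $\sum_j\pm\theta_j\phi_j\in U$ for all sign choices; for closed bounded convex $U$, $\Im_U=\bigcup_{\gamma>0}\gamma U$. A bounded closed set $U$ is a maxiset if: (i) $U$ is convex; (ii) $U$ is ortho-symmetric; (iii) for any $0<c<C$, every subsequence of alternatives $f_{n_i}\in U$ with $cn_i^{-r}<\|f_{n_i}\|<Cn_i^{-r}$, $n_i\to\infty$, is consistent; (iv) for every $f=\sum_j\theta_j\phi_j\notin\Im_U$ satisfying condition D, every convex ortho-symmetric set $V$ containing $f$ contains an inconsistent subsequence $f_{n_i}\in V$ with $cn_i^{-r}<\|f_{n_i}\|<Cn_i^{-r}$ for some $0<c<C$, $n_i\to\infty$. Condition D: there is $l_0$ such that for all $l>l_0$ the function $1+\sum_{j>l}\theta_j\phi_j$ is nonnegative (a density). *)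

theory Defs
  imports "HOL-Probability.Probability"
begin

definition phi :: "nat \<Rightarrow> real \<Rightarrow> real" where
  "phi j t = sqrt 2 * cos (pi * real j * t)"

text \<open>Coefficient sequences theta_j, j >= 1 (the entry at index 0 is unused and fixed to 0),
  square summable, i.e. elements of l2 corresponding to f in L2(0,1).\<close>
definition l2seq :: "(nat \<Rightarrow> real) \<Rightarrow> bool" where
  "l2seq \<theta> \<longleftrightarrow> \<theta> 0 = 0 \<and> summable (\<lambda>j. (\<theta> j)\<^sup>2)"

text \<open>L2 norm of f = sum theta_j phi_j (Parseval).\<close>
definition l2norm :: "(nat \<Rightarrow> real) \<Rightarrow> real" where
  "l2norm \<theta> = sqrt (\<Sum>j. (\<theta> j)\<^sup>2)"

definition L2fun :: "(real \<Rightarrow> real) \<Rightarrow> bool" where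
  "L2fun f \<longleftrightarrow> f \<in> borel_measurable lborel \<and> set_integrable lborel {0<..<1::real} (\<lambda>x. (f x)\<^sup>2)"

definition expands :: "(real \<Rightarrow> real) \<Rightarrow> (nat \<Rightarrow> real) \<Rightarrow> bool" where
  "expands f \<theta> \<longleftrightarrow>
     (\<lambda>N. LBINT x:{0<..<1::real}. (f x - (\<Sum>j\<in>{1..N}. \<theta> j * phi j x))\<^sup>2) \<longlonglongrightarrow> 0"

definition is_dens :: "(nat \<Rightarrow> real) \<Rightarrow> bool" where
  "is_dens \<theta> \<longleftrightarrow> l2seq \<theta> \<and>
     (\<exists>f. L2fun f \<and> expands f \<theta> \<and> (AE x in lborel. x \<in> {0<..<1} \<longrightarrow> 0 \<le> 1 + f x))"

text \<open>The distribution with density 1 + f on (0,1) (meaningful when is_dens theta holds;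
  the choice of the representative f is irrelevant since they agree a.e.).\<close>
definition law :: "(nat \<Rightarrow> real) \<Rightarrow> real measure" where
  "law \<theta> = density lborel
     (\<lambda>x. indicator {0<..<1} x * ennreal (1 + (SOME f. L2fun f \<and> expands f \<theta>) x))"

definition sample :: "nat \<Rightarrow> (nat \<Rightarrow> real) \<Rightarrow> (nat \<Rightarrow> real) measure" where
  "sample n \<theta> = PiM {..<n} (\<lambda>_. law \<theta>)"

definition ecdf :: "nat \<Rightarrow> (nat \<Rightarrow> real) \<Rightarrow> real \<Rightarrow> real" where
  "ecdf n X x = real (card {i\<in>{..<n}. X i \<le> x}) / real n"

definition cvm :: "nat \<Rightarrow> (nat \<Rightarrow> real) \<Rightarrow> real" where
  "cvm n X = real n * (LBINT x:{0..1::real}. (ecdf n X x - x)\<^sup>2)"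

definition alpha_err :: "nat \<Rightarrow> real \<Rightarrow> real" where
  "alpha_err n c = measure (sample n (\<lambda>_. 0)) {X \<in> space (sample n (\<lambda>_. 0)). cvm n X > c}"

definition beta_err :: "nat \<Rightarrow> real \<Rightarrow> (nat \<Rightarrow> real) \<Rightarrow> real" where
  "beta_err n c \<theta> = measure (sample n \<theta>) {X \<in> space (sample n \<theta>). cvm n X \<le> c}"

definition consistent :: "(nat \<Rightarrow> nat) \<Rightarrow> (nat \<Rightarrow> nat \<Rightarrow> real) \<Rightarrow> bool" where
  "consistent n \<theta>s \<longleftrightarrow>
     (\<forall>\<alpha>\<in>{0<..<1::real}. \<forall>c :: nat \<Rightarrow> real.
        (\<lambda>i. alpha_err (n i) (c i)) \<longlonglongrightarrow> \<alpha> \<longrightarrow>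
        limsup (\<lambda>i. ereal (beta_err (n i) (c i) (\<theta>s i))) < ereal (1 - \<alpha>))"

definition inconsistent :: "(nat \<Rightarrow> nat) \<Rightarrow> (nat \<Rightarrow> nat \<Rightarrow> real) \<Rightarrow> bool" where
  "inconsistent n \<theta>s \<longleftrightarrow>
     (\<forall>c :: nat \<Rightarrow> real.
        liminf (\<lambda>i. ereal (alpha_err (n i) (c i) + beta_err (n i) (c i) (\<theta>s i))) \<ge> 1)"

definition Bbar :: "real \<Rightarrow> real \<Rightarrow> (nat \<Rightarrow> real) set" where
  "Bbar s P0 = {\<theta>. l2seq \<theta> \<and>
     (\<forall>lam>0. lam powr (2 * s) * (\<Sum>j. if real j > lam then (\<theta> j)\<^sup>2 else 0) \<le> P0)}"

definition ortho_sym :: "(nat \<Rightarrow> real) set \<Rightarrow> bool" where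
  "ortho_sym U \<longleftrightarrow>
     (\<forall>\<theta>\<in>U. \<forall>\<epsilon> :: nat \<Rightarrow> real. (\<forall>j. \<epsilon> j = 1 \<or> \<epsilon> j = -1) \<longrightarrow> (\<lambda>j. \<epsilon> j * \<theta> j) \<in> U)"

definition seq_convex :: "(nat \<Rightarrow> real) set \<Rightarrow> bool" where
  "seq_convex U \<longleftrightarrow>
     (\<forall>\<theta>\<in>U. \<forall>\<eta>\<in>U. \<forall>t\<in>{0..1::real}. (\<lambda>j. t * \<theta> j + (1 - t) * \<eta> j) \<in> U)"

definition l2_bounded :: "(nat \<Rightarrow> real) set \<Rightarrow> bool" where
  "l2_bounded U \<longleftrightarrow> (\<exists>M. \<forall>\<theta>\<in>U. l2norm \<theta> \<le> M)"

definition l2_closed :: "(nat \<Rightarrow> real) set \<Rightarrow> bool" where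
  "l2_closed U \<longleftrightarrow>
     (\<forall>\<theta>s \<theta>. (\<forall>k. \<theta>s k \<in> U) \<and> l2seq \<theta> \<and>
        (\<lambda>k. l2norm (\<lambda>j. \<theta>s k j - \<theta> j)) \<longlonglongrightarrow> 0 \<longrightarrow> \<theta> \<in> U)"

definition cone :: "(nat \<Rightarrow> real) set \<Rightarrow> (nat \<Rightarrow> real) set" where
  "cone U = {\<theta>. \<exists>\<gamma>>0. \<exists>\<eta>\<in>U. \<theta> = (\<lambda>j. \<gamma> * \<eta> j)}"

definition condD :: "(nat \<Rightarrow> real) \<Rightarrow> bool" where
  "condD \<theta> \<longleftrightarrow> (\<exists>l0. \<forall>l>l0. is_dens (\<lambda>j. if j > l then \<theta> j else 0))"

definition in_band :: "real \<Rightarrow> real \<Rightarrow> real \<Rightarrow> nat \<Rightarrow> (nat \<Rightarrow> real) \<Rightarrow> bool" where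
  "in_band r c C m \<theta> \<longleftrightarrow>
     c * real m powr (- r) < l2norm \<theta> \<and> l2norm \<theta> < C * real m powr (- r)"

definition maxiset :: "real \<Rightarrow> (nat \<Rightarrow> real) set \<Rightarrow> bool" where
  "maxiset r U \<longleftrightarrow>
     U \<subseteq> {\<theta>. l2seq \<theta>} \<and> l2_bounded U \<and> l2_closed U \<and>
     seq_convex U \<and> ortho_sym U \<and>
     (\<forall>c C. 0 < c \<and> c < C \<longrightarrow>
        (\<forall>n \<theta>s. strict_mono n \<and> (\<forall>i. \<theta>s i \<in> U \<and> is_dens (\<theta>s i) \<and> in_band r c C (n i) (\<theta>s i))
           \<longrightarrow> consistent n \<theta>s)) \<and>
     (\<forall>\<theta>. l2seq \<theta> \<and> \<theta> \<notin> cone U \<and> condD \<theta> \<longrightarrow>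
        (\<forall>V. V \<subseteq> {\<theta>. l2seq \<theta>} \<and> seq_convex V \<and> ortho_sym V \<and> \<theta> \<in> V \<longrightarrow>
          (\<exists>c C n \<theta>s. 0 < c \<and> c < C \<and> strict_mono n \<and>
             (\<forall>i. \<theta>s i \<in> V \<and> is_dens (\<theta>s i) \<and> in_band r c C (n i) (\<theta>s i)) \<and>
             inconsistent n \<theta>s)))"

end

theory Submission
  imports Defs
begin

text \<open>
  On \<open>[0,1]\<close> the statistic is the quadratic form \<open>\<Sum>\<^sub>j lam\<^sub>j (S\<^sub>j + \<surd>n \<theta>\<^sub>j)\<^sup>2\<close> with \<open>lam\<^sub>j = (\<pi> j)\<^sup>-\<^sup>2\<close> and \<open>S\<^sub>j\<close> the
  normalised centred cosine scores, because the kernel of the Cramer--von Mises form has the Fourier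
  expansion of a quadratic Bernoulli polynomial. If the alternatives tend to \<open>0\<close> in \<open>L\<^sub>2\<close>, finitely many
  scores behave like independent standard normals, uniformly in the drift \<open>\<surd>n \<theta>\<^sub>j\<close>: the
  Laplace transform of the form is a Gaussian average of one-dimensional characteristic functions, in
  which the drift is only a phase, and Bernstein polynomials lead from Laplace transforms to
  distribution functions. The frequencies above \<open>m\<close> carry noise of expected size at most
  \<open>2 \<Sum>\<^sub>j\<^sub>>\<^sub>m lam\<^sub>j\<close>.

  Hence a sequence is consistent as soon as the drift energy \<open>n \<Sum>\<^sub>j lam\<^sub>j \<theta>\<^sub>j\<^sup>2\<close> stays away from \<open>0\<close>, and
  inconsistent if it vanishes together with all fixed coordinates. For \<open>\<theta>\<close> in the Besov body with
  \<open>\<parallel>\<theta>\<parallel> \<asymp> n\<^sup>-\<^sup>r\<close> half of the energy sits at frequencies of at most order \<open>n\<close> to the power \<open>(1 - 2 r) / 2\<close>, so the drift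
  energy is bounded below. Outside the cone the high-frequency tails of \<open>\<theta>\<close>, which lie in every convex
  ortho-symmetric set containing \<open>\<theta>\<close>, are so large at suitable frequencies that at matching sample sizes the drift
  energy vanishes.
\<close>

section \<open>Laws with prescribed cosine coefficients\<close>

text \<open>The obstacle is that no limit law is available: thresholds are arbitrary real sequences
  and the drifts \<open>drift \<theta> n j\<close> may be unbounded. Every comparison is therefore
  between two moving laws at the same index, with constants uniform in the drift and in the
  truncation level. Thresholds only need an upper bound, which tightness under the null supplies.
  The Gaussian comparison forms contain coordinate 1, whose bounded normal density gives a modulus
  of continuity common to all of them.

  Only the cosine moments of an alternative enter. A product of two cosines is again a combination
  of two cosines, so a small \<open>l2norm\<close> already makes the score covariances close to the
  identity, without any bound on the density.

  The exponents fit because \<open>1 - 1 / (2 * r) = - 1 / s\<close>: tail energy \<tau> beyond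
  frequency \<open>l\<close> calls for a sample size of order
  \<open>\<tau> powr (- 1 / (2 * r))\<close>, hence gives drift energy of order at most
  \<open>\<tau> powr (- 1 / s) / l^2\<close>, which is small when
  \<open>l powr (2 * s) * \<tau>\<close> is large.\<close>

lemma phi_measurable [measurable]: "phi j \<in> borel_measurable borel"
  unfolding phi_def by measurable

lemma abs_phi_le: "\<bar>phi j x\<bar> \<le> sqrt 2"
  unfolding phi_def by (simp add: abs_mult)

lemma phi_sq_le: "(phi j x)\<^sup>2 \<le> 2"
  using power_mono[OF abs_phi_le[of j x], of 2] by simp

text \<open>Product-to-sum formula. Since \<open>phi 0\<close> is the constant sqrt 2 and not 1, the
  case j = k needs no exception. It turns second moments of the system into first moments.\<close>

lemma phi_mult:
  assumes "k \<le> j"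
  shows "phi j x * phi k x = (phi (j + k) x + phi (j - k) x) / sqrt 2"
proof -
  have "cos (pi * real (j + k) * x) + cos (pi * real (j - k) * x) =
      2 * (cos (pi * real j * x) * cos (pi * real k * x))"
    using assms by (simp add: of_nat_diff algebra_simps cos_add cos_diff)
  moreover have "sqrt 2 * cos a * (sqrt 2 * cos b) = 2 * (cos a * cos b)" for a b by simp
  ultimately show ?thesis unfolding phi_def by (simp add: distrib_left[symmetric])
qed

abbreviation unit_uniform :: "real measure" where
  "unit_uniform \<equiv> restrict_space lborel {0<..<1}"

interpretation unit_uniform: prob_space unit_uniform
  by (rule prob_spaceI) (simp add: emeasure_restrict_space space_restrict_space)

lemma borel_measurable_unit_uniform [measurable (raw)]:
  "f \<in> borel_measurable borel \<Longrightarrow> f \<in> borel_measurable unit_uniform"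
  by (simp add: measurable_restrict_space1)

lemma integral_unit_uniform: "(LINT x|unit_uniform. f x) = (LBINT x:{0<..<1}. (f x :: real))"
  unfolding set_lebesgue_integral_def by (rule integral_restrict_space) simp

lemma integral_unit_uniform_phi: "(LINT x|unit_uniform. phi m x) = (if m = 0 then sqrt 2 else 0)"
proof -
  define F where "F x = (if m = 0 then sqrt 2 * x else sqrt 2 * sin (pi * real m * x) / (pi * real m))" for x
  have "(LBINT x=ereal 0..ereal 1. phi m x) = F 1 - F 0"
  proof (rule interval_integral_FTC_finite)
    show "continuous_on {min 0 1..max 0 1} (phi m)"
      unfolding phi_def by (intro continuous_intros)
    show "(F has_vector_derivative phi m x) (at x within {min 0 1..max 0 1})" for x
      unfolding has_real_derivative_iff_has_vector_derivative[symmetric] F_def phi_def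
      by (cases "m = 0") (auto intro!: derivative_eq_intros)
  qed
  then show ?thesis
    unfolding integral_unit_uniform by (auto simp: interval_integral_Ioo F_def sin_npi2 zero_ereal_def one_ereal_def)
qed

lemma integrable_unit_uniform_bounded:
  assumes "f \<in> borel_measurable unit_uniform" "\<And>x. \<bar>f x\<bar> \<le> B"
  shows "integrable unit_uniform (f :: real \<Rightarrow> real)"
  by (rule unit_uniform.integrable_const_bound[of _ B]) (use assms in auto)

lemma integrable_phi_mult: "integrable unit_uniform (\<lambda>x. phi j x * phi k x)"
proof (rule integrable_unit_uniform_bounded)
  show "\<bar>phi j x * phi k x\<bar> \<le> sqrt 2 * sqrt 2" for x
    unfolding abs_mult by (intro mult_mono abs_phi_le) auto
qed simp

lemma integrable_phi: "integrable unit_uniform (phi j)"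
  by (rule integrable_unit_uniform_bounded[OF _ abs_phi_le]) simp

lemma phi_orthonormal:
  assumes "1 \<le> j"
  shows "(LINT x|unit_uniform. phi j x * phi m x) = (if j = m then 1 else 0)"
proof -
  have *: "(LINT x|unit_uniform. phi a x * phi b x) = (if a = b then 1 else 0)" if "b \<le> a" "1 \<le> a" for a b
    using that
    by (simp add: phi_mult Bochner_Integration.integral_add integrable_phi integral_unit_uniform_phi)
  show ?thesis
  proof (cases "m \<le> j")
    case True
    then show ?thesis using *[of m j] assms by simp
  next
    case False
    then show ?thesis using *[of j m] assms by (simp add: mult.commute)
  qed
qed

lemma L2fun_square_integrable:
  assumes "L2fun f"
  shows "f \<in> borel_measurable unit_uniform" "integrable unit_uniform (\<lambda>x. (f x)\<^sup>2)" "integrable unit_uniform f"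
proof -
  show m: "f \<in> borel_measurable unit_uniform"
    using assms unfolding L2fun_def by (auto intro: measurable_restrict_space1)
  show sq: "integrable unit_uniform (\<lambda>x. (f x)\<^sup>2)"
    using assms unfolding L2fun_def by (subst integrable_restrict_space) (auto simp: set_integrable_def)
  show "integrable unit_uniform f"
    by (rule unit_uniform.square_integrable_imp_integrable[OF m sq])
qed

abbreviation fourier_partial :: "(nat \<Rightarrow> real) \<Rightarrow> nat \<Rightarrow> real \<Rightarrow> real" where
  "fourier_partial \<theta> N x \<equiv> (\<Sum>j\<in>{1..N}. \<theta> j * phi j x)"

lemma square_integrable_diff:
  fixes f g :: "'a \<Rightarrow> real"
  assumes "f \<in> borel_measurable M" "g \<in> borel_measurable M"
    "integrable M (\<lambda>x. (f x)\<^sup>2)" "integrable M (\<lambda>x. (g x)\<^sup>2)"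
  shows "integrable M (\<lambda>x. (f x - g x)\<^sup>2)"
proof (rule Bochner_Integration.integrable_bound)
  show "integrable M (\<lambda>x. 2 * (f x)\<^sup>2 + 2 * (g x)\<^sup>2)" using assms by simp
  have "(f x - g x)\<^sup>2 \<le> 2 * (f x)\<^sup>2 + 2 * (g x)\<^sup>2" for x
    using zero_le_power2[of "f x + g x"] by (simp add: power2_eq_square algebra_simps)
  then show "AE x in M. norm ((f x - g x)\<^sup>2) \<le> norm (2 * (f x)\<^sup>2 + 2 * (g x)\<^sup>2)" by simp
qed (use assms in simp)

lemma abs_fourier_partial_le: "\<bar>fourier_partial \<theta> N x\<bar> \<le> (\<Sum>j\<in>{1..N}. \<bar>\<theta> j\<bar> * sqrt 2)"
  by (rule order_trans[OF sum_abs]) (auto simp: abs_mult intro!: sum_mono mult_left_mono abs_phi_le)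

lemma fourier_partial_sq_integrable: "integrable unit_uniform (\<lambda>x. (fourier_partial \<theta> N x)\<^sup>2)"
proof (rule integrable_unit_uniform_bounded)
  show "\<bar>(fourier_partial \<theta> N x)\<^sup>2\<bar> \<le> (\<Sum>j\<in>{1..N}. \<bar>\<theta> j\<bar> * sqrt 2)\<^sup>2" for x
    using power_mono[OF abs_fourier_partial_le[where N = N and \<theta> = \<theta> and x = x], of 2] by simp
qed simp

lemma expands_sq_integrable:
  assumes "L2fun f"
  shows "integrable unit_uniform (\<lambda>x. (f x - fourier_partial \<theta> N x)\<^sup>2)"
  by (intro square_integrable_diff L2fun_square_integrable[OF assms] fourier_partial_sq_integrable) simp

text \<open>\<open>expands\<close> asserts only L2 convergence of partial sums. Pairing with the
  bounded function \<open>phi m\<close> is continuous in L1, hence in L2 on a probability space, so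
  orthonormality recovers the coefficient. For m = 0 this says that f has integral 0.\<close>

lemma expands_coefficient:
  assumes f: "L2fun f" and e: "expands f \<theta>" and \<theta>0: "\<theta> 0 = 0"
  shows "(LINT x|unit_uniform. f x * phi m x) = \<theta> m"
proof -
  define u where "u N x = f x - fourier_partial \<theta> N x" for N x
  have fm [measurable]: "f \<in> borel_measurable unit_uniform" using f by (rule L2fun_square_integrable)
  have um [measurable]: "u N \<in> borel_measurable unit_uniform" for N unfolding u_def by measurable
  have usq: "integrable unit_uniform (\<lambda>x. (u N x)\<^sup>2)" for N
    unfolding u_def by (rule expands_sq_integrable[OF f])
  have ui: "integrable unit_uniform (u N)" for N
    by (rule unit_uniform.square_integrable_imp_integrable[OF um usq])
  have up: "integrable unit_uniform (\<lambda>x. u N x * phi m x)" for N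
  proof (rule Bochner_Integration.integrable_bound)
    show "integrable unit_uniform (\<lambda>x. u N x * sqrt 2)" using ui by simp
    show "AE x in unit_uniform. norm (u N x * phi m x) \<le> norm (u N x * sqrt 2)"
      by (auto simp: abs_mult intro!: mult_left_mono abs_phi_le)
  qed simp
  have u0: "(\<lambda>N. LINT x|unit_uniform. (u N x)\<^sup>2) \<longlonglongrightarrow> 0"
    using e unfolding expands_def integral_unit_uniform u_def by simp
  have sm: "(LINT x|unit_uniform. fourier_partial \<theta> N x * phi m x) = \<theta> m" if "m \<le> N" for N
  proof -
    have "(LINT x|unit_uniform. fourier_partial \<theta> N x * phi m x) =
       (LINT x|unit_uniform. (\<Sum>j\<in>{1..N}. \<theta> j * (phi j x * phi m x)))"
      by (simp add: sum_distrib_right mult.assoc)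
    also have "\<dots> = (\<Sum>j\<in>{1..N}. \<theta> j * (if j = m then 1 else 0))"
      by (subst Bochner_Integration.integral_sum)
         (auto intro!: sum.cong integrable_phi_mult simp: phi_orthonormal simp del: mult_cancel_left)
    also have "\<dots> = \<theta> m" using that \<theta>0 by (cases "m = 0") (auto simp: if_distrib sum.delta cong: if_cong)
    finally show ?thesis .
  qed
  have split: "(LINT x|unit_uniform. f x * phi m x) = (LINT x|unit_uniform. u N x * phi m x) + \<theta> m" if "m \<le> N" for N
  proof -
    have sp: "integrable unit_uniform (\<lambda>x. fourier_partial \<theta> N x * phi m x)"
    proof (rule integrable_unit_uniform_bounded)
      show "\<bar>fourier_partial \<theta> N x * phi m x\<bar> \<le> (\<Sum>j\<in>{1..N}. \<bar>\<theta> j\<bar> * sqrt 2) * sqrt 2" for x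
        unfolding abs_mult by (intro mult_mono abs_fourier_partial_le abs_phi_le) (auto intro!: sum_nonneg)
    qed simp
    have "(LINT x|unit_uniform. f x * phi m x) =
       (LINT x|unit_uniform. u N x * phi m x + fourier_partial \<theta> N x * phi m x)"
      by (simp add: u_def algebra_simps)
    also have "\<dots> = (LINT x|unit_uniform. u N x * phi m x) + \<theta> m"
      using sm[OF that] up sp by simp
    finally show ?thesis .
  qed
  have "(\<lambda>N. LINT x|unit_uniform. u N x * phi m x) \<longlonglongrightarrow> 0"
  proof (rule LIMSEQ_I)
    fix e :: real assume e: "0 < e"
    define d where "d = e / (2 * sqrt 2)"
    have d: "d > 0" using e by (simp add: d_def)
    obtain N0 where N0: "\<And>N. N \<ge> N0 \<Longrightarrow> norm ((LINT x|unit_uniform. (u N x)\<^sup>2) - 0) < d * d"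
      using LIMSEQ_D[OF u0, of "d * d"] d by auto
    have "norm ((LINT x|unit_uniform. u N x * phi m x) - 0) < e" if N: "N \<ge> N0" for N
    proof -
      \<comment> \<open>Replaces Cauchy-Schwarz: after integration the L1 norm of \<open>u N\<close>
        is at most \<open>d\<close> plus its squared L2 norm over \<open>d\<close>, so below
        \<open>2 * d\<close> once that squared norm is below \<open>d * d\<close>. The bound sqrt 2
        on \<open>phi m\<close> turns \<open>2 * d\<close> into \<open>e\<close>.\<close>
      have pt: "\<bar>v\<bar> \<le> d + v\<^sup>2 / d" for v :: real
      proof (cases "\<bar>v\<bar> \<le> d")
        case True
        then show ?thesis using d by (simp add: add_increasing2)
      next
        case False
        then have "\<bar>v\<bar> * d \<le> \<bar>v\<bar> * \<bar>v\<bar>" by (intro mult_left_mono) auto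
        then have "\<bar>v\<bar> \<le> v\<^sup>2 / d" using d by (simp add: field_simps power2_eq_square)
        then show ?thesis using d by simp
      qed
      have "norm (LINT x|unit_uniform. u N x * phi m x) \<le> (LINT x|unit_uniform. norm (u N x * phi m x))"
        by (rule integral_norm_bound)
      also have "\<dots> \<le> (LINT x|unit_uniform. (d + (u N x)\<^sup>2 / d) * sqrt 2)"
      proof (rule integral_mono)
        show "norm (u N x * phi m x) \<le> (d + (u N x)\<^sup>2 / d) * sqrt 2" for x
          using d unfolding real_norm_def abs_mult by (intro mult_mono pt abs_phi_le) (auto intro!: add_nonneg_nonneg)
      qed (use up usq in auto)
      also have "\<dots> = (d + (LINT x|unit_uniform. (u N x)\<^sup>2) / d) * sqrt 2"
        using usq unit_uniform.prob_space by simp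
      also have "\<dots> < (d + d) * sqrt 2"
        using N0[OF N] d by (simp add: field_simps)
      also have "\<dots> = e" by (simp add: d_def)
      finally show ?thesis by simp
    qed
    then show "\<exists>no. \<forall>N\<ge>no. norm ((LINT x|unit_uniform. u N x * phi m x) - 0) < e" by blast
  qed
  then have "(\<lambda>N. (LINT x|unit_uniform. u N x * phi m x) + \<theta> m) \<longlonglongrightarrow> 0 + \<theta> m" by (intro tendsto_intros)
  moreover have "\<forall>\<^sub>F N in sequentially. (LINT x|unit_uniform. u N x * phi m x) + \<theta> m = (LINT x|unit_uniform. f x * phi m x)"
    by (rule eventually_sequentiallyI[of m]) (simp add: split)
  ultimately have "(\<lambda>N. LINT x|unit_uniform. f x * phi m x) \<longlonglongrightarrow> 0 + \<theta> m" by (rule Lim_transform_eventually)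
  then show ?thesis using LIMSEQ_unique[OF _ tendsto_const] by fastforce
qed

text \<open>\<open>law\<close> picks its representative by \<open>SOME\<close>, whereas
  nonnegativity is known only for the one witnessing \<open>is_dens\<close>; this transfers
  it.\<close>

lemma expands_unique:
  assumes f: "L2fun f" "expands f \<theta>" and g: "L2fun g" "expands g \<theta>"
  shows "AE x in unit_uniform. f x = g x"
proof -
  have fg: "integrable unit_uniform (\<lambda>x. (f x - g x)\<^sup>2)"
    by (intro square_integrable_diff L2fun_square_integrable f g)
  have "(LINT x|unit_uniform. (f x - g x)\<^sup>2) \<le>
     2 * (LINT x|unit_uniform. (f x - fourier_partial \<theta> N x)\<^sup>2) + 2 * (LINT x|unit_uniform. (g x - fourier_partial \<theta> N x)\<^sup>2)" for N
  proof -
    have "(LINT x|unit_uniform. (f x - g x)\<^sup>2) \<le>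
       (LINT x|unit_uniform. 2 * (f x - fourier_partial \<theta> N x)\<^sup>2 + 2 * (g x - fourier_partial \<theta> N x)\<^sup>2)"
    proof (rule integral_mono[OF fg])
      have "(a - b)\<^sup>2 \<le> 2 * (a - c)\<^sup>2 + 2 * (b - c)\<^sup>2" for a b c :: real
        using zero_le_power2[of "a + b - 2 * c"] by (simp add: power2_eq_square algebra_simps)
      then show "(f x - g x)\<^sup>2 \<le> 2 * (f x - fourier_partial \<theta> N x)\<^sup>2 + 2 * (g x - fourier_partial \<theta> N x)\<^sup>2" for x .
    qed (use expands_sq_integrable f g in auto)
    then show ?thesis using expands_sq_integrable f g by simp
  qed
  moreover have "(\<lambda>N. 2 * (LINT x|unit_uniform. (f x - fourier_partial \<theta> N x)\<^sup>2) + 2 * (LINT x|unit_uniform. (g x - fourier_partial \<theta> N x)\<^sup>2)) \<longlonglongrightarrow> 2 * 0 + 2 * 0"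
    using f(2) g(2) unfolding expands_def integral_unit_uniform by (intro tendsto_intros)
  ultimately have "(LINT x|unit_uniform. (f x - g x)\<^sup>2) \<le> 2 * 0 + 2 * 0"
    by (intro LIMSEQ_le_const) auto
  then have "(LINT x|unit_uniform. (f x - g x)\<^sup>2) = 0"
    by (intro order_antisym) auto
  then show ?thesis using fg by (subst (asm) integral_nonneg_eq_0_iff_AE) auto
qed

text \<open>Everything that the probabilistic part uses about an alternative. The density is
  forgotten; what remains is the support and the cosine moments.\<close>

definition cos_law :: "real measure \<Rightarrow> (nat \<Rightarrow> real) \<Rightarrow> bool" where
  "cos_law \<mu> \<theta> \<longleftrightarrow> prob_space \<mu> \<and> sets \<mu> = sets borel \<and> (AE x in \<mu>. x \<in> {0<..<1}) \<and>
     (\<forall>m\<ge>1. (LINT x|\<mu>. phi m x) = \<theta> m)"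

lemma cos_law_law:
  assumes "is_dens \<theta>"
  shows "cos_law (law \<theta>) \<theta>"
proof -
  obtain f0 where f0: "L2fun f0" "expands f0 \<theta>" "AE x in lborel. x \<in> {0<..<1} \<longrightarrow> 0 \<le> 1 + f0 x"
    using assms unfolding is_dens_def by auto
  have \<theta>0: "\<theta> 0 = 0" using assms unfolding is_dens_def l2seq_def by auto
  define f where "f = (SOME f. L2fun f \<and> expands f \<theta>)"
  have f: "L2fun f" "expands f \<theta>"
    using someI[of "\<lambda>f. L2fun f \<and> expands f \<theta>" f0] f0 unfolding f_def by auto
  have fm [measurable]: "f \<in> borel_measurable borel" using f(1) unfolding L2fun_def by simp
  have "AE x in lborel. x \<in> {0<..<1} \<longrightarrow> f x = f0 x"
    using expands_unique[OF f f0(1,2)] by (subst (asm) AE_restrict_space_iff) auto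
  with f0(3) have pos: "AE x in lborel. x \<in> {0<..<1} \<longrightarrow> 0 \<le> 1 + f x" by eventually_elim auto
  define d where "d x = indicator {0<..<1} x * (1 + f x)" for x :: real
  have dm [measurable]: "d \<in> borel_measurable borel" unfolding d_def by measurable
  have dpos: "AE x in lborel. 0 \<le> d x" using pos by eventually_elim (auto simp: d_def indicator_def)
  have "(\<lambda>x. indicator {0<..<1} x * ennreal (1 + f x)) = (\<lambda>x. ennreal (d x))"
    by (auto simp: d_def indicator_def)
  then have law: "law \<theta> = density lborel (\<lambda>x. ennreal (d x))" unfolding law_def f_def by simp
  have fi: "integrable unit_uniform f" by (rule L2fun_square_integrable[OF f(1)])
  have int: "(LINT x|law \<theta>. phi m x) = (LINT x|unit_uniform. (1 + f x) * phi m x)" for m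
  proof -
    have "(LINT x|law \<theta>. phi m x) = (LINT x|lborel. d x *\<^sub>R phi m x)"
      unfolding law by (rule integral_density) (use dpos in auto)
    also have "\<dots> = (LINT x|unit_uniform. (1 + f x) * phi m x)"
      unfolding integral_unit_uniform set_lebesgue_integral_def by (simp add: d_def mult.assoc)
    finally show ?thesis .
  qed
  have fp: "integrable unit_uniform (\<lambda>x. f x * phi m x)" for m
  proof (rule Bochner_Integration.integrable_bound)
    show "integrable unit_uniform (\<lambda>x. f x * sqrt 2)" using fi by simp
    show "AE x in unit_uniform. norm (f x * phi m x) \<le> norm (f x * sqrt 2)"
      by (auto simp: abs_mult intro!: mult_left_mono abs_phi_le)
  qed simp
  have coeff: "(LINT x|law \<theta>. phi m x) = (if m = 0 then sqrt 2 else 0) + \<theta> m" for m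
    unfolding int using fp[of m] integrable_phi[of m]
    by (simp add: distrib_right integral_unit_uniform_phi expands_coefficient[OF f \<theta>0])
  \<comment> \<open>The constant function is \<open>phi 0 / sqrt 2\<close>, so the total mass is
    itself a cosine moment, and \<theta> 0 = 0 makes it 1.\<close>
  have "(LINT x|unit_uniform. (1 + f x) * phi 0 x) = sqrt 2"
    using coeff[of 0] \<theta>0 unfolding int by simp
  then have "(LINT x|unit_uniform. 1 + f x) = 1" by (simp add: phi_def)
  then have d1: "(LINT x|lborel. d x) = 1"
    unfolding integral_unit_uniform set_lebesgue_integral_def by (simp add: d_def)
  have "set_integrable lborel {0<..<1} (\<lambda>x. 1 + f x)"
    using fi integrable_restrict_space[of "{0<..<1}" lborel "\<lambda>x. 1 + f x"] by (simp add: set_integrable_def)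
  then have di: "integrable lborel d" by (simp add: set_integrable_def d_def[abs_def])
  have "prob_space (law \<theta>)"
  proof (rule prob_spaceI)
    have "emeasure (law \<theta>) (space (law \<theta>)) = (\<integral>\<^sup>+x. ennreal (d x) \<partial>lborel)"
      unfolding law by (subst emeasure_density) auto
    also have "\<dots> = 1" using d1 nn_integral_eq_integral[OF di dpos] by simp
    finally show "emeasure (law \<theta>) (space (law \<theta>)) = 1" .
  qed
  moreover have "AE x in law \<theta>. x \<in> {0<..<1}"
    unfolding law by (subst AE_density) (auto simp: d_def indicator_def)
  moreover have "sets (law \<theta>) = sets borel" unfolding law by simp
  ultimately show ?thesis using coeff unfolding cos_law_def by auto
qed

lemma is_dens_zero: "is_dens (\<lambda>_. 0)"
  unfolding is_dens_def l2seq_def L2fun_def expands_def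
  by (auto simp: set_integrable_def set_lebesgue_integral_def intro!: exI[of _ "\<lambda>_. 0::real"])

section \<open>The Cramer--von Mises statistic in cosine coordinates\<close>

text \<open>The damping by r < 1 makes the termwise derivative converge uniformly. The resulting
  sine series is the imaginary part of the logarithm of \<open>1 - r * cis t\<close>, and since that
  number has positive real part its argument is an arctangent. The term j = 0 vanishes because
  division by zero gives 0.\<close>

lemma damped_cos_series_deriv:
  fixes r t :: real
  assumes r: "0 \<le> r" "r < 1"
  shows "((\<lambda>t. \<Sum>j. r ^ j * cos (real j * t) / (real j)\<^sup>2) has_real_derivative
           arctan (- r * sin t / (1 - r * cos t))) (at t)"
proof -
  have "uniform_limit UNIV (\<lambda>n x. \<Sum>i<n. - (r ^ i * sin (real i * x) / real i))
          (\<lambda>x. \<Sum>i. - (r ^ i * sin (real i * x) / real i)) sequentially"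
  proof (rule Weierstrass_m_test)
    show "summable (\<lambda>i. r ^ i)" using r by simp
    fix n and x :: real
    have "norm (- (r ^ n * sin (real n * x) / real n)) = r ^ n * (\<bar>sin (real n * x)\<bar> / real n)"
      using r by (simp add: abs_mult)
    also have "\<bar>sin (real n * x)\<bar> / real n \<le> 1"
    proof (cases "n = 0")
      case False
      then have "\<bar>sin (real n * x)\<bar> \<le> real n"
        using order_trans[OF abs_sin_le_one, of "real n"] by simp
      then show ?thesis using False by simp
    qed simp
    then have "r ^ n * (\<bar>sin (real n * x)\<bar> / real n) \<le> r ^ n"
      using r mult_left_le[of "\<bar>sin (real n * x)\<bar> / real n" "r ^ n"] by simp
    finally show "norm (- (r ^ n * sin (real n * x) / real n)) \<le> r ^ n" .
  qed
  then have uc: "uniformly_convergent_on UNIV (\<lambda>n x. \<Sum>i<n. - (r ^ i * sin (real i * x) / real i))"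
    unfolding uniformly_convergent_on_def by blast
  have s0: "summable (\<lambda>n. r ^ n * cos (real n * 0) / (real n)\<^sup>2)"
  proof (rule summable_comparison_test')
    show "summable (\<lambda>i. r ^ i)" using r by simp
    fix n :: nat
    show "norm (r ^ n * cos (real n * 0) / (real n)\<^sup>2) \<le> r ^ n"
      using r mult_left_mono[of 1 "(real n)\<^sup>2" "r ^ n"] by (cases "n = 0") (auto simp: field_simps)
  qed
  have D: "((\<lambda>x. r ^ n * cos (real n * x) / (real n)\<^sup>2) has_field_derivative
        - (r ^ n * sin (real n * x) / real n)) (at x within UNIV)" for n x
    by (cases "n = 0") (auto intro!: derivative_eq_intros simp: power2_eq_square field_simps)
  have deriv: "((\<lambda>x. \<Sum>n. r ^ n * cos (real n * x) / (real n)\<^sup>2) has_field_derivative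
       (\<Sum>n. - (r ^ n * sin (real n * t) / real n))) (at t)"
    by (rule has_field_derivative_series'(2)[OF convex_UNIV D uc _ s0]) auto
  define w where "w = complex_of_real r * cis t"
  have nw: "norm w < 1" using r by (simp add: w_def norm_mult)
  have "(\<lambda>n. - ((- (- w)) ^ n) / of_nat n) sums ln (1 + - w)"
    by (rule Ln_series') (use nw in simp)
  then have "(\<lambda>n. Im (- (w ^ n) / of_nat n)) sums Im (ln (1 - w))"
    by (intro sums_Im) simp
  moreover have "Im (- (w ^ n) / of_nat n) = - (r ^ n * sin (real n * t) / real n)" for n
  proof -
    have "w ^ n = complex_of_real (r ^ n) * cis (real n * t)"
      by (simp add: w_def power_mult_distrib Complex.DeMoivre)
    then show ?thesis by (simp add: Im_divide_of_nat del: of_real_power)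
  qed
  ultimately have "(\<lambda>n. - (r ^ n * sin (real n * t) / real n)) sums Im (ln (1 - w))"
    by (simp only:)
  then have "(\<Sum>n. - (r ^ n * sin (real n * t) / real n)) = Im (ln (1 - w))"
    by (rule sums_unique[symmetric])
  also have "\<bar>r * cos t\<bar> < 1"
    using r mult_left_mono[OF abs_cos_le_one[of t] r(1)] by (simp add: abs_mult)
  then have "0 < Re (1 - w)" by (simp add: w_def)
  then have "Im (ln (1 - w)) = arctan (Im (1 - w) / Re (1 - w))"
    by (subst Im_Ln_eq) auto
  finally show ?thesis using deriv by (simp add: w_def)
qed

text \<open>The derivative of the undamped series is only conditionally convergent, so it is
  approached from r < 1. The damped derivatives are arctangents, hence bounded by pi / 2, and
  dominated convergence integrates their pointwise limit (x - pi) / 2. The value at 0 is the sum of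
  inverse squares.\<close>

lemma cos_series_quadratic:
  fixes t :: real
  assumes t: "0 \<le> t" "t \<le> 2 * pi"
  shows "(\<lambda>j. cos (real j * t) / (real j)\<^sup>2) sums (pi\<^sup>2 / 6 - pi * t / 2 + t\<^sup>2 / 4)"
proof -
  define F where "F r t = (\<Sum>j. r ^ j * cos (real j * t) / (real j)\<^sup>2)" for r t :: real
  define h where "h r t = arctan (- r * sin t / (1 - r * cos t))" for r t :: real
  define \<rho> where "\<rho> k = 1 - 1 / real (Suc k)" for k
  \<comment> \<open>At 0 and 2 * pi every damped derivative is 0, so the pointwise limit jumps
    there; two points do not affect the integral.\<close>
  define g where "g x = (if x = 0 \<or> x = 2 * pi then 0 else (x - pi) / 2)" for x :: real
  have \<rho>: "0 \<le> \<rho> k" "\<rho> k < 1" for k by (auto simp: \<rho>_def field_simps)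
  have \<rho>1: "\<rho> \<longlonglongrightarrow> 1"
    unfolding \<rho>_def using tendsto_diff[OF tendsto_const[of 1] LIMSEQ_inverse_real_of_nat]
    by (simp add: inverse_eq_divide)
  have int: "(h (\<rho> k) has_integral (F (\<rho> k) t - F (\<rho> k) 0)) {0..t}" for k
  proof (rule fundamental_theorem_of_calculus[OF t(1)])
    fix x assume "x \<in> {0..t}"
    have "(F (\<rho> k) has_real_derivative h (\<rho> k) x) (at x)"
      unfolding F_def[abs_def] h_def[abs_def] by (rule damped_cos_series_deriv[OF \<rho>])
    then show "(F (\<rho> k) has_vector_derivative h (\<rho> k) x) (at x within {0..t})"
      by (simp add: has_real_derivative_iff_has_vector_derivative[symmetric] has_field_derivative_at_within)
  qed
  have lim: "(\<lambda>k. h (\<rho> k) x) \<longlonglongrightarrow> g x" if x: "x \<in> {0..t}" for x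
  proof (cases "x = 0 \<or> x = 2 * pi")
    case True
    then show ?thesis by (auto simp: h_def g_def)
  next
    case False
    then have x': "0 < x" "x < 2 * pi" using x t by auto
    have "cos x \<noteq> 1"
    proof
      assume "cos x = 1"
      then obtain k :: int where k: "x = of_int k * 2 * pi" using cos_one_2pi_int by auto
      then have "0 < k" "k < 1" using x' by (auto simp: zero_less_mult_iff)
      then show False by simp
    qed
    then have "(\<lambda>k. h (\<rho> k) x) \<longlonglongrightarrow> arctan (- 1 * sin x / (1 - 1 * cos x))"
      unfolding h_def by (intro tendsto_intros \<rho>1) simp
    also have "- 1 * sin x / (1 - 1 * cos x) = tan ((x - pi) / 2)"
    proof -
      have "2 * ((x - pi) / 2) = x - pi" by simp
      then have "tan ((x - pi) / 2) = sin (x - pi) / (cos (x - pi) + 1)" by (simp only: tan_half)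
      then show ?thesis by (simp add: sin_diff cos_diff)
    qed
    also have "arctan (tan ((x - pi) / 2)) = (x - pi) / 2"
      by (rule arctan_tan) (use x' in \<open>auto simp: field_simps\<close>)
    finally show ?thesis using False by (simp add: g_def)
  qed
  have "(\<lambda>k. integral {0..t} (h (\<rho> k))) \<longlonglongrightarrow> integral {0..t} g"
  proof (rule dominated_convergence(2)[where h = "\<lambda>_. pi / 2"])
    show "h (\<rho> k) integrable_on {0..t}" for k using int by blast
    show "norm (h (\<rho> k) x) \<le> pi / 2" for k x
      unfolding h_def using arctan_bounded[of "- \<rho> k * sin x / (1 - \<rho> k * cos x)"]
      unfolding real_norm_def by linarith
  qed (use lim in auto)
  moreover have "((\<lambda>x. (x - pi) / 2) has_integral ((t\<^sup>2 / 4 - pi * t / 2) - (0\<^sup>2 / 4 - pi * 0 / 2))) {0..t}"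
    by (rule fundamental_theorem_of_calculus[OF t(1)])
       (auto intro!: derivative_eq_intros simp: has_real_derivative_iff_has_vector_derivative[symmetric] field_simps)
  then have "(g has_integral (t\<^sup>2 / 4 - pi * t / 2)) {0..t}"
    by (intro has_integral_spike_finite[of "{0, 2 * pi}" _ g]) (auto simp: g_def)
  ultimately have 1: "(\<lambda>k. F (\<rho> k) t - F (\<rho> k) 0) \<longlonglongrightarrow> t\<^sup>2 / 4 - pi * t / 2"
    using integral_unique[OF int] by (simp add: integral_unique)
  have zeta: "(\<lambda>j. 1 / (real j)\<^sup>2) sums (pi\<^sup>2 / 6)"
    using inverse_squares_sums sums_Suc_iff[of "\<lambda>j. 1 / (real j)\<^sup>2" "pi\<^sup>2 / 6"] by (simp add: add.commute)
  have lim2: "(\<lambda>k. F (\<rho> k) x) \<longlonglongrightarrow> (\<Sum>j. cos (real j * x) / (real j)\<^sup>2)" for x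
    unfolding F_def
  proof (rule tannerys_theorem[THEN conjunct2, THEN conjunct2])
    show "summable (\<lambda>j. 1 / (real j)\<^sup>2)" using zeta by (rule sums_summable)
    show "(\<lambda>k. \<rho> k ^ j * cos (real j * x) / (real j)\<^sup>2) \<longlonglongrightarrow> cos (real j * x) / (real j)\<^sup>2" for j
      using tendsto_divide[OF tendsto_mult[OF tendsto_power[OF \<rho>1, of j] tendsto_const] tendsto_const, of "(real j)\<^sup>2" "cos (real j * x)"]
      by (cases "j = 0") auto
    have "norm (\<rho> k ^ j * cos (real j * x) / (real j)\<^sup>2) \<le> 1 / (real j)\<^sup>2" for j k
    proof -
      have "\<bar>\<rho> k ^ j * cos (real j * x)\<bar> \<le> 1 * 1"
        unfolding abs_mult using \<rho>[of k] by (intro mult_mono) (auto simp: power_le_one power_abs)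
      then show ?thesis by (simp add: divide_right_mono)
    qed
    then show "\<forall>\<^sub>F (j, k) in sequentially \<times>\<^sub>F sequentially.
        norm (\<rho> k ^ j * cos (real j * x) / (real j)\<^sup>2) \<le> 1 / (real j)\<^sup>2"
      by (auto intro: always_eventually)
  qed simp
  have "(\<Sum>j. cos (real j * t) / (real j)\<^sup>2) - (\<Sum>j. cos (real j * 0) / (real j)\<^sup>2) = t\<^sup>2 / 4 - pi * t / 2"
    using LIMSEQ_unique[OF tendsto_diff[OF lim2[of t] lim2[of 0]] 1] .
  then have "(\<Sum>j. cos (real j * t) / (real j)\<^sup>2) = pi\<^sup>2 / 6 - pi * t / 2 + t\<^sup>2 / 4"
    using zeta by (simp add: sums_iff)
  moreover have "summable (\<lambda>j. cos (real j * t) / (real j)\<^sup>2)"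
    by (rule summable_comparison_test'[OF sums_summable[OF zeta], of 0]) (simp add: divide_right_mono)
  ultimately show ?thesis by (simp add: sums_iff)
qed

section \<open>Eigenvalues and kernel of the Cramer--von Mises form\<close>

definition lam :: "nat \<Rightarrow> real" where
  "lam j = 1 / (pi * real j)\<^sup>2"

text \<open>The closed form of the integral over t in [0,1] of (1(x <= t) - t)(1(y <= t) - t). Its
  eigenfunctions are the cosines, with eigenvalues \<open>lam j\<close>; \<open>lam 0\<close> is 0
  through division by zero, so series may start at index 0.\<close>

definition cvm_kernel :: "real \<Rightarrow> real \<Rightarrow> real" where
  "cvm_kernel x y = 1 / 3 - max x y + (x\<^sup>2 + y\<^sup>2) / 2"

text \<open>The product of cosines splits into cosines at x + y and at the distance of x and y. Both
  numbers lie in [0,2], so after scaling by pi they stay in the range where the quadratic formula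
  holds.\<close>

lemma cvm_kernel_expansion:
  assumes "x \<in> {0..1}" "y \<in> {0..1}"
  shows "(\<lambda>j. lam j * (phi j x * phi j y)) sums cvm_kernel x y"
proof -
  have "(\<lambda>j. cos (real j * (pi * (x + y))) / (real j)\<^sup>2) sums
      (pi\<^sup>2 / 6 - pi * (pi * (x + y)) / 2 + (pi * (x + y))\<^sup>2 / 4)"
    by (rule cos_series_quadratic) (use assms in \<open>auto simp: mult.commute\<close>)
  moreover have "(\<lambda>j. cos (real j * (pi * \<bar>x - y\<bar>)) / (real j)\<^sup>2) sums
      (pi\<^sup>2 / 6 - pi * (pi * \<bar>x - y\<bar>) / 2 + (pi * \<bar>x - y\<bar>)\<^sup>2 / 4)"
    by (rule cos_series_quadratic) (use assms in \<open>auto simp: mult.commute abs_if\<close>)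
  ultimately have "(\<lambda>j. (cos (real j * (pi * (x + y))) / (real j)\<^sup>2 + cos (real j * (pi * \<bar>x - y\<bar>)) / (real j)\<^sup>2) / pi\<^sup>2)
      sums ((pi\<^sup>2 / 6 - pi * (pi * (x + y)) / 2 + (pi * (x + y))\<^sup>2 / 4 +
             (pi\<^sup>2 / 6 - pi * (pi * \<bar>x - y\<bar>) / 2 + (pi * \<bar>x - y\<bar>)\<^sup>2 / 4)) / pi\<^sup>2)"
    by (intro sums_divide sums_add)
  moreover have "(cos (real j * (pi * (x + y))) / (real j)\<^sup>2 + cos (real j * (pi * \<bar>x - y\<bar>)) / (real j)\<^sup>2) / pi\<^sup>2
      = lam j * (phi j x * phi j y)" for j
  proof -
    have c: "cos (real j * (pi * \<bar>x - y\<bar>)) = cos (pi * real j * x - pi * real j * y)"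
      by (cases "x \<ge> y") (auto simp: algebra_simps cos_diff)
    have d: "cos (real j * (pi * (x + y))) = cos (pi * real j * x + pi * real j * y)"
      by (simp add: algebra_simps)
    show ?thesis
      unfolding c d cos_add cos_diff lam_def phi_def
      by (cases "j = 0") (simp_all add: field_simps power2_eq_square)
  qed
  moreover have "(pi\<^sup>2 / 6 - pi * (pi * (x + y)) / 2 + (pi * (x + y))\<^sup>2 / 4 +
             (pi\<^sup>2 / 6 - pi * (pi * \<bar>x - y\<bar>) / 2 + (pi * \<bar>x - y\<bar>)\<^sup>2 / 4)) / pi\<^sup>2 = cvm_kernel x y"
    by (cases "x \<ge> y") (auto simp: cvm_kernel_def field_simps power2_eq_square max_def)
  ultimately show ?thesis by simp
qed

text \<open>For x \<le> y the integrand is t^2, then t^2 - t, then (1 - t)^2 on the three pieces, up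
  to the right endpoint of a piece, where an indicator has already switched on.\<close>

lemma cvm_kernel_integral:
  assumes "x \<in> {0..1}" "y \<in> {0..1}"
  shows "((\<lambda>t. (of_bool (x \<le> t) - t) * (of_bool (y \<le> t) - t)) has_integral cvm_kernel x y) {0..1}"
  using assms
proof (induction x y rule: linorder_wlog)
  case (le x y)
  let ?f = "\<lambda>t. (of_bool (x \<le> t) - t) * (of_bool (y \<le> t) - t)"
  have 1: "(?f has_integral (x ^ 3 / 3 - 0 ^ 3 / 3)) {0..x}"
  proof (rule has_integral_spike_finite[of "{x}"])
    show "((\<lambda>t. t\<^sup>2) has_integral (x ^ 3 / 3 - 0 ^ 3 / 3)) {0..x}"
      by (rule fundamental_theorem_of_calculus)
         (use le in \<open>auto intro!: derivative_eq_intros simp: has_real_derivative_iff_has_vector_derivative[symmetric]\<close>)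
  qed (use le in \<open>auto simp: power2_eq_square\<close>)
  have 2: "(?f has_integral ((y ^ 3 / 3 - y\<^sup>2 / 2) - (x ^ 3 / 3 - x\<^sup>2 / 2))) {x..y}"
  proof (rule has_integral_spike_finite[of "{y}"])
    show "((\<lambda>t. t\<^sup>2 - t) has_integral ((y ^ 3 / 3 - y\<^sup>2 / 2) - (x ^ 3 / 3 - x\<^sup>2 / 2))) {x..y}"
      by (rule fundamental_theorem_of_calculus)
         (use le in \<open>auto intro!: derivative_eq_intros simp: has_real_derivative_iff_has_vector_derivative[symmetric]\<close>)
  qed (use le in \<open>auto simp: power2_eq_square algebra_simps\<close>)
  have 3: "(?f has_integral ((1 ^ 3 / 3 - 1\<^sup>2 + 1) - (y ^ 3 / 3 - y\<^sup>2 + y))) {y..1}"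
  proof (rule has_integral_eq)
    show "((\<lambda>t. (1 - t)\<^sup>2) has_integral ((1 ^ 3 / 3 - 1\<^sup>2 + 1) - (y ^ 3 / 3 - y\<^sup>2 + y))) {y..1}"
      by (rule fundamental_theorem_of_calculus)
         (use le in \<open>auto intro!: derivative_eq_intros simp: has_real_derivative_iff_has_vector_derivative[symmetric] power2_eq_square algebra_simps\<close>)
  qed (use le in \<open>auto simp: power2_eq_square algebra_simps\<close>)
  have "(?f has_integral ((x ^ 3 / 3 - 0 ^ 3 / 3) + ((y ^ 3 / 3 - y\<^sup>2 / 2) - (x ^ 3 / 3 - x\<^sup>2 / 2))
     + ((1 ^ 3 / 3 - 1\<^sup>2 + 1) - (y ^ 3 / 3 - y\<^sup>2 + y)))) {0..1}"
    by (rule has_integral_combine[OF _ _ has_integral_combine[OF _ _ 1 2] 3]) (use le in auto)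
  moreover have "(x ^ 3 / 3 - 0 ^ 3 / 3) + ((y ^ 3 / 3 - y\<^sup>2 / 2) - (x ^ 3 / 3 - x\<^sup>2 / 2))
     + ((1 ^ 3 / 3 - 1\<^sup>2 + 1) - (y ^ 3 / 3 - y\<^sup>2 + y)) = cvm_kernel x y"
    using le by (simp add: cvm_kernel_def max_def field_simps)
  ultimately show ?case by simp
next
  case (sym x y)
  then show ?case by (simp add: cvm_kernel_def max.commute add.commute mult.commute)
qed

lemma ecdf_sum: "ecdf n X x = (\<Sum>i<n. of_bool (X i \<le> x)) / real n"
proof -
  have "{i \<in> {..<n}. X i \<le> x} = {..<n} \<inter> {i. X i \<le> x}" by auto
  then show ?thesis
    unfolding ecdf_def by (simp add: of_bool_def sum.If_cases)
qed

lemma cvm_kernel_sum: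
  assumes X: "\<And>i. i < n \<Longrightarrow> X i \<in> {0..1}" and n: "n > 0"
  shows "cvm n X = (\<Sum>i<n. \<Sum>k<n. cvm_kernel (X i) (X k)) / real n"
proof -
  define q where "q t = (\<Sum>i<n. \<Sum>k<n. (of_bool (X i \<le> t) - t) * (of_bool (X k \<le> t) - t))" for t
  have q: "(ecdf n X t - t)\<^sup>2 = q t / (real n)\<^sup>2" for t
  proof -
    have "ecdf n X t - t = (\<Sum>i<n. of_bool (X i \<le> t) - t) / real n"
      using n by (simp add: ecdf_sum sum_subtractf field_simps)
    then show ?thesis unfolding q_def by (simp add: power2_eq_square sum_product)
  qed
  have I: "(q has_integral (\<Sum>i<n. \<Sum>k<n. cvm_kernel (X i) (X k))) {0..1}"
    unfolding q_def by (intro has_integral_sum cvm_kernel_integral) (use X in auto)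
  then have I': "((\<lambda>t. (ecdf n X t - t)\<^sup>2) has_integral (\<Sum>i<n. \<Sum>k<n. cvm_kernel (X i) (X k)) / (real n)\<^sup>2) {0..1}"
    unfolding q by (rule has_integral_divide)
  have m: "(\<lambda>t. indicator {0..1} t *\<^sub>R (ecdf n X t - t)\<^sup>2) \<in> borel_measurable lborel"
    unfolding ecdf_sum of_bool_def by measurable
  have "integrable lborel (\<lambda>t. indicator {0..1} t *\<^sub>R (ecdf n X t - t)\<^sup>2)"
  proof (rule Bochner_Integration.integrable_bound)
    show "integrable lborel (\<lambda>t. indicator {0..1::real} t *\<^sub>R (1::real))" by simp
    have "\<bar>ecdf n X t - t\<bar> \<le> 1" if "t \<in> {0..1}" for t
    proof -
      have "(\<Sum>i<n. of_bool (X i \<le> t)) \<le> (\<Sum>i<n. 1::real)" by (rule sum_mono) auto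
      then have "0 \<le> ecdf n X t" "ecdf n X t \<le> 1"
        using n by (auto simp: ecdf_sum intro: sum_nonneg)
      then show ?thesis using that by auto
    qed
    then show "AE t in lborel. norm (indicator {0..1} t *\<^sub>R (ecdf n X t - t)\<^sup>2) \<le> norm (indicator {0..1} t *\<^sub>R (1::real))"
      by (intro AE_I2) (auto simp: indicator_def abs_square_le_1)
  qed (use m in auto)
  then have "(LBINT t:{0..1}. (ecdf n X t - t)\<^sup>2) = (\<Sum>i<n. \<Sum>k<n. cvm_kernel (X i) (X k)) / (real n)\<^sup>2"
    using I' by (subst set_borel_integral_eq_integral) (auto simp: set_integrable_def integral_unique)
  then show ?thesis unfolding cvm_def using n by (simp add: power2_eq_square)
qed

text \<open>Exact for every sample in [0,1]: inserting the kernel expansion into the double sum over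
  observations makes the j-th term a perfect square.\<close>

lemma cvm_expansion:
  assumes X: "\<And>i. i < n \<Longrightarrow> X i \<in> {0..1}" and n: "n > 0"
  shows "(\<lambda>j. lam j * ((\<Sum>i<n. phi j (X i)) / sqrt (real n))\<^sup>2) sums cvm n X"
proof -
  have "(\<lambda>j. (\<Sum>i<n. \<Sum>k<n. lam j * (phi j (X i) * phi j (X k))) / real n)
     sums ((\<Sum>i<n. \<Sum>k<n. cvm_kernel (X i) (X k)) / real n)"
    by (intro sums_divide sums_sum cvm_kernel_expansion) (use X in auto)
  moreover have "(\<Sum>i<n. \<Sum>k<n. lam j * (phi j (X i) * phi j (X k))) / real n =
     lam j * ((\<Sum>i<n. phi j (X i)) / sqrt (real n))\<^sup>2" for j
  proof -
    have "(\<Sum>i<n. \<Sum>k<n. lam j * (phi j (X i) * phi j (X k))) = lam j * (\<Sum>i<n. phi j (X i))\<^sup>2"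
      unfolding power2_eq_square sum_product by (simp only: sum_distrib_left)
    then show ?thesis using n by (simp add: power_divide)
  qed
  ultimately show ?thesis using cvm_kernel_sum[OF X n] by simp
qed

section \<open>Cosine scores of an i.i.d. sample\<close>

abbreviation iid :: "nat \<Rightarrow> real measure \<Rightarrow> (nat \<Rightarrow> real) measure" where
  "iid n \<mu> \<equiv> Pi\<^sub>M {..<n} (\<lambda>_. \<mu>)"

text \<open>Centred at the mean under the alternative rather than under the null, so that the noise
  has mean zero and all of the signal sits in the deterministic shift
  \<open>sqrt (real n) * \<theta> j\<close>.\<close>

definition cscore :: "(nat \<Rightarrow> real) \<Rightarrow> nat \<Rightarrow> (nat \<Rightarrow> real) \<Rightarrow> nat \<Rightarrow> real" where
  "cscore \<theta> n X j = (\<Sum>i<n. phi j (X i) - \<theta> j) / sqrt (real n)"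

lemma prob_space_iid: "prob_space \<mu> \<Longrightarrow> prob_space (iid n \<mu>)"
  by (rule prob_space_PiM)

lemma measurable_iid_component [measurable (raw)]:
  assumes "f \<in> borel_measurable \<mu>" "i < n"
  shows "(\<lambda>X. f (X i)) \<in> borel_measurable (iid n \<mu>)"
  using assms by (intro measurable_compose[OF measurable_component_singleton]) auto

lemma integrable_iid_bounded:
  fixes f :: "(nat \<Rightarrow> real) \<Rightarrow> 'b :: {banach, second_countable_topology}"
  assumes "prob_space \<mu>" "f \<in> borel_measurable (iid n \<mu>)" "\<And>x. norm (f x) \<le> B"
  shows "integrable (iid n \<mu>) f"
proof -
  interpret prob_space "iid n \<mu>" using assms(1) by (rule prob_space_iid)
  show ?thesis by (rule integrable_const_bound[of _ B]) (use assms in auto)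
qed

lemma integral_iid_prod:
  fixes f :: "nat \<Rightarrow> real \<Rightarrow> 'b :: {real_normed_field, banach, second_countable_topology}"
  assumes "prob_space \<mu>" "\<And>i. i < n \<Longrightarrow> integrable \<mu> (f i)"
  shows "(LINT X|iid n \<mu>. (\<Prod>i<n. f i (X i))) = (\<Prod>i<n. LINT x|\<mu>. f i x)"
proof -
  interpret prob_space \<mu> by fact
  interpret product_sigma_finite "\<lambda>_. \<mu>" by (rule product_sigma_finite.intro) unfold_locales
  show ?thesis by (rule product_integral_prod) (use assms in auto)
qed

section \<open>Moments and characteristic functions of the scores under one law\<close>

context
  fixes \<mu> :: "real measure" and \<theta> :: "nat \<Rightarrow> real"
  assumes law: "cos_law \<mu> \<theta>"
begin

interpretation \<mu>: prob_space \<mu> using law by (simp add: cos_law_def)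

lemma cos_law_sets [measurable_cong]: "sets \<mu> = sets borel"
  using law by (simp add: cos_law_def)

lemma cos_law_integrable_bounded:
  fixes f :: "real \<Rightarrow> 'b :: {banach, second_countable_topology}"
  assumes "f \<in> borel_measurable borel" "\<And>x. norm (f x) \<le> B"
  shows "integrable \<mu> f"
  by (rule \<mu>.integrable_const_bound[of _ B]) (use assms cos_law_sets in \<open>auto cong: measurable_cong_sets\<close>)

lemma cos_law_integrable_phi: "integrable \<mu> (phi j)"
  by (rule cos_law_integrable_bounded[of _ "sqrt 2"]) (auto intro: abs_phi_le)

lemma cos_law_integrable_phi_mult: "integrable \<mu> (\<lambda>x. phi j x * phi k x)"
proof (rule cos_law_integrable_bounded)
  show "norm (phi j x * phi k x) \<le> sqrt 2 * sqrt 2" for x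
    unfolding real_norm_def abs_mult by (intro mult_mono abs_phi_le) auto
qed measurable

lemma cos_law_mean: "1 \<le> m \<Longrightarrow> (LINT x|\<mu>. phi m x) = \<theta> m"
  using law by (simp add: cos_law_def)

lemma cos_law_coeff_le: "1 \<le> m \<Longrightarrow> \<bar>\<theta> m\<bar> \<le> sqrt 2"
proof -
  assume m: "1 \<le> m"
  have "\<bar>LINT x|\<mu>. phi m x\<bar> \<le> (LINT x|\<mu>. \<bar>phi m x\<bar>)" by (rule integral_abs_bound)
  also have "\<dots> \<le> (LINT x|\<mu>. sqrt 2)"
    by (rule integral_mono) (use cos_law_integrable_phi abs_phi_le in auto)
  finally show ?thesis using cos_law_mean[OF m] \<mu>.prob_space by simp
qed

text \<open>By \<open>phi_mult\<close> the second moments are again coefficients of \<theta>, apart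
  from the constant term on the diagonal. The product formula and the product of the two means each
  contribute at most \<open>sqrt 2 * \<epsilon>\<close>, and
  \<open>2 * sqrt 2 \<le> 3\<close>.\<close>

lemma cos_law_covariance:
  assumes jk: "1 \<le> j" "1 \<le> k" and \<epsilon>: "\<And>m. 1 \<le> m \<Longrightarrow> \<bar>\<theta> m\<bar> \<le> \<epsilon>"
  shows "\<bar>(LINT x|\<mu>. (phi j x - \<theta> j) * (phi k x - \<theta> k)) - of_bool (j = k)\<bar> \<le> 3 * \<epsilon>"
proof -
  have \<epsilon>0: "0 \<le> \<epsilon>" using \<epsilon>[of 1] by simp
  have main: "\<bar>(LINT x|\<mu>. phi a x * phi b x) - of_bool (a = b)\<bar> \<le> sqrt 2 * \<epsilon>" if ab: "b \<le> a" "1 \<le> b" for a b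
  proof -
    have "(LINT x|\<mu>. phi a x * phi b x) = ((LINT x|\<mu>. phi (a + b) x) + (LINT x|\<mu>. phi (a - b) x)) / sqrt 2"
      using ab by (simp add: phi_mult cos_law_integrable_phi)
    also have "(LINT x|\<mu>. phi (a + b) x) = \<theta> (a + b)" using ab by (intro cos_law_mean) auto
    finally have e: "(LINT x|\<mu>. phi a x * phi b x) = (\<theta> (a + b) + (LINT x|\<mu>. phi (a - b) x)) / sqrt 2" .
    have t1: "\<bar>\<theta> (a + b)\<bar> \<le> \<epsilon>" using ab by (intro \<epsilon>) auto
    have 2: "sqrt 2 * \<epsilon> = (2 * \<epsilon>) / sqrt 2" by (simp add: field_simps)
    show ?thesis
    proof (cases "a = b")
      case True
      then have "(LINT x|\<mu>. phi (a - b) x) = sqrt 2" using \<mu>.prob_space by (simp add: phi_def)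
      then have "(LINT x|\<mu>. phi a x * phi b x) - of_bool (a = b) = \<theta> (a + b) / sqrt 2"
        using e True by (simp add: add_divide_distrib)
      then show ?thesis using t1 \<epsilon>0 unfolding 2 by (simp add: divide_right_mono)
    next
      case False
      then have "(LINT x|\<mu>. phi (a - b) x) = \<theta> (a - b)" using ab by (intro cos_law_mean) auto
      moreover have "\<bar>\<theta> (a - b)\<bar> \<le> \<epsilon>" using False ab by (intro \<epsilon>) auto
      ultimately show ?thesis using t1 False e unfolding 2 by (simp add: divide_right_mono)
    qed
  qed
  have main': "\<bar>(LINT x|\<mu>. phi j x * phi k x) - of_bool (j = k)\<bar> \<le> sqrt 2 * \<epsilon>"
  proof (cases "k \<le> j")
    case False
    then have "\<bar>(LINT x|\<mu>. phi k x * phi j x) - of_bool (k = j)\<bar> \<le> sqrt 2 * \<epsilon>" using jk by (intro main) auto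
    moreover have "(LINT x|\<mu>. phi k x * phi j x) = (LINT x|\<mu>. phi j x * phi k x)"
      by (simp only: mult.commute)
    ultimately show ?thesis using False by auto
  qed (use main jk in auto)
  have "(LINT x|\<mu>. (phi j x - \<theta> j) * (phi k x - \<theta> k)) =
     (LINT x|\<mu>. phi j x * phi k x - \<theta> j * phi k x - \<theta> k * phi j x + \<theta> j * \<theta> k)"
    by (simp add: algebra_simps)
  also have "\<dots> = (LINT x|\<mu>. phi j x * phi k x) - \<theta> j * \<theta> k"
    using jk \<mu>.prob_space by (simp add: cos_law_integrable_phi cos_law_integrable_phi_mult cos_law_mean)
  finally have "\<bar>(LINT x|\<mu>. (phi j x - \<theta> j) * (phi k x - \<theta> k)) - of_bool (j = k)\<bar> \<le> sqrt 2 * \<epsilon> + \<bar>\<theta> j\<bar> * \<bar>\<theta> k\<bar>"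
    using main' by (simp add: abs_mult[symmetric])
  also have "\<bar>\<theta> j\<bar> * \<bar>\<theta> k\<bar> \<le> sqrt 2 * \<epsilon>"
    using jk \<epsilon>0 by (intro mult_mono cos_law_coeff_le \<epsilon>) auto
  also have "sqrt 2 * \<epsilon> + sqrt 2 * \<epsilon> \<le> 3 * \<epsilon>"
  proof -
    have "2 * sqrt 2 \<le> (3::real)" by (rule power2_le_imp_le) (auto simp: power_mult_distrib)
    from mult_right_mono[OF this \<epsilon>0] show ?thesis by (simp add: mult_ac)
  qed
  finally show ?thesis by simp
qed

lemma cscore_measurable [measurable]: "(\<lambda>X. cscore \<theta> n X j) \<in> borel_measurable (iid n \<mu>)"
proof -
  have [measurable]: "phi j \<in> borel_measurable \<mu>" by measurable
  show ?thesis unfolding cscore_def by measurable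
qed

lemma abs_cscore_le:
  assumes "1 \<le> j"
  shows "\<bar>cscore \<theta> n X j\<bar> \<le> 2 * sqrt 2 * sqrt (real n)"
proof -
  have "\<bar>\<Sum>i<n. phi j (X i) - \<theta> j\<bar> \<le> (\<Sum>i<n. 2 * sqrt 2)"
  proof (rule order_trans[OF sum_abs sum_mono])
    fix i show "\<bar>phi j (X i) - \<theta> j\<bar> \<le> 2 * sqrt 2"
      using abs_phi_le[of j "X i"] cos_law_coeff_le[OF assms] by linarith
  qed
  then have "\<bar>cscore \<theta> n X j\<bar> \<le> real n * (2 * sqrt 2) / sqrt (real n)"
    unfolding cscore_def by (simp add: divide_right_mono)
  also have "\<dots> = 2 * sqrt 2 * sqrt (real n)"
    by (cases "n = 0") (auto simp: field_simps)
  finally show ?thesis .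
qed

text \<open>Cross terms vanish by independence and centring. The remaining variance of one
  \<open>phi j\<close> is at most 2 because its square is, so the bound is the same for all
  frequencies, sample sizes and laws.\<close>

lemma cscore_second_moment:
  assumes j: "1 \<le> j"
  shows "(LINT X|iid n \<mu>. (cscore \<theta> n X j)\<^sup>2) \<le> 2"
proof -
  define g where "g x = phi j x - \<theta> j" for x
  have [measurable]: "g \<in> borel_measurable borel" unfolding g_def by measurable
  have gb: "norm (g x) \<le> 2 * sqrt 2" for x
    unfolding g_def using abs_phi_le[of j x] cos_law_coeff_le[OF j] by (simp add: abs_if split: if_splits)
  have gi: "integrable \<mu> g" unfolding g_def using cos_law_integrable_phi by simp
  have g0: "(LINT x|\<mu>. g x) = 0"
    unfolding g_def using cos_law_integrable_phi cos_law_mean[OF j] \<mu>.prob_space by simp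
  have g2b: "norm (g x * g x) \<le> (2 * sqrt 2) * (2 * sqrt 2)" for x
    unfolding norm_mult by (intro mult_mono gb) auto
  have g2i: "integrable \<mu> (\<lambda>x. g x * g x)" by (rule cos_law_integrable_bounded[OF _ g2b]) simp
  have g2: "(LINT x|\<mu>. g x * g x) \<le> 2"
  proof -
    have "(LINT x|\<mu>. g x * g x) = (LINT x|\<mu>. phi j x * phi j x - 2 * \<theta> j * phi j x + \<theta> j * \<theta> j)"
      unfolding g_def by (simp add: algebra_simps)
    also have "\<dots> = (LINT x|\<mu>. phi j x * phi j x) - (\<theta> j)\<^sup>2"
      using j \<mu>.prob_space by (simp add: cos_law_integrable_phi cos_law_integrable_phi_mult cos_law_mean power2_eq_square)
    also have "\<dots> \<le> (LINT x|\<mu>. phi j x * phi j x)" by simp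
    also have "\<dots> \<le> (LINT x|\<mu>. 2)"
      using phi_sq_le[of j] by (intro integral_mono cos_law_integrable_phi_mult) (auto simp: power2_eq_square)
    finally show ?thesis using \<mu>.prob_space by simp
  qed
  have cross: "(LINT X|iid n \<mu>. g (X i) * g (X k)) = (if i = k then (LINT x|\<mu>. g x * g x) else 0)"
    if ik: "i < n" "k < n" for i k
  proof -
    \<comment> \<open>Writes the product of two coordinates as a product over all of them, as the
      product formula for integrals requires; for i = k both factors fall on the same
      coordinate.\<close>
    define h where "h m x = (if m = i then g x else 1) * (if m = k then g x else 1)" for m x
    have hi: "integrable \<mu> (h m)" for m
      unfolding h_def using gi g2i by (cases "m = i"; cases "m = k") auto
    have "(\<Prod>m<n. h m (X m)) = g (X i) * g (X k)" for X
      unfolding h_def prod.distrib using ik by (simp add: prod.delta)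
    then have "(LINT X|iid n \<mu>. g (X i) * g (X k)) = (\<Prod>m<n. LINT x|\<mu>. h m x)"
      using integral_iid_prod[of \<mu> n h] hi \<mu>.prob_space_axioms by simp
    also have "\<dots> = (if i = k then (LINT x|\<mu>. g x * g x) else 0)"
    proof (cases "i = k")
      case True
      have "(LINT x|\<mu>. h m x) = (if m = i then (LINT x|\<mu>. g x * g x) else 1)" for m
        unfolding h_def using True \<mu>.prob_space by auto
      then show ?thesis using True ik by (simp add: prod.delta)
    next
      case False
      then have "(LINT x|\<mu>. h i x) = 0" unfolding h_def using g0 by simp
      then show ?thesis using False ik by auto
    qed
    finally show ?thesis .
  qed
  have int: "integrable (iid n \<mu>) (\<lambda>X. g (X i) * g (X k))" if ik: "i < n" "k < n" for i k
  proof (rule integrable_iid_bounded[OF \<mu>.prob_space_axioms])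
    have [measurable]: "g \<in> borel_measurable \<mu>" by measurable
    show "(\<lambda>X. g (X i) * g (X k)) \<in> borel_measurable (iid n \<mu>)" using ik by measurable
    show "norm (g (x i) * g (x k)) \<le> (2 * sqrt 2) * (2 * sqrt 2)" for x
      unfolding norm_mult by (intro mult_mono gb) auto
  qed
  have sq: "(cscore \<theta> n X j)\<^sup>2 = (\<Sum>i<n. \<Sum>k<n. g (X i) * g (X k)) / real n" for X
    unfolding cscore_def g_def[symmetric] power_divide by (simp add: power2_eq_square sum_product)
  have "(LINT X|iid n \<mu>. (cscore \<theta> n X j)\<^sup>2) = (\<Sum>i<n. \<Sum>k<n. if i = k then (LINT x|\<mu>. g x * g x) else 0) / real n"
  proof -
    have "(LINT X|iid n \<mu>. (\<Sum>i<n. \<Sum>k<n. g (X i) * g (X k))) = (\<Sum>i<n. \<Sum>k<n. LINT X|iid n \<mu>. g (X i) * g (X k))"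
    proof (subst Bochner_Integration.integral_sum)
      show "integrable (iid n \<mu>) (\<lambda>X. \<Sum>k<n. g (X i) * g (X k))" if "i \<in> {..<n}" for i
        using int that by auto
      show "(\<Sum>i<n. LINT X|iid n \<mu>. (\<Sum>k<n. g (X i) * g (X k))) = (\<Sum>i<n. \<Sum>k<n. LINT X|iid n \<mu>. g (X i) * g (X k))"
        by (intro sum.cong refl Bochner_Integration.integral_sum int) auto
    qed
    also have "\<dots> = (\<Sum>i<n. \<Sum>k<n. if i = k then (LINT x|\<mu>. g x * g x) else 0)"
      by (intro sum.cong cross) auto
    finally show ?thesis unfolding sq by simp
  qed
  also have "\<dots> = (\<Sum>i<n. (LINT x|\<mu>. g x * g x)) / real n" by (simp add: sum.delta)
  also have "\<dots> \<le> 2" using g2 by (cases "n = 0") auto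
  finally show ?thesis .
qed

text \<open>A quantitative central limit theorem. The characteristic function is the n-th power of
  that of one summand, and for numbers of modulus at most 1 the n-th powers differ by at most n
  times the difference of the bases. The assumption on the weights is exactly what keeps the Taylor
  base \<open>1 - S / (2 * n)\<close> above -1. The error consists of the cubic Taylor remainder and
  of the deviation of the covariance from the identity.\<close>

lemma cscore_char_approx:
  fixes w :: "nat \<Rightarrow> real"
  assumes J: "finite J" "0 \<notin> J" and \<epsilon>: "\<And>m. 1 \<le> m \<Longrightarrow> \<bar>\<theta> m\<bar> \<le> \<epsilon>"
    and n: "0 < n" "(\<Sum>j\<in>J. (w j)\<^sup>2) \<le> 4 * real n"
  defines "A \<equiv> \<Sum>j\<in>J. \<bar>w j\<bar>"
  shows "cmod ((CLINT X|iid n \<mu>. iexp (\<Sum>j\<in>J. w j * cscore \<theta> n X j)) -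
            of_real ((1 + (- (\<Sum>j\<in>J. (w j)\<^sup>2) / 2) / real n) ^ n))
      \<le> (2 * sqrt 2 * A) ^ 3 / (6 * sqrt (real n)) + 3 / 2 * \<epsilon> * A\<^sup>2"
proof -
  define V where "V x = (\<Sum>j\<in>J. w j * (phi j x - \<theta> j))" for x
  define B where "B = 2 * sqrt 2 * A"
  define S where "S = (\<Sum>j\<in>J. (w j)\<^sup>2)"
  have J1: "1 \<le> j" if "j \<in> J" for j using J that by (cases j) auto
  have A0: "0 \<le> A" unfolding A_def by (rule sum_nonneg) auto
  have Vm [measurable]: "V \<in> borel_measurable borel" unfolding V_def by measurable
  have VB: "\<bar>V x\<bar> \<le> B" for x
  proof -
    have "\<bar>V x\<bar> \<le> (\<Sum>j\<in>J. \<bar>w j\<bar> * (2 * sqrt 2))"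
      unfolding V_def
    proof (rule order_trans[OF sum_abs sum_mono])
      fix j assume "j \<in> J"
      then show "\<bar>w j * (phi j x - \<theta> j)\<bar> \<le> \<bar>w j\<bar> * (2 * sqrt 2)"
        unfolding abs_mult using abs_phi_le[of j x] cos_law_coeff_le[OF J1, of j]
        by (intro mult_left_mono) (auto simp: abs_if split: if_splits)
    qed
    then show ?thesis by (simp add: B_def A_def sum_distrib_left mult.commute mult.left_commute)
  qed
  have B0: "0 \<le> B" using VB[of 0] by linarith
  have Vi: "integrable \<mu> V" by (rule cos_law_integrable_bounded[of _ B]) (use VB in auto)
  have V2i: "integrable \<mu> (\<lambda>x. (V x)\<^sup>2)"
    by (rule cos_law_integrable_bounded[of _ "B\<^sup>2"]) (use VB B0 in \<open>auto simp: abs_le_square_iff[symmetric]\<close>)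
  have V0: "(LINT x|\<mu>. V x) = 0"
    unfolding V_def using cos_law_integrable_phi J1 \<mu>.prob_space
    by (simp add: cos_law_mean Bochner_Integration.integral_sum)
  define v where "v = (LINT x|\<mu>. (V x)\<^sup>2)"
  \<comment> \<open>The variance of \<open>V\<close> is the covariance matrix evaluated at
    \<open>w\<close>; \<open>S\<close> is the identity matrix evaluated at \<open>w\<close>.\<close>
  have vS: "\<bar>v - S\<bar> \<le> 3 * \<epsilon> * A\<^sup>2"
  proof -
    define C where "C j k = (LINT x|\<mu>. (phi j x - \<theta> j) * (phi k x - \<theta> k))" for j k
    have Ci: "integrable \<mu> (\<lambda>x. (phi j x - \<theta> j) * (phi k x - \<theta> k))" for j k
      using cos_law_integrable_phi cos_law_integrable_phi_mult by (simp add: algebra_simps)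
    have "(V x)\<^sup>2 = (\<Sum>j\<in>J. \<Sum>k\<in>J. w j * w k * ((phi j x - \<theta> j) * (phi k x - \<theta> k)))" for x
      unfolding V_def power2_eq_square sum_product by (simp add: mult_ac)
    then have "v = (\<Sum>j\<in>J. \<Sum>k\<in>J. w j * w k * C j k)"
      unfolding v_def C_def using Ci by (simp add: Bochner_Integration.integral_sum)
    moreover have "S = (\<Sum>j\<in>J. \<Sum>k\<in>J. w j * w k * of_bool (j = k))"
      unfolding S_def using J by (simp add: power2_eq_square)
    ultimately have "v - S = (\<Sum>j\<in>J. \<Sum>k\<in>J. w j * w k * (C j k - of_bool (j = k)))"
      by (simp only: sum_subtractf[symmetric] right_diff_distrib)
    also have "\<bar>\<dots>\<bar> \<le> (\<Sum>j\<in>J. \<Sum>k\<in>J. \<bar>w j\<bar> * \<bar>w k\<bar> * (3 * \<epsilon>))"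
      unfolding C_def
      by (intro order_trans[OF sum_abs] sum_mono) (unfold abs_mult, intro mult_left_mono cos_law_covariance, use J1 \<epsilon> in auto)
    also have "\<dots> = 3 * \<epsilon> * A\<^sup>2"
      unfolding A_def power2_eq_square sum_product by (simp add: sum_distrib_left mult_ac)
    finally show ?thesis .
  qed
  define p where "p = (CLINT x|\<mu>. iexp (V x / sqrt (real n)))"
  have ei: "integrable \<mu> (\<lambda>x. iexp (V x / sqrt (real n)))"
    by (rule cos_law_integrable_bounded[of _ 1]) auto
  have "(CLINT X|iid n \<mu>. iexp (\<Sum>j\<in>J. w j * cscore \<theta> n X j)) = (CLINT X|iid n \<mu>. (\<Prod>i<n. iexp (V (X i) / sqrt (real n))))"
  proof (rule Bochner_Integration.integral_cong[OF refl])
    fix X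
    have "(\<Sum>j\<in>J. w j * cscore \<theta> n X j) = (\<Sum>j\<in>J. \<Sum>i<n. w j * (phi j (X i) - \<theta> j)) / sqrt (real n)"
      unfolding cscore_def by (simp add: sum_distrib_left sum_divide_distrib)
    also have "\<dots> = (\<Sum>i<n. V (X i) / sqrt (real n))"
      unfolding V_def by (subst sum.swap) (simp add: sum_divide_distrib)
    finally show "iexp (\<Sum>j\<in>J. w j * cscore \<theta> n X j) = (\<Prod>i<n. iexp (V (X i) / sqrt (real n)))"
      by (simp add: exp_sum sum_distrib_left)
  qed
  also have "\<dots> = p ^ n"
    using integral_iid_prod[OF \<mu>.prob_space_axioms, of n "\<lambda>_ x. iexp (V x / sqrt (real n))"] ei
    by (simp add: p_def)
  finally have lhs: "(CLINT X|iid n \<mu>. iexp (\<Sum>j\<in>J. w j * cscore \<theta> n X j)) = p ^ n" .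
  define q where "q = 1 + (- S / 2) / real n"
  have q1: "\<bar>q\<bar> \<le> 1"
  proof -
    have "0 \<le> S" unfolding S_def by (rule sum_nonneg) auto
    then show ?thesis using n unfolding q_def S_def[symmetric] by (auto simp: abs_le_iff field_simps)
  qed
  have p1: "cmod p \<le> 1"
  proof -
    have "cmod p \<le> (LINT x|\<mu>. cmod (iexp (V x / sqrt (real n))))"
      unfolding p_def by (rule integral_norm_bound)
    then show ?thesis using \<mu>.prob_space by simp
  qed
  have pv: "cmod (p - of_real (1 - v / (2 * real n))) \<le> B ^ 3 / (6 * real n * sqrt (real n))"
  proof -
    define y where "y x = V x / sqrt (real n)" for x
    have ym [measurable]: "y \<in> borel_measurable borel" unfolding y_def by measurable
    have yi: "integrable \<mu> y" unfolding y_def using Vi by simp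
    have y2: "(y x)\<^sup>2 = (V x)\<^sup>2 / real n" for x unfolding y_def by (simp add: power_divide)
    have y2i: "integrable \<mu> (\<lambda>x. (y x)\<^sup>2)" unfolding y2 using V2i by simp
    have taylor: "(\<Sum>k\<le>2. (\<i> * complex_of_real t) ^ k / fact k) = \<i> * of_real t + of_real (1 - t\<^sup>2 / 2)" for t
      by (simp add: numeral_2_eq_2 power_mult_distrib)
    have i1: "integrable \<mu> (\<lambda>x. \<i> * complex_of_real (y x))"
      using yi by (intro integrable_mult_right integrable_of_real)
    have i2: "integrable \<mu> (\<lambda>x. complex_of_real (1 - (y x)\<^sup>2 / 2))"
      using y2i by (intro integrable_of_real) simp
    note ti = Bochner_Integration.integrable_add[OF i1 i2]
    have "(CLINT x|\<mu>. \<i> * of_real (y x) + of_real (1 - (y x)\<^sup>2 / 2)) = \<i> * of_real (LINT x|\<mu>. y x) + of_real (LINT x|\<mu>. 1 - (y x)\<^sup>2 / 2)"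
      by (simp only: Bochner_Integration.integral_add[OF i1 i2] integral_mult_right_zero integral_complex_of_real)
    also have "\<dots> = of_real (1 - v / (2 * real n))"
    proof -
      have "(LINT x|\<mu>. y x) = 0" unfolding y_def using V0 by simp
      moreover have "(LINT x|\<mu>. 1 - (y x)\<^sup>2 / 2) = 1 - v / (2 * real n)"
        unfolding y2 v_def using V2i \<mu>.prob_space by simp
      ultimately show ?thesis by simp
    qed
    finally have "p - of_real (1 - v / (2 * real n)) =
       (CLINT x|\<mu>. iexp (y x) - (\<i> * of_real (y x) + of_real (1 - (y x)\<^sup>2 / 2)))"
      using ei ti unfolding p_def y_def[symmetric] by simp
    also have "cmod \<dots> \<le> (LINT x|\<mu>. cmod (iexp (y x) - (\<i> * of_real (y x) + of_real (1 - (y x)\<^sup>2 / 2))))"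
      by (rule integral_norm_bound)
    also have "\<dots> \<le> (LINT x|\<mu>. (B / sqrt (real n)) ^ 3 / 6)"
    proof (rule integral_mono)
      fix x
      have "cmod (iexp (y x) - (\<i> * of_real (y x) + of_real (1 - (y x)\<^sup>2 / 2))) \<le> \<bar>y x\<bar> ^ 3 / 6"
        using iexp_approx1[of "y x" 2] unfolding taylor by (simp add: numeral_3_eq_3 fact_numeral)
      also have "\<bar>y x\<bar> \<le> B / sqrt (real n)" unfolding y_def using VB[of x] by (simp add: divide_right_mono)
      then have "\<bar>y x\<bar> ^ 3 / 6 \<le> (B / sqrt (real n)) ^ 3 / 6" by (intro divide_right_mono power_mono) auto
      finally show "cmod (iexp (y x) - (\<i> * of_real (y x) + of_real (1 - (y x)\<^sup>2 / 2))) \<le> (B / sqrt (real n)) ^ 3 / 6" .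
    qed (use ei ti in \<open>auto simp: y_def[symmetric]\<close>)
    also have "\<dots> = B ^ 3 / (6 * real n * sqrt (real n))"
      using \<mu>.prob_space n by (simp add: power_divide power3_eq_cube)
    finally show ?thesis .
  qed
  have "cmod (p ^ n - of_real q ^ n) \<le> real n * cmod (p - of_real q)"
    by (rule norm_power_diff) (use p1 q1 in auto)
  also have "cmod (p - of_real q) \<le> B ^ 3 / (6 * real n * sqrt (real n)) + 3 * \<epsilon> * A\<^sup>2 / (2 * real n)"
  proof -
    have "p - of_real q = (p - of_real (1 - v / (2 * real n))) + of_real ((S - v) / (2 * real n))"
      unfolding q_def by (simp add: diff_divide_distrib)
    also have "cmod \<dots> \<le> cmod (p - of_real (1 - v / (2 * real n))) + \<bar>(S - v) / (2 * real n)\<bar>"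
      by (rule order_trans[OF norm_triangle_ineq]) (simp only: norm_of_real order_refl)
    also have "\<bar>(S - v) / (2 * real n)\<bar> \<le> 3 * \<epsilon> * A\<^sup>2 / (2 * real n)"
      using vS by (simp add: abs_minus_commute divide_right_mono)
    finally show ?thesis using pv by linarith
  qed
  then have "real n * cmod (p - of_real q) \<le> real n * (B ^ 3 / (6 * real n * sqrt (real n)) + 3 * \<epsilon> * A\<^sup>2 / (2 * real n))"
    by (rule mult_left_mono) simp
  also have "\<dots> = B ^ 3 / (6 * sqrt (real n)) + 3 / 2 * \<epsilon> * A\<^sup>2"
    using n by (simp add: field_simps)
  finally show ?thesis unfolding lhs B_def S_def q_def by simp
qed

end

section \<open>Laplace transforms of quadratic forms\<close>

abbreviation gaussian :: "nat set \<Rightarrow> (nat \<Rightarrow> real) measure" where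
  "gaussian J \<equiv> Pi\<^sub>M J (\<lambda>_. std_normal_distribution)"

lemma prob_space_std_normal: "prob_space std_normal_distribution"
  by (rule prob_space_normal_density) simp

lemma prob_space_gaussian: "prob_space (gaussian J)"
  by (rule prob_space_PiM) (rule prob_space_std_normal)

interpretation std_normal: prob_space std_normal_distribution
  by (rule prob_space_std_normal)

interpretation gaussian: prob_space "gaussian J" for J
  by (rule prob_space_gaussian)

interpretation std_normal_product: product_sigma_finite "\<lambda>_. std_normal_distribution"
  by (rule product_sigma_finite.intro) unfold_locales

lemma measurable_gaussian_component [measurable (raw)]:
  "j \<in> J \<Longrightarrow> (\<lambda>z. z j) \<in> borel_measurable (gaussian J)"
  using measurable_component_singleton[of j J "\<lambda>_. std_normal_distribution"]
  by (simp cong: measurable_cong_sets)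

lemma gaussian_char:
  assumes "finite J"
  shows "(CLINT z|gaussian J. iexp (\<Sum>j\<in>J. y j * z j)) = of_real (exp (- (\<Sum>j\<in>J. (y j)\<^sup>2) / 2))"
proof -
  have i: "integrable std_normal_distribution (\<lambda>x. iexp (y j * x))" for j
    by (rule std_normal.integrable_const_bound[of _ 1]) auto
  have "(CLINT z|gaussian J. iexp (\<Sum>j\<in>J. y j * z j)) = (CLINT z|gaussian J. (\<Prod>j\<in>J. iexp (y j * z j)))"
    using assms by (simp add: exp_sum sum_distrib_left)
  also have "\<dots> = (\<Prod>j\<in>J. (CLINT x|std_normal_distribution. iexp (y j * x)))"
    by (rule std_normal_product.product_integral_prod[OF assms i])
  also have "\<dots> = (\<Prod>j\<in>J. of_real (exp (- (y j)\<^sup>2 / 2)))"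
    using char_std_normal_distribution by (simp add: char_def fun_eq_iff)
  also have "\<dots> = of_real (exp (\<Sum>j\<in>J. - (y j)\<^sup>2 / 2))"
    using assms by (simp add: exp_sum)
  also have "(\<Sum>j\<in>J. - (y j)\<^sup>2 / 2) = - (\<Sum>j\<in>J. (y j)\<^sup>2) / 2"
    by (simp add: sum_negf sum_divide_distrib)
  finally show ?thesis .
qed

text \<open>\<open>exp (- y\<^sup>2 / 2)\<close> is the characteristic function of a standard normal variable, so the
  Laplace transform of a shifted quadratic form is a Gaussian average of characteristic functions
  in which the shift enters only through factors of modulus one.\<close>

lemma gaussian_average_char:
  fixes Y :: "nat \<Rightarrow> 'a \<Rightarrow> real"
  assumes "prob_space M" "finite J" "\<And>j. j \<in> J \<Longrightarrow> Y j \<in> borel_measurable M"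
  shows "complex_of_real (LINT \<omega>|M. exp (- (\<Sum>j\<in>J. (Y j \<omega> + a j)\<^sup>2) / 2)) =
      (CLINT z|gaussian J. iexp (\<Sum>j\<in>J. z j * a j) * (CLINT \<omega>|M. iexp (\<Sum>j\<in>J. z j * Y j \<omega>)))"
    and "(\<lambda>z. CLINT \<omega>|M. iexp (\<Sum>j\<in>J. z j * Y j \<omega>)) \<in> borel_measurable (gaussian J)"
proof -
  interpret M: prob_space M by fact
  interpret P: pair_prob_space M "gaussian J" by unfold_locales
  interpret P': pair_prob_space "gaussian J" M by unfold_locales
  note [measurable] = assms(3)
  define f where "f \<omega> z = iexp (\<Sum>j\<in>J. (Y j \<omega> + a j) * z j)" for \<omega> z
  have fm: "(\<lambda>(\<omega>, z). f \<omega> z) \<in> borel_measurable (M \<Otimes>\<^sub>M gaussian J)"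
  proof -
    have "(\<lambda>p. Y j (fst p)) \<in> borel_measurable (M \<Otimes>\<^sub>M gaussian J)"
      "(\<lambda>p. snd p j) \<in> borel_measurable (M \<Otimes>\<^sub>M gaussian J)" if "j \<in> J" for j
      using that by (auto intro: measurable_compose[OF measurable_fst assms(3)] measurable_compose[OF measurable_snd measurable_gaussian_component])
    then have [measurable]: "(\<lambda>p. \<Sum>j\<in>J. (Y j (fst p) + a j) * snd p j) \<in> borel_measurable (M \<Otimes>\<^sub>M gaussian J)"
      by (intro borel_measurable_sum borel_measurable_times borel_measurable_add) auto
    show ?thesis unfolding f_def case_prod_beta by measurable
  qed
  have fi: "integrable (M \<Otimes>\<^sub>M gaussian J) (\<lambda>(\<omega>, z). f \<omega> z)"
    by (rule P.integrable_const_bound[of _ 1, OF _ fm]) (auto simp: f_def)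
  have "complex_of_real (LINT \<omega>|M. exp (- (\<Sum>j\<in>J. (Y j \<omega> + a j)\<^sup>2) / 2)) =
     (CLINT \<omega>|M. of_real (exp (- (\<Sum>j\<in>J. (Y j \<omega> + a j)\<^sup>2) / 2)))"
    by (rule integral_complex_of_real[symmetric])
  also have "\<dots> = (CLINT \<omega>|M. (CLINT z|gaussian J. f \<omega> z))"
    unfolding f_def by (simp only: gaussian_char[OF assms(2)])
  also have "\<dots> = (CLINT z|gaussian J. (CLINT \<omega>|M. f \<omega> z))"
    by (rule P.Fubini_integral[OF fi, symmetric])
  also have "\<dots> = (CLINT z|gaussian J. iexp (\<Sum>j\<in>J. z j * a j) * (CLINT \<omega>|M. iexp (\<Sum>j\<in>J. z j * Y j \<omega>)))"
  proof (rule Bochner_Integration.integral_cong[OF refl])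
    fix z
    have "f \<omega> z = iexp (\<Sum>j\<in>J. z j * a j) * iexp (\<Sum>j\<in>J. z j * Y j \<omega>)" for \<omega>
      unfolding f_def exp_add[symmetric] distrib_left[symmetric] of_real_add[symmetric] sum.distrib[symmetric]
      by (simp add: algebra_simps)
    then show "(CLINT \<omega>|M. f \<omega> z) = iexp (\<Sum>j\<in>J. z j * a j) * (CLINT \<omega>|M. iexp (\<Sum>j\<in>J. z j * Y j \<omega>))"
      by simp
  qed
  finally show "complex_of_real (LINT \<omega>|M. exp (- (\<Sum>j\<in>J. (Y j \<omega> + a j)\<^sup>2) / 2)) =
      (CLINT z|gaussian J. iexp (\<Sum>j\<in>J. z j * a j) * (CLINT \<omega>|M. iexp (\<Sum>j\<in>J. z j * Y j \<omega>)))" .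
  show "(\<lambda>z. CLINT \<omega>|M. iexp (\<Sum>j\<in>J. z j * Y j \<omega>)) \<in> borel_measurable (gaussian J)"
  proof (rule M.borel_measurable_lebesgue_integral)
    have "(\<lambda>p. Y j (snd p)) \<in> borel_measurable (gaussian J \<Otimes>\<^sub>M M)"
      "(\<lambda>p. fst p j) \<in> borel_measurable (gaussian J \<Otimes>\<^sub>M M)" if "j \<in> J" for j
      using that by (auto intro: measurable_compose[OF measurable_snd assms(3)] measurable_compose[OF measurable_fst measurable_gaussian_component])
    then have [measurable]: "(\<lambda>p. \<Sum>j\<in>J. fst p j * Y j (snd p)) \<in> borel_measurable (gaussian J \<Otimes>\<^sub>M M)"
      by (intro borel_measurable_sum borel_measurable_times) auto
    show "(\<lambda>(z, \<omega>). iexp (\<Sum>j\<in>J. z j * Y j \<omega>)) \<in> borel_measurable (gaussian J \<Otimes>\<^sub>M M)"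
      unfolding case_prod_beta by measurable
  qed
qed

text \<open>The right-hand side does not contain \<open>a\<close>: a factor of modulus one drops out
  of the norm. A bound obtained from it holds for arbitrary shifts, also for unbounded ones that
  vary with the sample size.\<close>

lemma laplace_difference_le:
  fixes Y :: "nat \<Rightarrow> 'a \<Rightarrow> real" and W :: "nat \<Rightarrow> 'b \<Rightarrow> real"
  assumes M: "prob_space M" "\<And>j. j \<in> J \<Longrightarrow> Y j \<in> borel_measurable M"
    and M': "prob_space M'" "\<And>j. j \<in> J \<Longrightarrow> W j \<in> borel_measurable M'"
    and J: "finite J"
  shows "\<bar>(LINT \<omega>|M. exp (- (\<Sum>j\<in>J. (Y j \<omega> + a j)\<^sup>2) / 2)) - (LINT \<omega>|M'. exp (- (\<Sum>j\<in>J. (W j \<omega> + a j)\<^sup>2) / 2))\<bar>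
    \<le> (LINT z|gaussian J. cmod ((CLINT \<omega>|M. iexp (\<Sum>j\<in>J. z j * Y j \<omega>)) - (CLINT \<omega>|M'. iexp (\<Sum>j\<in>J. z j * W j \<omega>))))"
proof -
  define \<psi> where "\<psi> z = (CLINT \<omega>|M. iexp (\<Sum>j\<in>J. z j * Y j \<omega>))" for z
  define \<psi>' where "\<psi>' z = (CLINT \<omega>|M'. iexp (\<Sum>j\<in>J. z j * W j \<omega>))" for z
  define e where "e z = iexp (\<Sum>j\<in>J. z j * a j)" for z
  have 1: "complex_of_real (LINT \<omega>|M. exp (- (\<Sum>j\<in>J. (Y j \<omega> + a j)\<^sup>2) / 2)) = (CLINT z|gaussian J. e z * \<psi> z)"
    unfolding \<psi>_def e_def by (rule gaussian_average_char(1)[OF M(1) J M(2)])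
  have 2: "complex_of_real (LINT \<omega>|M'. exp (- (\<Sum>j\<in>J. (W j \<omega> + a j)\<^sup>2) / 2)) = (CLINT z|gaussian J. e z * \<psi>' z)"
    unfolding \<psi>'_def e_def by (rule gaussian_average_char(1)[OF M'(1) J M'(2)])
  have le: "cmod (\<psi> z) \<le> 1" "cmod (\<psi>' z) \<le> 1" for z
    unfolding \<psi>_def \<psi>'_def
    using integral_norm_bound[of M "\<lambda>\<omega>. iexp (\<Sum>j\<in>J. z j * Y j \<omega>)"] prob_space.prob_space[OF M(1)]
      integral_norm_bound[of M' "\<lambda>\<omega>. iexp (\<Sum>j\<in>J. z j * W j \<omega>)"] prob_space.prob_space[OF M'(1)]
    by simp_all
  have em [measurable]: "e \<in> borel_measurable (gaussian J)" unfolding e_def by measurable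
  have [measurable]: "\<psi> \<in> borel_measurable (gaussian J)" "\<psi>' \<in> borel_measurable (gaussian J)"
    unfolding \<psi>_def \<psi>'_def
    by (rule gaussian_average_char(2)[OF M(1) J M(2)], assumption) (rule gaussian_average_char(2)[OF M'(1) J M'(2)], assumption)
  have ne: "cmod (e z) = 1" for z by (simp add: e_def)
  have i: "integrable (gaussian J) (\<lambda>z. e z * \<psi> z)" "integrable (gaussian J) (\<lambda>z. e z * \<psi>' z)"
    using le by (auto intro!: gaussian.integrable_const_bound[where B = 1] simp: norm_mult ne)
  have "\<bar>(LINT \<omega>|M. exp (- (\<Sum>j\<in>J. (Y j \<omega> + a j)\<^sup>2) / 2)) - (LINT \<omega>|M'. exp (- (\<Sum>j\<in>J. (W j \<omega> + a j)\<^sup>2) / 2))\<bar>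
     = cmod (complex_of_real (LINT \<omega>|M. exp (- (\<Sum>j\<in>J. (Y j \<omega> + a j)\<^sup>2) / 2)) - complex_of_real (LINT \<omega>|M'. exp (- (\<Sum>j\<in>J. (W j \<omega> + a j)\<^sup>2) / 2)))"
    by (simp only: of_real_diff[symmetric] norm_of_real)
  also have "\<dots> = cmod (CLINT z|gaussian J. e z * \<psi> z - e z * \<psi>' z)"
    unfolding 1 2 using i by simp
  also have "\<dots> \<le> (LINT z|gaussian J. cmod (e z * \<psi> z - e z * \<psi>' z))" by (rule integral_norm_bound)
  also have "\<dots> = (LINT z|gaussian J. cmod (\<psi> z - \<psi>' z))"
    by (simp add: right_diff_distrib[symmetric] norm_mult ne)
  finally show ?thesis unfolding \<psi>_def \<psi>'_def .
qed

text \<open>Convergence of characteristic functions at each fixed frequency vector z suffices: the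
  Gaussian measure in z is finite and the integrand is at most 2, so dominated convergence needs no
  uniformity in z.\<close>

lemma cscore_laplace_tendsto:
  fixes b :: "nat \<Rightarrow> real"
  assumes law: "\<And>i. cos_law (\<mu> i) (\<theta> i)" and n: "filterlim n at_top sequentially"
    and \<epsilon>: "\<And>i m. 1 \<le> m \<Longrightarrow> \<bar>\<theta> i m\<bar> \<le> \<epsilon> i" "\<epsilon> \<longlonglongrightarrow> 0"
    and J: "finite J" "0 \<notin> J"
  shows "(\<lambda>i. (LINT X|iid (n i) (\<mu> i). exp (- (\<Sum>j\<in>J. (b j * (cscore (\<theta> i) (n i) X j + a i j))\<^sup>2) / 2)) -
      (LINT z|gaussian J. exp (- (\<Sum>j\<in>J. (b j * (z j + a i j))\<^sup>2) / 2))) \<longlonglongrightarrow> 0"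
proof (rule Lim_null_comparison)
  define \<psi> where "\<psi> i z = (CLINT X|iid (n i) (\<mu> i). iexp (\<Sum>j\<in>J. z j * (b j * cscore (\<theta> i) (n i) X j)))" for i z
  define \<gamma> where "\<gamma> z = (CLINT y|gaussian J. iexp (\<Sum>j\<in>J. z j * (b j * y j)))" for z
  have ps: "prob_space (iid (n i) (\<mu> i))" for i
    using law[of i] unfolding cos_law_def by (intro prob_space_iid) simp
  have m1: "(\<lambda>X. b j * cscore (\<theta> i) (n i) X j) \<in> borel_measurable (iid (n i) (\<mu> i))" for i j
    using cscore_measurable[OF law, of i "n i" j] by simp
  have m2: "(\<lambda>y. b j * y j) \<in> borel_measurable (gaussian J)" if "j \<in> J" for j
    using that by measurable
  have \<psi>m [measurable]: "\<psi> i \<in> borel_measurable (gaussian J)" for i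
    unfolding \<psi>_def by (rule gaussian_average_char(2)[OF ps J(1)]) (use m1 in auto)
  have \<gamma>m [measurable]: "\<gamma> \<in> borel_measurable (gaussian J)"
    unfolding \<gamma>_def by (rule gaussian_average_char(2)[OF prob_space_gaussian J(1)]) (use m2 in auto)
  show "\<forall>\<^sub>F i in sequentially. norm ((LINT X|iid (n i) (\<mu> i). exp (- (\<Sum>j\<in>J. (b j * (cscore (\<theta> i) (n i) X j + a i j))\<^sup>2) / 2)) -
      (LINT z|gaussian J. exp (- (\<Sum>j\<in>J. (b j * (z j + a i j))\<^sup>2) / 2))) \<le> (LINT z|gaussian J. cmod (\<psi> i z - \<gamma> z))"
    unfolding \<psi>_def \<gamma>_def real_norm_def distrib_left
    by (intro always_eventually allI laplace_difference_le ps prob_space_gaussian m1 m2 J)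
  have \<psi>1: "cmod (\<psi> i z) \<le> 1" for i z
    unfolding \<psi>_def
    using integral_norm_bound[of "iid (n i) (\<mu> i)" "\<lambda>X. iexp (\<Sum>j\<in>J. z j * (b j * cscore (\<theta> i) (n i) X j))"]
      prob_space.prob_space[OF ps[of i]] by simp
  have \<gamma>: "\<gamma> z = of_real (exp (- (\<Sum>j\<in>J. (z j * b j)\<^sup>2) / 2))" for z
    unfolding \<gamma>_def using gaussian_char[OF J(1), of "\<lambda>j. z j * b j"] by (simp add: mult.assoc)
  have \<gamma>1: "cmod (\<gamma> z) \<le> 1" for z
    unfolding \<gamma> by (simp add: sum_nonneg)
  have pt: "(\<lambda>i. \<psi> i z) \<longlonglongrightarrow> \<gamma> z" for z
  proof -
    define w where "w j = z j * b j" for j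
    define S where "S = (\<Sum>j\<in>J. (w j)\<^sup>2)"
    define A where "A = (\<Sum>j\<in>J. \<bar>w j\<bar>)"
    have nr: "filterlim (\<lambda>i. real (n i)) at_top sequentially"
      by (rule filterlim_compose[OF filterlim_real_sequentially n])
    have "(\<lambda>i. \<psi> i z - of_real ((1 + (- S / 2) / real (n i)) ^ n i)) \<longlonglongrightarrow> 0"
    proof (rule Lim_null_comparison)
      have "\<forall>\<^sub>F i in sequentially. max 1 S \<le> real (n i)"
        using nr unfolding filterlim_at_top by blast
      then show "\<forall>\<^sub>F i in sequentially. norm (\<psi> i z - of_real ((1 + (- S / 2) / real (n i)) ^ n i))
          \<le> (2 * sqrt 2 * A) ^ 3 / (6 * sqrt (real (n i))) + 3 / 2 * \<epsilon> i * A\<^sup>2"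
      proof eventually_elim
        case (elim i)
        have "0 < n i" "S \<le> 4 * real (n i)" using elim by auto
        from cscore_char_approx[OF law[of i] J \<epsilon>(1)[of _ i] this(1), of w] this(2)
        show ?case unfolding \<psi>_def S_def A_def w_def by (simp add: mult.assoc)
      qed
      have "((\<lambda>i. (2 * sqrt 2 * A) ^ 3 / (6 * sqrt (real (n i))) + 3 / 2 * \<epsilon> i * A\<^sup>2) \<longlongrightarrow> 0 + 3 / 2 * 0 * A\<^sup>2) sequentially"
      proof (intro tendsto_add tendsto_mult tendsto_const \<epsilon>(2) real_tendsto_divide_at_top[OF tendsto_const])
        show "filterlim (\<lambda>i. 6 * sqrt (real (n i))) at_top sequentially"
          by (rule filterlim_tendsto_pos_mult_at_top[OF tendsto_const _ filterlim_compose[OF sqrt_at_top nr]]) simp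
      qed
      then show "(\<lambda>i. (2 * sqrt 2 * A) ^ 3 / (6 * sqrt (real (n i))) + 3 / 2 * \<epsilon> i * A\<^sup>2) \<longlonglongrightarrow> 0" by simp
    qed
    moreover have "(\<lambda>i. of_real ((1 + (- S / 2) / real (n i)) ^ n i) :: complex) \<longlonglongrightarrow> of_real (exp (- S / 2))"
      by (intro tendsto_of_real filterlim_compose[OF tendsto_exp_limit_sequentially n])
    ultimately have "(\<lambda>i. (\<psi> i z - of_real ((1 + (- S / 2) / real (n i)) ^ n i)) + of_real ((1 + (- S / 2) / real (n i)) ^ n i)) \<longlonglongrightarrow> 0 + of_real (exp (- S / 2))"
      by (rule tendsto_add)
    then show ?thesis unfolding \<gamma> S_def w_def by simp
  qed
  have "(\<lambda>i. LINT z|gaussian J. cmod (\<psi> i z - \<gamma> z)) \<longlonglongrightarrow> (LINT z|gaussian J. 0)"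
  proof (rule integral_dominated_convergence[where w = "\<lambda>_. 2"])
    show "AE z in gaussian J. (\<lambda>i. cmod (\<psi> i z - \<gamma> z)) \<longlonglongrightarrow> 0"
      using pt by (intro AE_I2 tendsto_norm_zero) (simp add: LIM_zero)
    show "AE z in gaussian J. norm (cmod (\<psi> i z - \<gamma> z)) \<le> 2" for i
    proof (rule AE_I2)
      fix z show "norm (cmod (\<psi> i z - \<gamma> z)) \<le> 2"
        using norm_triangle_ineq4[of "\<psi> i z" "\<gamma> z"] \<psi>1[of i z] \<gamma>1[of z] by simp
    qed
  qed auto
  then show "(\<lambda>i. LINT z|gaussian J. cmod (\<psi> i z - \<gamma> z)) \<longlonglongrightarrow> 0" by simp
qed

section \<open>From Laplace transforms to distribution functions\<close>

text \<open>Bernstein's argument: the binomial weights have variance \<open>m * x * (1 - x)\<close>.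
  The explicit rate depends on H only through L, so one degree serves a whole family of Lipschitz
  functions.\<close>

lemma Bernstein_lipschitz_approx:
  fixes H :: "real \<Rightarrow> real"
  assumes H: "\<And>x y. x \<in> {0..1} \<Longrightarrow> y \<in> {0..1} \<Longrightarrow> \<bar>H x - H y\<bar> \<le> L * \<bar>x - y\<bar>"
    and m: "0 < m" and x: "x \<in> {0..1}" and L: "0 \<le> L"
  shows "\<bar>H x - (\<Sum>k\<le>m. H (real k / real m) * Bernstein m k x)\<bar> \<le> 2 * L / sqrt (real m)"
proof -
  define b where "b k = Bernstein m k x" for k
  have b0: "0 \<le> b k" for k unfolding b_def using x by (intro Bernstein_nonneg) auto
  have b1: "(\<Sum>k\<le>m. b k) = 1" unfolding b_def by (rule sum_Bernstein)
  have sq: "(\<Sum>k\<le>m. (real k - real m * x)\<^sup>2 * b k) = real m * x * (1 - x)"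
  proof -
    have "(\<Sum>k\<le>m. (real k - real m * x)\<^sup>2 * b k) =
       (\<Sum>k\<le>m. real k * (real k - 1) * b k + (1 - 2 * real m * x) * (real k * b k) + (real m * x)\<^sup>2 * b k)"
      by (rule sum.cong) (auto simp: power2_eq_square algebra_simps)
    also have "\<dots> = real m * (real m - 1) * x\<^sup>2 + (1 - 2 * real m * x) * (real m * x) + (real m * x)\<^sup>2"
      unfolding sum.distrib sum_distrib_left[symmetric] b_def sum_kk_Bernstein sum_k_Bernstein sum_Bernstein by simp
    also have "\<dots> = real m * x * (1 - x)" by (simp add: power2_eq_square algebra_simps)
    finally show ?thesis .
  qed
  \<comment> \<open>The scale of the binomial standard deviation. A deviation d is at most r + d^2 /
    r, which bounds its mean by second moments and gives the two equal terms in the rate.\<close>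
  define r where "r = sqrt (real m)"
  have r: "0 < r" "r * r = real m" using m by (auto simp: r_def)
  have dev: "\<bar>x - real k / real m\<bar> \<le> 1 / r + (real k - real m * x)\<^sup>2 / (r * real m)" for k
  proof -
    define d where "d = \<bar>real k - real m * x\<bar>"
    have d: "\<bar>x - real k / real m\<bar> = d / real m"
    proof -
      have "x - real k / real m = - ((real k - real m * x) / real m)" using m by (simp add: field_simps)
      then show ?thesis unfolding d_def by simp
    qed
    have "d \<le> r + d\<^sup>2 / r"
    proof (cases "d \<le> r")
      case False
      then have "d * r \<le> d * d" using r by (intro mult_left_mono) auto
      then have "d \<le> d\<^sup>2 / r" using r by (simp add: field_simps power2_eq_square)
      then show ?thesis using r by simp
    qed (use r in \<open>simp add: add_increasing2\<close>)
    then have "d / real m \<le> (r + d\<^sup>2 / r) / real m" by (intro divide_right_mono) auto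
    also have "\<dots> = 1 / r + d\<^sup>2 / (r * real m)"
      using r m by (simp add: add_divide_distrib flip: r(2))
    finally show ?thesis unfolding d unfolding d_def by simp
  qed
  have "\<bar>H x - (\<Sum>k\<le>m. H (real k / real m) * Bernstein m k x)\<bar> = \<bar>\<Sum>k\<le>m. (H x - H (real k / real m)) * b k\<bar>"
  proof -
    have "(\<Sum>k\<le>m. (H x - H (real k / real m)) * b k) = (\<Sum>k\<le>m. H x * b k) - (\<Sum>k\<le>m. H (real k / real m) * b k)"
      by (simp add: left_diff_distrib sum_subtractf)
    then show ?thesis unfolding sum_distrib_left[symmetric] b1 by (simp add: b_def)
  qed
  also have "\<dots> \<le> (\<Sum>k\<le>m. (L * \<bar>x - real k / real m\<bar>) * b k)"
  proof (rule order_trans[OF sum_abs sum_mono])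
    fix k assume "k \<in> {..m}"
    then have "real k / real m \<in> {0..1}" using m by auto
    then show "\<bar>(H x - H (real k / real m)) * b k\<bar> \<le> L * \<bar>x - real k / real m\<bar> * b k"
      unfolding abs_mult abs_of_nonneg[OF b0] using H[OF x] b0 by (intro mult_right_mono) auto
  qed
  also have "\<dots> = L * (\<Sum>k\<le>m. \<bar>x - real k / real m\<bar> * b k)" by (simp add: sum_distrib_left mult.assoc)
  also have "(\<Sum>k\<le>m. \<bar>x - real k / real m\<bar> * b k) \<le> 2 / r"
  proof -
    have "(\<Sum>k\<le>m. \<bar>x - real k / real m\<bar> * b k) \<le> (\<Sum>k\<le>m. (1 / r + (real k - real m * x)\<^sup>2 / (r * real m)) * b k)"
      by (intro sum_mono mult_right_mono dev b0)
    also have "\<dots> = 1 / r + (\<Sum>k\<le>m. (real k - real m * x)\<^sup>2 * b k) / (r * real m)"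
    proof -
      have "(\<Sum>k\<le>m. (1 / r + (real k - real m * x)\<^sup>2 / (r * real m)) * b k) =
        (\<Sum>k\<le>m. 1 / r * b k) + (\<Sum>k\<le>m. (real k - real m * x)\<^sup>2 * b k / (r * real m))"
        by (simp add: distrib_right sum.distrib)
      then show ?thesis unfolding sum_distrib_left[symmetric] sum_divide_distrib[symmetric] b1 by simp
    qed
    also have "\<dots> \<le> 1 / r + 1 / r"
    proof -
      have "x * (1 - x) \<le> 1 * 1" using x by (intro mult_mono) auto
      then have "real m * (x * (1 - x)) / (r * real m) \<le> real m * 1 / (r * real m)"
        using m r by (intro divide_right_mono mult_left_mono) auto
      then show ?thesis unfolding sq using m by (simp add: mult.assoc)
    qed
    finally show ?thesis by simp
  qed
  then have "L * (\<Sum>k\<le>m. \<bar>x - real k / real m\<bar> * b k) \<le> L * (2 / r)" by (rule mult_left_mono[OF _ L])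
  finally show ?thesis by (simp add: r_def mult.commute)
qed

text \<open>The coefficients do not depend on x, so the expectation of a Bernstein polynomial is a
  fixed linear combination of finitely many moments.\<close>

lemma Bernstein_power_sum:
  obtains c where "\<And>x. Bernstein m k x = (\<Sum>l\<le>m - k. c l * x ^ (k + l))"
proof
  fix x :: real
  have "(1 - x) ^ (m - k) = (\<Sum>l\<le>m - k. real ((m - k) choose l) * (- x) ^ l * 1 ^ (m - k - l))"
    using binomial_ring[of "- x" 1 "m - k"] by simp
  then show "Bernstein m k x = (\<Sum>l\<le>m - k. real (m choose k) * (real ((m - k) choose l) * (- 1) ^ l) * x ^ (k + l))"
    unfolding Bernstein_def by (simp add: sum_distrib_left power_add power_minus[of x] mult_ac)
qed

lemma integrable_unit_interval_power:
  assumes "prob_space P" "Z \<in> borel_measurable P" "\<And>\<omega>. Z \<omega> \<in> {0..1::real}"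
  shows "integrable P (\<lambda>\<omega>. Z \<omega> ^ p)"
proof -
  interpret prob_space P by fact
  show ?thesis
    by (rule integrable_const_bound[of _ 1]) (use assms in \<open>auto simp: power_le_one\<close>)
qed

lemma lipschitz_Bernstein_expectation:
  fixes H :: "real \<Rightarrow> real"
  assumes Q: "prob_space Q" "Z \<in> borel_measurable Q" "\<And>\<omega>. Z \<omega> \<in> {0..1}"
    and Bi: "\<And>k. integrable Q (\<lambda>\<omega>. Bernstein m k (Z \<omega>))"
    and H: "H \<in> borel_measurable borel" "\<And>x. \<bar>H x\<bar> \<le> 1"
      "\<And>x y. x \<in> {0..1} \<Longrightarrow> y \<in> {0..1} \<Longrightarrow> \<bar>H x - H y\<bar> \<le> L * \<bar>x - y\<bar>"
    and L: "0 \<le> L" and m: "0 < m"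
  shows "\<bar>(LINT \<omega>|Q. H (Z \<omega>)) - (\<Sum>k\<le>m. H (real k / real m) * (LINT \<omega>|Q. Bernstein m k (Z \<omega>)))\<bar>
    \<le> 2 * L / sqrt (real m)"
proof -
  interpret prob_space Q by fact
  define P where "P x = (\<Sum>k\<le>m. H (real k / real m) * Bernstein m k x)" for x
  have PH: "\<bar>H x - P x\<bar> \<le> 2 * L / sqrt (real m)" if "x \<in> {0..1}" for x
    unfolding P_def by (rule Bernstein_lipschitz_approx[OF H(3) m that L])
  have [measurable]: "Z \<in> borel_measurable Q" "H \<in> borel_measurable borel" by fact+
  have hi: "integrable Q (\<lambda>\<omega>. H (Z \<omega>))"
    by (rule integrable_const_bound[of _ 1]) (use H in auto)
  have pi: "integrable Q (\<lambda>\<omega>. P (Z \<omega>))" unfolding P_def using Bi by simp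
  have "(\<Sum>k\<le>m. H (real k / real m) * (LINT \<omega>|Q. Bernstein m k (Z \<omega>))) = (LINT \<omega>|Q. P (Z \<omega>))"
    unfolding P_def using Bi by simp
  then have "\<bar>(LINT \<omega>|Q. H (Z \<omega>)) - (\<Sum>k\<le>m. H (real k / real m) * (LINT \<omega>|Q. Bernstein m k (Z \<omega>)))\<bar> = \<bar>LINT \<omega>|Q. H (Z \<omega>) - P (Z \<omega>)\<bar>"
    using hi pi by simp
  also have "\<dots> \<le> (LINT \<omega>|Q. \<bar>H (Z \<omega>) - P (Z \<omega>)\<bar>)" by (rule integral_abs_bound)
  also have "\<dots> \<le> (LINT \<omega>|Q. 2 * L / sqrt (real m))"
    by (rule integral_mono) (use hi pi PH[OF Q(3)] in auto)
  finally show ?thesis using prob_space by simp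
qed

text \<open>Both families move with i, and closeness is stated as differences of moments tending to
  0, because the laws themselves need not converge. For the exponential of a negated statistic the
  k-th moment is the Laplace transform at k.\<close>

locale moment_close =
  fixes M :: "nat \<Rightarrow> 'a measure" and N :: "nat \<Rightarrow> 'b measure"
    and Y :: "nat \<Rightarrow> 'a \<Rightarrow> real" and W :: "nat \<Rightarrow> 'b \<Rightarrow> real"
  assumes M: "\<And>i. prob_space (M i)" "\<And>i. Y i \<in> borel_measurable (M i)" "\<And>i \<omega>. Y i \<omega> \<in> {0..1}"
    and N: "\<And>i. prob_space (N i)" "\<And>i. W i \<in> borel_measurable (N i)" "\<And>i \<omega>. W i \<omega> \<in> {0..1}"
    and moments: "\<And>k::nat. (\<lambda>i. (LINT \<omega>|M i. Y i \<omega> ^ k) - (LINT \<omega>|N i. W i \<omega> ^ k)) \<longlonglongrightarrow> 0"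
begin

lemma integrable_Bernstein:
  "integrable (M i) (\<lambda>\<omega>. Bernstein m k (Y i \<omega>))" "integrable (N i) (\<lambda>\<omega>. Bernstein m k (W i \<omega>))"
proof -
  obtain c where B: "\<And>x. Bernstein m k x = (\<Sum>l\<le>m - k. c l * x ^ (k + l))"
    using Bernstein_power_sum by blast
  show "integrable (M i) (\<lambda>\<omega>. Bernstein m k (Y i \<omega>))"
    unfolding B by (intro Bochner_Integration.integrable_sum integrable_mult_right integrable_unit_interval_power M)
  show "integrable (N i) (\<lambda>\<omega>. Bernstein m k (W i \<omega>))"
    unfolding B by (intro Bochner_Integration.integrable_sum integrable_mult_right integrable_unit_interval_power N)
qed

lemma Bernstein_expectation_tendsto:
  "(\<lambda>i. (LINT \<omega>|M i. Bernstein m k (Y i \<omega>)) - (LINT \<omega>|N i. Bernstein m k (W i \<omega>))) \<longlonglongrightarrow> 0"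
proof -
  obtain c where B: "\<And>x. Bernstein m k x = (\<Sum>l\<le>m - k. c l * x ^ (k + l))"
    using Bernstein_power_sum by blast
  have "(\<lambda>i. \<Sum>l\<le>m - k. c l * ((LINT \<omega>|M i. Y i \<omega> ^ (k + l)) - (LINT \<omega>|N i. W i \<omega> ^ (k + l)))) \<longlonglongrightarrow> (\<Sum>l\<le>m - k. c l * 0)"
    by (intro tendsto_intros moments)
  moreover have "(LINT \<omega>|M i. Bernstein m k (Y i \<omega>)) = (\<Sum>l\<le>m - k. c l * (LINT \<omega>|M i. Y i \<omega> ^ (k + l)))" for i
    unfolding B using integrable_unit_interval_power[OF M(1,2,3)] by simp
  moreover have "(LINT \<omega>|N i. Bernstein m k (W i \<omega>)) = (\<Sum>l\<le>m - k. c l * (LINT \<omega>|N i. W i \<omega> ^ (k + l)))" for i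
    unfolding B using integrable_unit_interval_power[OF N(1,2,3)] by simp
  ultimately show ?thesis by (simp add: right_diff_distrib sum_subtractf)
qed

lemma lipschitz_expectation_tendsto:
  fixes H :: "nat \<Rightarrow> real \<Rightarrow> real"
  assumes Hm: "\<And>i. H i \<in> borel_measurable borel" and H1: "\<And>i x. \<bar>H i x\<bar> \<le> 1"
    and HL: "\<And>i x y. x \<in> {0..1} \<Longrightarrow> y \<in> {0..1} \<Longrightarrow> \<bar>H i x - H i y\<bar> \<le> L * \<bar>x - y\<bar>" and L: "0 \<le> L"
  shows "(\<lambda>i. (LINT \<omega>|M i. H i (Y i \<omega>)) - (LINT \<omega>|N i. H i (W i \<omega>))) \<longlonglongrightarrow> 0"
proof (rule LIMSEQ_I)
  fix e :: real assume e: "0 < e"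
  \<comment> \<open>Makes each of the two approximation errors less than e / 4. The degree depends
    on L and e only, not on i, which leaves finitely many Bernstein expectations to compare.\<close>
  obtain m :: nat where m: "(8 * L / e)\<^sup>2 < real m" using reals_Archimedean2 by blast
  have m0: "0 < m" using m by (cases m) (auto simp: not_less)
  have "8 * L / e < sqrt (real m)" using m by (rule real_less_rsqrt)
  then have me: "2 * L / sqrt (real m) < e / 4" using e m0 by (simp add: field_simps)
  define S where "S i = (\<Sum>k\<le>m. \<bar>(LINT \<omega>|M i. Bernstein m k (Y i \<omega>)) - (LINT \<omega>|N i. Bernstein m k (W i \<omega>))\<bar>)" for i
  have "S \<longlonglongrightarrow> (\<Sum>k\<le>m. 0)"
    unfolding S_def by (intro tendsto_sum tendsto_rabs_zero Bernstein_expectation_tendsto)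
  then obtain i0 where i0: "\<And>i. i \<ge> i0 \<Longrightarrow> norm (S i - 0) < e / 2"
    using LIMSEQ_D[of S 0 "e / 2"] e by auto
  have "norm ((LINT \<omega>|M i. H i (Y i \<omega>)) - (LINT \<omega>|N i. H i (W i \<omega>)) - 0) < e" if i: "i \<ge> i0" for i
  proof -
    define a where "a k = (LINT \<omega>|M i. Bernstein m k (Y i \<omega>))" for k
    define b where "b k = (LINT \<omega>|N i. Bernstein m k (W i \<omega>))" for k
    have "\<bar>(LINT \<omega>|M i. H i (Y i \<omega>)) - (\<Sum>k\<le>m. H i (real k / real m) * a k)\<bar> \<le> 2 * L / sqrt (real m)"
      unfolding a_def by (rule lipschitz_Bernstein_expectation[OF M integrable_Bernstein(1) Hm H1 HL L m0])
    moreover have "\<bar>(LINT \<omega>|N i. H i (W i \<omega>)) - (\<Sum>k\<le>m. H i (real k / real m) * b k)\<bar> \<le> 2 * L / sqrt (real m)"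
      unfolding b_def by (rule lipschitz_Bernstein_expectation[OF N integrable_Bernstein(2) Hm H1 HL L m0])
    moreover have "\<bar>(\<Sum>k\<le>m. H i (real k / real m) * a k) - (\<Sum>k\<le>m. H i (real k / real m) * b k)\<bar> \<le> S i"
    proof -
      have "(\<Sum>k\<le>m. H i (real k / real m) * a k) - (\<Sum>k\<le>m. H i (real k / real m) * b k) = (\<Sum>k\<le>m. H i (real k / real m) * (a k - b k))"
        by (simp add: right_diff_distrib sum_subtractf)
      also have "\<bar>\<dots>\<bar> \<le> (\<Sum>k\<le>m. 1 * \<bar>a k - b k\<bar>)"
        by (rule order_trans[OF sum_abs sum_mono]) (unfold abs_mult, intro mult_right_mono H1, auto)
      finally show ?thesis unfolding S_def a_def b_def by simp
    qed
    ultimately show ?thesis using me i0[OF i] by simp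
  qed
  then show "\<exists>no. \<forall>i\<ge>no. norm ((LINT \<omega>|M i. H i (Y i \<omega>)) - (LINT \<omega>|N i. H i (W i \<omega>)) - 0) < e" by blast
qed

end

text \<open>A smoothed indicator of z \<le> c in the variable y = exp (- z): equal to 1 for y at
  least exp (- c), equal to 0 for y at most exp (- (c + \<eta>)), and linear in between.\<close>

definition exp_bump :: "real \<Rightarrow> real \<Rightarrow> real \<Rightarrow> real" where
  "exp_bump c \<eta> y = max 0 (min 1 ((y - exp (- (c + \<eta>))) / (exp (- c) - exp (- (c + \<eta>)))))"

lemma exp_bump_measurable [measurable]: "exp_bump c \<eta> \<in> borel_measurable borel"
  unfolding exp_bump_def by measurable

lemma exp_bump_bounds: "0 \<le> exp_bump c \<eta> y" "exp_bump c \<eta> y \<le> 1"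
  unfolding exp_bump_def by auto

text \<open>The slope is exp c / (1 - exp (- \<eta>)), which grows with c only. Hence thresholds
  need an upper bound but may tend to minus infinity.\<close>

lemma exp_bump_lipschitz:
  assumes "0 < \<eta>" "c \<le> C"
  shows "\<bar>exp_bump c \<eta> x - exp_bump c \<eta> y\<bar> \<le> exp C / (1 - exp (- \<eta>)) * \<bar>x - y\<bar>"
proof -
  define D where "D = exp (- c) - exp (- (c + \<eta>))"
  have D: "D = exp (- c) * (1 - exp (- \<eta>))" unfolding D_def by (simp add: algebra_simps exp_add[symmetric])
  have D0: "0 < D" using assms by (simp add: D_def)
  have "\<bar>exp_bump c \<eta> x - exp_bump c \<eta> y\<bar> \<le> \<bar>(x - exp (- (c + \<eta>))) / D - (y - exp (- (c + \<eta>))) / D\<bar>"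
    unfolding exp_bump_def D_def[symmetric] by linarith
  also have "\<dots> = \<bar>x - y\<bar> / D" using D0 by (simp add: diff_divide_distrib[symmetric])
  also have "\<dots> = exp c / (1 - exp (- \<eta>)) * \<bar>x - y\<bar>" unfolding D by (simp add: exp_minus field_simps)
  also have "\<dots> \<le> exp C / (1 - exp (- \<eta>)) * \<bar>x - y\<bar>"
    using assms by (intro mult_right_mono divide_right_mono) auto
  finally show ?thesis .
qed

lemma exp_bump_sandwich:
  assumes P: "prob_space P" and Z: "Z \<in> borel_measurable P" and \<eta>: "0 < \<eta>"
  shows "measure P {\<omega> \<in> space P. Z \<omega> \<le> c} \<le> (LINT \<omega>|P. exp_bump c \<eta> (exp (- Z \<omega>)))"
    and "(LINT \<omega>|P. exp_bump c \<eta> (exp (- Z \<omega>))) \<le> measure P {\<omega> \<in> space P. Z \<omega> \<le> c + \<eta>}"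
proof -
  interpret prob_space P by fact
  note [measurable] = Z
  have D0: "0 < exp (- c) - exp (- (c + \<eta>))" using \<eta> by simp
  have bi: "integrable P (\<lambda>\<omega>. exp_bump c \<eta> (exp (- Z \<omega>)))"
    by (rule integrable_const_bound[of _ 1]) (use exp_bump_bounds in auto)
  have ind: "measure P {\<omega> \<in> space P. Z \<omega> \<le> t} = (LINT \<omega>|P. indicator {\<omega> \<in> space P. Z \<omega> \<le> t} \<omega>)" for t
    by simp
  have ii: "integrable P (\<lambda>\<omega>. indicat_real {\<omega> \<in> space P. Z \<omega> \<le> t} \<omega>)" for t
    by (rule integrable_const_bound[of _ 1]) (auto simp: indicator_def)
  show "measure P {\<omega> \<in> space P. Z \<omega> \<le> c} \<le> (LINT \<omega>|P. exp_bump c \<eta> (exp (- Z \<omega>)))"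
    unfolding ind
  proof (rule integral_mono[OF ii bi])
    fix \<omega>
    have "exp_bump c \<eta> (exp (- Z \<omega>)) = 1" if "Z \<omega> \<le> c"
      unfolding exp_bump_def using that D0 by (simp add: max_def min_def field_simps)
    then show "indicator {\<omega> \<in> space P. Z \<omega> \<le> c} \<omega> \<le> exp_bump c \<eta> (exp (- Z \<omega>))"
      using exp_bump_bounds by (auto simp: indicator_def)
  qed
  show "(LINT \<omega>|P. exp_bump c \<eta> (exp (- Z \<omega>))) \<le> measure P {\<omega> \<in> space P. Z \<omega> \<le> c + \<eta>}"
    unfolding ind
  proof (rule integral_mono[OF bi ii])
    fix \<omega> assume "\<omega> \<in> space P"
    moreover have "exp_bump c \<eta> (exp (- Z \<omega>)) = 0" if "\<not> Z \<omega> \<le> c + \<eta>"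
    proof -
      have "exp (- Z \<omega>) - exp (- (c + \<eta>)) \<le> 0" using that by simp
      then have "(exp (- Z \<omega>) - exp (- (c + \<eta>))) / (exp (- c) - exp (- (c + \<eta>))) \<le> 0"
        using D0 by (simp add: divide_nonpos_pos)
      then show ?thesis unfolding exp_bump_def by simp
    qed
    ultimately show "exp_bump c \<eta> (exp (- Z \<omega>)) \<le> indicator {\<omega> \<in> space P. Z \<omega> \<le> c + \<eta>} \<omega>"
      using exp_bump_bounds by (auto simp: indicator_def)
  qed
qed

text \<open>The bumps at c and at c - \<eta> bracket the distribution function of the first family
  between those of the second at c - \<eta> and c + \<eta>. Anticoncentration is needed for the
  comparison family alone, with one modulus for all i.\<close>

lemma cdf_difference_tendsto:
  fixes M :: "nat \<Rightarrow> 'a measure" and N :: "nat \<Rightarrow> 'b measure"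
  assumes M: "\<And>i. prob_space (M i)" "\<And>i. Q i \<in> borel_measurable (M i)" "\<And>i \<omega>. 0 \<le> Q i \<omega>"
    and N: "\<And>i. prob_space (N i)" "\<And>i. R i \<in> borel_measurable (N i)" "\<And>i \<omega>. 0 \<le> R i \<omega>"
    and laplace: "\<And>k::nat. (\<lambda>i. (LINT \<omega>|M i. exp (- (real k * Q i \<omega>))) - (LINT \<omega>|N i. exp (- (real k * R i \<omega>)))) \<longlonglongrightarrow> 0"
    and anti: "\<And>i t \<eta>. 0 < \<eta> \<Longrightarrow> measure (N i) {\<omega> \<in> space (N i). R i \<omega> \<le> t + \<eta>} \<le>
       measure (N i) {\<omega> \<in> space (N i). R i \<omega> \<le> t} + K * sqrt \<eta>"
    and c: "\<And>i. c i \<le> C"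
  shows "(\<lambda>i. measure (M i) {\<omega> \<in> space (M i). Q i \<omega> \<le> c i} - measure (N i) {\<omega> \<in> space (N i). R i \<omega> \<le> c i}) \<longlonglongrightarrow> 0"
proof (rule LIMSEQ_I)
  fix e :: real assume e: "0 < e"
  interpret mc: moment_close M N "\<lambda>i \<omega>. exp (- Q i \<omega>)" "\<lambda>i \<omega>. exp (- R i \<omega>)"
  proof (rule moment_close.intro)
    show "(\<lambda>i. (LINT \<omega>|M i. exp (- Q i \<omega>) ^ k) - (LINT \<omega>|N i. exp (- R i \<omega>) ^ k)) \<longlonglongrightarrow> 0" for k
      using laplace[of k] by (simp add: exp_of_nat_mult[symmetric])
    show "exp (- Q i \<omega>) \<in> {0..1}" for i \<omega> using M(3)[of i \<omega>] by simp
    show "exp (- R i \<omega>) \<in> {0..1}" for i \<omega> using N(3)[of i \<omega>] by simp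
    show "(\<lambda>\<omega>. exp (- Q i \<omega>)) \<in> borel_measurable (M i)" for i using M(2)[of i] by measurable
    show "(\<lambda>\<omega>. exp (- R i \<omega>)) \<in> borel_measurable (N i)" for i using N(2)[of i] by measurable
  qed (rule M(1) N(1))+
  have K: "0 \<le> K"
  proof -
    have [measurable]: "R 0 \<in> borel_measurable (N 0)" by fact
    have "measure (N 0) {\<omega> \<in> space (N 0). R 0 \<omega> \<le> 0} \<le> measure (N 0) {\<omega> \<in> space (N 0). R 0 \<omega> \<le> 0 + 1}"
      by (rule finite_measure.finite_measure_mono[OF prob_space.finite_measure[OF N(1)]]) auto
    then show ?thesis using anti[of 1 0 0] by simp
  qed
  \<comment> \<open>Leaves at most e / 2 for the anticoncentration error; K + 1 instead of K keeps
    the denominator positive when K = 0.\<close>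
  define \<eta> where "\<eta> = (e / (2 * (K + 1)))\<^sup>2"
  have \<eta>: "0 < \<eta>" using e K by (simp add: \<eta>_def)
  have "K * sqrt \<eta> = K * (e / (2 * (K + 1)))" using e K by (simp add: \<eta>_def)
  also have "\<dots> \<le> (K + 1) * (e / (2 * (K + 1)))" using e K by (intro mult_right_mono) auto
  also have "\<dots> = e / 2" using K by (simp add: field_simps)
  finally have K\<eta>: "K * sqrt \<eta> \<le> e / 2" .
  define L where "L = exp C / (1 - exp (- \<eta>))"
  have L: "0 \<le> L" using \<eta> by (simp add: L_def)
  have up: "(\<lambda>i. (LINT \<omega>|M i. exp_bump (c i) \<eta> (exp (- Q i \<omega>))) - (LINT \<omega>|N i. exp_bump (c i) \<eta> (exp (- R i \<omega>)))) \<longlonglongrightarrow> 0"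
    by (rule mc.lipschitz_expectation_tendsto[OF _ _ _ L]) (use exp_bump_bounds exp_bump_lipschitz[OF \<eta> c] in \<open>auto simp: L_def\<close>)
  have lo: "(\<lambda>i. (LINT \<omega>|M i. exp_bump (c i - \<eta>) \<eta> (exp (- Q i \<omega>))) - (LINT \<omega>|N i. exp_bump (c i - \<eta>) \<eta> (exp (- R i \<omega>)))) \<longlonglongrightarrow> 0"
  proof (rule mc.lipschitz_expectation_tendsto[OF _ _ _ L])
    show "\<bar>exp_bump (c i - \<eta>) \<eta> x - exp_bump (c i - \<eta>) \<eta> y\<bar> \<le> L * \<bar>x - y\<bar>" for i x y
      unfolding L_def by (rule exp_bump_lipschitz[OF \<eta>]) (use c[of i] \<eta> in simp)
  qed (use exp_bump_bounds in auto)
  obtain i1 where i1: "\<And>i. i \<ge> i1 \<Longrightarrow> \<bar>(LINT \<omega>|M i. exp_bump (c i) \<eta> (exp (- Q i \<omega>))) - (LINT \<omega>|N i. exp_bump (c i) \<eta> (exp (- R i \<omega>)))\<bar> < e / 2"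
    using LIMSEQ_D[OF up, of "e / 2"] e by auto
  obtain i2 where i2: "\<And>i. i \<ge> i2 \<Longrightarrow> \<bar>(LINT \<omega>|M i. exp_bump (c i - \<eta>) \<eta> (exp (- Q i \<omega>))) - (LINT \<omega>|N i. exp_bump (c i - \<eta>) \<eta> (exp (- R i \<omega>)))\<bar> < e / 2"
    using LIMSEQ_D[OF lo, of "e / 2"] e by auto
  have "norm (measure (M i) {\<omega> \<in> space (M i). Q i \<omega> \<le> c i} - measure (N i) {\<omega> \<in> space (N i). R i \<omega> \<le> c i} - 0) < e"
    if "i \<ge> max i1 i2" for i
    using exp_bump_sandwich[OF M(1,2) \<eta>, of i "c i"] exp_bump_sandwich[OF N(1,2) \<eta>, of i "c i"]
      exp_bump_sandwich[OF M(1,2) \<eta>, of i "c i - \<eta>"] exp_bump_sandwich[OF N(1,2) \<eta>, of i "c i - \<eta>"]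
      anti[OF \<eta>, of i "c i"] anti[OF \<eta>, of i "c i - \<eta>"] i1[of i] i2[of i] that K\<eta>
    by (simp add: abs_if split: if_splits)
  then show "\<exists>no. \<forall>i\<ge>no. norm (measure (M i) {\<omega> \<in> space (M i). Q i \<omega> \<le> c i} - measure (N i) {\<omega> \<in> space (N i). R i \<omega> \<le> c i} - 0) < e"
    by blast
qed

section \<open>Shifted normal variables\<close>

lemma std_normal_density_le_1: "std_normal_density x \<le> 1"
proof -
  have "1 \<le> sqrt (2 * pi)" using pi_ge_two by simp
  moreover have "exp (- x\<^sup>2 / 2) \<le> 1" by simp
  ultimately show ?thesis unfolding std_normal_density_def
    by (intro mult_le_one) auto
qed

lemma std_normal_density_mono:
  assumes "\<bar>x\<bar> \<le> \<bar>y\<bar>"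
  shows "std_normal_density y \<le> std_normal_density x"
proof -
  have "x\<^sup>2 \<le> y\<^sup>2" using assms by (simp add: abs_le_square_iff)
  then show ?thesis unfolding std_normal_density_def by (intro mult_left_mono) auto
qed

text \<open>Interval probabilities become differences of an antiderivative, so that monotonicity and
  mean value arguments apply. The additive constant is irrelevant.\<close>

lemma std_normal_primitive:
  obtains \<Phi> where "\<And>x. (\<Phi> has_real_derivative std_normal_density x) (at x)"
    "\<And>u v. u \<le> v \<Longrightarrow> measure std_normal_distribution {u..v} = \<Phi> v - \<Phi> u"
    "\<And>u v. u \<le> v \<Longrightarrow> \<Phi> u \<le> \<Phi> v"
proof -
  have "isCont std_normal_density x" for x
    unfolding std_normal_density_def by (intro continuous_intros) auto
  then obtain \<Phi> where \<Phi>: "\<And>x. (\<Phi> has_vector_derivative std_normal_density x) (at x)"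
    using einterval_antiderivative[of "-\<infinity>" \<infinity> std_normal_density] by auto
  then have D: "(\<Phi> has_real_derivative std_normal_density x) (at x)" for x
    by (simp add: has_real_derivative_iff_has_vector_derivative)
  have mono: "\<Phi> u \<le> \<Phi> v" if "u \<le> v" for u v
    by (rule DERIV_nonneg_imp_nondecreasing[OF that]) (use D normal_density_nonneg in blast)
  have "measure std_normal_distribution {u..v} = \<Phi> v - \<Phi> u" if uv: "u \<le> v" for u v
  proof -
    have "emeasure std_normal_distribution {u..v} = (\<integral>\<^sup>+x. ennreal (std_normal_density x) * indicator {u..v} x \<partial>lborel)"
      by (subst emeasure_density) auto
    also have "\<dots> = ennreal (\<Phi> v - \<Phi> u)"
      by (rule nn_integral_FTC_Icc) (use D uv in \<open>auto intro: has_field_derivative_at_within\<close>)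
    finally show ?thesis using mono[OF uv] by (simp add: measure_def)
  qed
  then show ?thesis using that D mono by blast
qed

text \<open>Distribution function of a scaled noncentral chi-square variable with one degree of
  freedom.\<close>

definition chi_cdf :: "real \<Rightarrow> real \<Rightarrow> real \<Rightarrow> real" where
  "chi_cdf l a t = measure std_normal_distribution {x. l * (x + a)\<^sup>2 \<le> t}"

lemma chi_set_measurable [measurable]: "{x. l * (x + a)\<^sup>2 \<le> t} \<in> sets borel" for l a t :: real
  by measurable

lemma chi_cdf_nonneg: "0 \<le> chi_cdf l a t" and chi_cdf_le_1: "chi_cdf l a t \<le> 1"
  unfolding chi_cdf_def by auto

lemma chi_cdf_mono: "t \<le> t' \<Longrightarrow> chi_cdf l a t \<le> chi_cdf l a t'"
  unfolding chi_cdf_def by (rule std_normal.finite_measure_mono) auto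

lemma chi_cdf_measurable [measurable]: "chi_cdf l a \<in> borel_measurable borel"
  by (rule borel_measurable_mono) (simp add: mono_def chi_cdf_mono)

lemma chi_set_eq:
  assumes "0 < l" "0 \<le> t"
  shows "{x. l * (x + a)\<^sup>2 \<le> t} = {- a - sqrt (t / l)..- a + sqrt (t / l)}"
proof -
  have "l * (x + a)\<^sup>2 \<le> t \<longleftrightarrow> \<bar>x + a\<bar> \<le> sqrt (t / l)" for x
  proof -
    have "l * (x + a)\<^sup>2 \<le> t \<longleftrightarrow> (x + a)\<^sup>2 \<le> t / l" using assms by (simp add: field_simps)
    also have "\<dots> \<longleftrightarrow> \<bar>x + a\<bar> \<le> sqrt (t / l)"
      using assms by (metis real_sqrt_abs real_sqrt_le_iff)
    finally show ?thesis .
  qed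
  then have "{x. l * (x + a)\<^sup>2 \<le> t} = {x. \<bar>x + a\<bar> \<le> sqrt (t / l)}" by (simp only:)
  also have "\<dots> = {- a - sqrt (t / l)..- a + sqrt (t / l)}" by (simp only: set_eq_iff mem_Collect_eq atLeastAtMost_iff) linarith
  finally show ?thesis .
qed

lemma std_normal_measure_interval_le:
  assumes "u \<le> v"
  shows "measure std_normal_distribution {u..v} \<le> v - u"
proof -
  obtain \<Phi> where \<Phi>: "\<And>x. (\<Phi> has_real_derivative std_normal_density x) (at x)"
    "\<And>u v. u \<le> v \<Longrightarrow> measure std_normal_distribution {u..v} = \<Phi> v - \<Phi> u"
    using std_normal_primitive by metis
  have "\<Phi> v - v \<le> \<Phi> u - u"
  proof (rule DERIV_nonpos_imp_nonincreasing[OF assms])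
    fix x
    have "((\<lambda>x. \<Phi> x - x) has_real_derivative std_normal_density x - 1) (at x)"
      by (intro DERIV_diff \<Phi>(1) DERIV_ident)
    then show "\<exists>y. ((\<lambda>x. \<Phi> x - x) has_real_derivative y) (at x) \<and> y \<le> 0"
      using std_normal_density_le_1[of x] by (intro exI[of _ "std_normal_density x - 1"]) simp
  qed
  then show ?thesis using \<Phi>(2)[OF assms] by simp
qed

text \<open>Subadditivity of the square root shows that raising the threshold by \<eta> adds at most
  two intervals of length \<open>sqrt (\<eta> / l)\<close>, and the normal density is at most 1. The
  bound is uniform in the shift and in the threshold.\<close>

lemma chi_cdf_anticoncentration:
  assumes l: "0 < l" and \<eta>: "0 < \<eta>"
  shows "chi_cdf l a (t + \<eta>) \<le> chi_cdf l a t + 2 * sqrt (\<eta> / l)"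
proof -
  define s where "s = sqrt (max t 0 / l)"
  define q where "q = sqrt (\<eta> / l)"
  have q0: "0 \<le> q" and s0: "0 \<le> s" using \<eta> l by (auto simp: q_def s_def)
  have "{x. l * (x + a)\<^sup>2 \<le> t + \<eta>} \<subseteq> {x. l * (x + a)\<^sup>2 \<le> t} \<union> {- a + s..- a + s + q} \<union> {- a - s - q..- a - s}"
  proof (intro subsetI)
    fix x assume x: "x \<in> {x. l * (x + a)\<^sup>2 \<le> t + \<eta>}"
    show "x \<in> {x. l * (x + a)\<^sup>2 \<le> t} \<union> {- a + s..- a + s + q} \<union> {- a - s - q..- a - s}"
    proof (cases "l * (x + a)\<^sup>2 \<le> t")
      case False
      have "max t 0 / l \<le> (x + a)\<^sup>2" using False l by (auto simp: field_simps max_def mult_nonneg_nonneg)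
      then have 1: "s \<le> \<bar>x + a\<bar>" unfolding s_def by (metis real_sqrt_abs real_sqrt_le_iff)
      have "(x + a)\<^sup>2 \<le> max t 0 / l + \<eta> / l" using x l by (auto simp: field_simps max_def)
      then have "\<bar>x + a\<bar> \<le> sqrt (max t 0 / l + \<eta> / l)" by (metis real_sqrt_abs real_sqrt_le_iff)
      also have "\<dots> \<le> s + q" unfolding s_def q_def
        using l \<eta> by (intro sqrt_add_le_add_sqrt) auto
      finally show ?thesis using 1 by auto
    qed simp
  qed
  then have "chi_cdf l a (t + \<eta>) \<le> measure std_normal_distribution ({x. l * (x + a)\<^sup>2 \<le> t} \<union> {- a + s..- a + s + q} \<union> {- a - s - q..- a - s})"
    unfolding chi_cdf_def by (intro std_normal.finite_measure_mono) auto
  also have "\<dots> \<le> measure std_normal_distribution ({x. l * (x + a)\<^sup>2 \<le> t} \<union> {- a + s..- a + s + q}) + measure std_normal_distribution {- a - s - q..- a - s}"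
    by (intro measure_Un_le) auto
  also have "measure std_normal_distribution ({x. l * (x + a)\<^sup>2 \<le> t} \<union> {- a + s..- a + s + q}) \<le> chi_cdf l a t + measure std_normal_distribution {- a + s..- a + s + q}"
    unfolding chi_cdf_def by (intro measure_Un_le) auto
  finally show ?thesis
    using std_normal_measure_interval_le[of "- a + s" "- a + s + q"] std_normal_measure_interval_le[of "- a - s - q" "- a - s"] q0
    by (simp add: q_def)
qed

text \<open>The mass \<open>k a\<close> of the shifted interval is even in the shift and decreasing
  in its modulus, but its derivative vanishes at 0. The loss is therefore taken from the mean value
  theorem on [a0 / 2, a0], where the two endpoint densities differ by the factor exp (2 * y * z)
  with 2 * y * z at least y0 * a0.\<close>

lemma std_normal_shift_gap:
  assumes y: "0 < y0" "y0 \<le> y" "y \<le> y1" and a: "0 < a0" "a0 \<le> \<bar>a\<bar>"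
  shows "measure std_normal_distribution {- a - y..- a + y} + a0 / 2 * (std_normal_density (y1 + a0) * (y0 * a0))
    \<le> measure std_normal_distribution {- y..y}"
proof -
  obtain \<Phi> where \<Phi>: "\<And>x. (\<Phi> has_real_derivative std_normal_density x) (at x)"
    "\<And>u v. u \<le> v \<Longrightarrow> measure std_normal_distribution {u..v} = \<Phi> v - \<Phi> u"
    using std_normal_primitive by metis
  define k where "k a = \<Phi> (- a + y) - \<Phi> (- a - y)" for a
  define k' where "k' a = std_normal_density (y + a) - std_normal_density (y - a)" for a
  have sym: "std_normal_density (- x) = std_normal_density x" for x by (simp add: std_normal_density_def)
  have Dk: "(k has_real_derivative k' a) (at a)" for a
  proof -
    have "((\<lambda>a. \<Phi> (- a + c)) has_real_derivative std_normal_density (- a + c) * (- 1)) (at a)" for c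
      by (rule DERIV_chain2[OF \<Phi>(1)]) (auto intro!: derivative_eq_intros)
    from DERIV_diff[OF this[of y] this[of "- y"]] show ?thesis
      unfolding k_def k'_def using sym[of "y + a"] by (simp add: algebra_simps)
  qed
  \<comment> \<open>The antiderivative is not known to be odd, so evenness is obtained from the
    vanishing derivative of the difference.\<close>
  have "k a = k (- a)" for a
  proof -
    have "((\<lambda>a. k a - k (- a)) has_real_derivative k' a - k' (- a) * (- 1)) (at a)" for a
      by (intro derivative_intros DERIV_chain2[OF Dk] Dk)
    moreover have "k' a - k' (- a) * (- 1) = 0" for a by (simp add: k'_def)
    ultimately have "\<forall>a. ((\<lambda>a. k a - k (- a)) has_real_derivative 0) (at a)" by simp
    then have "(\<lambda>a. k a - k (- a)) a = (\<lambda>a. k a - k (- a)) 0" by (rule DERIV_isconst_all)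
    then show ?thesis by simp
  qed
  then have kabs: "k a = k \<bar>a\<bar>" for a by (simp add: abs_if)
  have k'0: "k' x \<le> 0" if "0 \<le> x" for x
    unfolding k'_def using that y std_normal_density_mono[of "y - x" "y + x"] by simp
  have dec: "k v \<le> k u" if "0 \<le> u" "u \<le> v" for u v
  proof (rule DERIV_nonpos_imp_nonincreasing[OF that(2)])
    fix x assume "u \<le> x"
    then show "\<exists>y. (k has_real_derivative y) (at x) \<and> y \<le> 0"
      using Dk[of x] k'0[of x] that by (intro exI[of _ "k' x"]) auto
  qed
  have "\<exists>z>a0 / 2. z < a0 \<and> k a0 - k (a0 / 2) = (a0 - a0 / 2) * k' z"
    by (rule MVT2) (use a Dk in auto)
  then obtain z where z: "a0 / 2 < z" "z < a0" "k a0 - k (a0 / 2) = a0 / 2 * k' z" by auto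
  have "std_normal_density (y1 + a0) * (y0 * a0) \<le> - k' z"
  proof -
    have e: "std_normal_density (y - z) = std_normal_density (y + z) * exp (2 * y * z)"
      unfolding std_normal_density_def by (simp add: exp_add[symmetric] power2_eq_square field_simps)
    have "y0 * a0 \<le> 2 * y * z" using y a z mult_mono[of y0 y "a0 / 2" z] by simp
    also have "\<dots> \<le> exp (2 * y * z) - 1" using exp_ge_add_one_self[of "2 * y * z"] by linarith
    finally have "std_normal_density (y + z) * (y0 * a0) \<le> std_normal_density (y + z) * (exp (2 * y * z) - 1)"
      by (intro mult_left_mono) auto
    moreover have "std_normal_density (y1 + a0) * (y0 * a0) \<le> std_normal_density (y + z) * (y0 * a0)"
      using y a z by (intro mult_right_mono std_normal_density_mono) auto
    ultimately show ?thesis unfolding k'_def e by (simp add: algebra_simps)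
  qed
  then have "a0 / 2 * (std_normal_density (y1 + a0) * (y0 * a0)) \<le> a0 / 2 * (- k' z)"
    using a by (intro mult_left_mono) auto
  also have "\<dots> = k (a0 / 2) - k a0" using z by simp
  also have "\<dots> \<le> k 0 - k \<bar>a\<bar>" using dec[of 0 "a0 / 2"] dec[of a0 "\<bar>a\<bar>"] a by simp
  finally show ?thesis
    using \<Phi>(2)[of "- a - y" "- a + y"] \<Phi>(2)[of "- y" y] y kabs[of a] by (simp add: k_def)
qed

lemma chi_cdf_shift_gap:
  assumes l: "0 < l" and t: "0 < t0" "t0 \<le> t1" and a0: "0 < a0"
  obtains d where "0 < d" "\<And>t a. t \<in> {t0..t1} \<Longrightarrow> a0 \<le> \<bar>a\<bar> \<Longrightarrow> chi_cdf l a t + d \<le> chi_cdf l 0 t"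
proof
  let ?d = "a0 / 2 * (std_normal_density (sqrt (t1 / l) + a0) * (sqrt (t0 / l) * a0))"
  show "0 < ?d" using assms by (simp add: normal_density_pos)
  show "chi_cdf l a t + ?d \<le> chi_cdf l 0 t" if "t \<in> {t0..t1}" "a0 \<le> \<bar>a\<bar>" for t a
    using std_normal_shift_gap[of "sqrt (t0 / l)" "sqrt (t / l)" "sqrt (t1 / l)" a0 a] that assms
    unfolding chi_cdf_def using chi_set_eq[of l t 0] by (simp add: chi_set_eq divide_right_mono)
qed

text \<open>For positive t and a nonzero shift this is the gap over the one-point threshold range
  {t..t}. For t \<le> 0 the shifted set has at most one point, hence mass 0.\<close>

lemma chi_cdf_shift_le:
  assumes l: "0 < l"
  shows "chi_cdf l a t \<le> chi_cdf l 0 t"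
proof (cases "a = 0 \<or> t \<le> 0")
  case True
  show ?thesis
  proof (cases "a = 0")
    case False
    have "chi_cdf l a 0 = measure std_normal_distribution {- a..- a}"
      unfolding chi_cdf_def using chi_set_eq[OF l, of 0 a] by simp
    also have "\<dots> \<le> 0" using std_normal_measure_interval_le[of "- a" "- a"] by simp
    finally have "chi_cdf l a t \<le> 0" using chi_cdf_mono[of t 0 l a] True False by simp
    then show ?thesis using chi_cdf_nonneg[of l 0 t] by simp
  qed simp
next
  case False
  then have "0 < t" "0 < \<bar>a\<bar>" by auto
  from chi_cdf_shift_gap[OF l this(1) order_refl this(2)]
  obtain d where d: "0 < d" "\<And>t' b. t' \<in> {t..t} \<Longrightarrow> \<bar>a\<bar> \<le> \<bar>b\<bar> \<Longrightarrow> chi_cdf l b t' + d \<le> chi_cdf l 0 t'"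
    by blast
  show ?thesis using d(1) d(2)[of t a] by simp
qed

text \<open>Bounds below the mass of the shell between thresholds t - L and t, counting its right
  half only: the width is at least \<open>(L / l) / (2 * y1)\<close> and the density there is at
  least its value at y1. The left half contributes a nonnegative amount.\<close>

lemma chi_cdf_increment:
  assumes l: "0 < l" and L: "0 < L" "L \<le> t0" "t0 \<le> t1"
  obtains d where "0 < d" "\<And>t. t \<in> {t0..t1} \<Longrightarrow> chi_cdf l 0 (t - L) + d \<le> chi_cdf l 0 t"
proof
  define y1 where "y1 = sqrt (t1 / l)"
  let ?d = "(L / l) / (2 * y1) * std_normal_density y1"
  have y1: "0 < y1" using assms by (simp add: y1_def)
  show "0 < ?d" using assms y1 by (simp add: normal_density_pos)
  fix t assume t: "t \<in> {t0..t1}"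
  define y where "y = sqrt (t / l)"
  define z where "z = sqrt ((t - L) / l)"
  obtain \<Phi> where \<Phi>: "\<And>x. (\<Phi> has_real_derivative std_normal_density x) (at x)"
    "\<And>u v. u \<le> v \<Longrightarrow> measure std_normal_distribution {u..v} = \<Phi> v - \<Phi> u"
    "\<And>u v. u \<le> v \<Longrightarrow> \<Phi> u \<le> \<Phi> v"
    using std_normal_primitive by metis
  have zy: "0 \<le> z" "z < y" "y \<le> y1" "0 < y"
    using t assms by (auto simp: y_def z_def y1_def divide_right_mono divide_strict_right_mono)
  have sq: "y * y - z * z = L / l" using t assms by (simp add: y_def z_def flip: diff_divide_distrib)
  have "(L / l) / (2 * y1) \<le> y - z"
  proof -
    have "L / l = (y - z) * (y + z)" using sq by (simp add: algebra_simps)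
    also have "\<dots> \<le> (y - z) * (2 * y1)" using zy by (intro mult_left_mono) auto
    finally show ?thesis using y1 by (subst pos_divide_le_eq) auto
  qed
  moreover have "\<exists>x>z. x < y \<and> \<Phi> y - \<Phi> z = (y - z) * std_normal_density x"
    by (rule MVT2) (use zy \<Phi>(1) in auto)
  then obtain x where x: "z < x" "x < y" "\<Phi> y - \<Phi> z = (y - z) * std_normal_density x" by auto
  moreover have "std_normal_density y1 \<le> std_normal_density x"
    using x zy by (intro std_normal_density_mono) auto
  ultimately have "?d \<le> \<Phi> y - \<Phi> z"
    using zy unfolding x(3) by (intro mult_mono) auto
  moreover have "chi_cdf l 0 t = \<Phi> y - \<Phi> (- y)"
    unfolding chi_cdf_def using chi_set_eq[OF l, of t 0] t assms \<Phi>(2)[of "- y" y] zy by (simp add: y_def)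
  moreover have "chi_cdf l 0 (t - L) = \<Phi> z - \<Phi> (- z)"
    unfolding chi_cdf_def using chi_set_eq[OF l, of "t - L" 0] t assms \<Phi>(2)[of "- z" z] zy by (simp add: z_def)
  ultimately show "chi_cdf l 0 (t - L) + ?d \<le> chi_cdf l 0 t"
    using \<Phi>(3)[of "- y" "- z"] zy by simp
qed

section \<open>Weighted sums of squared normal variables\<close>

lemma lam_nonneg: "0 \<le> lam j"
  by (simp add: lam_def)

lemma lam_pos: "1 \<le> j \<Longrightarrow> 0 < lam j"
  by (simp add: lam_def)

lemma lam_sums: "lam sums (1 / 6)"
proof -
  have "(\<lambda>j. cos (real j * 0) / (real j)\<^sup>2) sums (pi\<^sup>2 / 6 - pi * 0 / 2 + 0\<^sup>2 / 4)"
    by (rule cos_series_quadratic) auto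
  then have "(\<lambda>j. 1 / (real j)\<^sup>2 / pi\<^sup>2) sums (pi\<^sup>2 / 6 / pi\<^sup>2)" by (intro sums_divide) simp
  then show ?thesis by (simp add: lam_def[abs_def] power_mult_distrib mult.commute)
qed

lemma summable_lam: "summable lam"
  using lam_sums by (rule sums_summable)

section \<open>Distribution functions of finite shifted quadratic forms\<close>

definition gform :: "nat set \<Rightarrow> (nat \<Rightarrow> real) \<Rightarrow> (nat \<Rightarrow> real) \<Rightarrow> real" where
  "gform J a z = (\<Sum>j\<in>J. lam j * (z j + a j)\<^sup>2)"

definition gcdf :: "nat set \<Rightarrow> (nat \<Rightarrow> real) \<Rightarrow> real \<Rightarrow> real" where
  "gcdf J a c = measure (gaussian J) {z \<in> space (gaussian J). gform J a z \<le> c}"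

lemma gform_measurable [measurable]: "gform J a \<in> borel_measurable (gaussian J)"
  unfolding gform_def
  by (intro borel_measurable_sum borel_measurable_times borel_measurable_const borel_measurable_power borel_measurable_add measurable_gaussian_component)

lemma gform_nonneg: "0 \<le> gform J a z"
  unfolding gform_def by (intro sum_nonneg mult_nonneg_nonneg lam_nonneg) simp

lemma gcdf_mono: "c \<le> c' \<Longrightarrow> gcdf J a c \<le> gcdf J a c'"
  unfolding gcdf_def by (rule gaussian.finite_measure_mono) auto

lemma gcdf_neg: "c < 0 \<Longrightarrow> gcdf J a c = 0"
proof -
  assume c: "c < 0"
  have "\<not> gform J a z \<le> c" for z using gform_nonneg[of J a z] c by linarith
  then have "{z \<in> space (gaussian J). gform J a z \<le> c} = {}" by blast
  then show ?thesis unfolding gcdf_def by (simp only: measure_empty)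
qed

lemma gcdf_cong: "(\<And>j. j \<in> J \<Longrightarrow> a j = b j) \<Longrightarrow> gcdf J a = gcdf J b"
  unfolding gcdf_def gform_def by (auto simp: fun_eq_iff cong: sum.cong)

lemma integrable_chi_gform: "integrable (gaussian J) (\<lambda>z. chi_cdf l b (c - gform J a z))"
  by (rule gaussian.integrable_const_bound[where B = 1])
     (use chi_cdf_nonneg chi_cdf_le_1 in auto)

text \<open>Conditioning on the other coordinates, by Fubini. Through this formula each inequality
  for \<open>chi_cdf\<close> becomes one for \<open>gcdf\<close>.\<close>

lemma gcdf_insert:
  assumes J: "finite J" "j \<notin> J"
  shows "gcdf (insert j J) a c = (LINT z|gaussian J. chi_cdf (lam j) (a j) (c - gform J a z))"
proof -
  let ?A = "{z \<in> space (gaussian (insert j J)). gform (insert j J) a z \<le> c}"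
  have A: "?A \<in> sets (gaussian (insert j J))" by measurable
  have "gcdf (insert j J) a c = (LINT z|gaussian (insert j J). indicat_real ?A z)"
    unfolding gcdf_def using A by simp
  also have "\<dots> = (LINT z|gaussian J. LINT y|std_normal_distribution. indicat_real ?A (z(j := y)))"
    by (rule std_normal_product.product_integral_insert[OF J]) (use A in \<open>simp add: less_top[symmetric]\<close>)
  also have "\<dots> = (LINT z|gaussian J. chi_cdf (lam j) (a j) (c - gform J a z))"
  proof (rule Bochner_Integration.integral_cong[OF refl])
    fix z assume z: "z \<in> space (gaussian J)"
    have "indicat_real ?A (z(j := y)) = indicat_real {y. lam j * (y + a j)\<^sup>2 \<le> c - gform J a z} y" for y
    proof -
      have "z(j := y) \<in> space (gaussian (insert j J))"
        using z by (auto simp: space_PiM PiE_iff extensional_def)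
      moreover have "gform J a (z(j := y)) = gform J a z"
        unfolding gform_def using J by (intro sum.cong) auto
      then have "gform (insert j J) a (z(j := y)) = lam j * (y + a j)\<^sup>2 + gform J a z"
        using J by (simp add: gform_def)
      ultimately show ?thesis by (auto simp: indicator_def)
    qed
    then show "(LINT y|std_normal_distribution. indicat_real ?A (z(j := y))) = chi_cdf (lam j) (a j) (c - gform J a z)"
      unfolding chi_cdf_def by simp
  qed
  finally show ?thesis .
qed

lemma gcdf_split:
  assumes "finite J" "j \<in> J"
  shows "gcdf J a c = (LINT z|gaussian (J - {j}). chi_cdf (lam j) (a j) (c - gform (J - {j}) a z))"
  using gcdf_insert[of "J - {j}" j a c] assms by (simp add: insert_absorb)

text \<open>The bound refers to a single coordinate j. With j = 1 it is the same for all truncation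
  levels and all shifts.\<close>

lemma gcdf_anticoncentration:
  assumes J: "finite J" "j \<in> J" "1 \<le> j" and \<eta>: "0 < \<eta>"
  shows "gcdf J a (c + \<eta>) \<le> gcdf J a c + 2 * sqrt (\<eta> / lam j)"
proof -
  have "gcdf J a (c + \<eta>) = (LINT z|gaussian (J - {j}). chi_cdf (lam j) (a j) (c + \<eta> - gform (J - {j}) a z))"
    by (rule gcdf_split[OF J(1,2)])
  also have "\<dots> \<le> (LINT z|gaussian (J - {j}). chi_cdf (lam j) (a j) (c - gform (J - {j}) a z) + 2 * sqrt (\<eta> / lam j))"
  proof (rule integral_mono)
    fix z
    show "chi_cdf (lam j) (a j) (c + \<eta> - gform (J - {j}) a z) \<le> chi_cdf (lam j) (a j) (c - gform (J - {j}) a z) + 2 * sqrt (\<eta> / lam j)"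
      using chi_cdf_anticoncentration[OF lam_pos[OF J(3)] \<eta>, of "a j" "c - gform (J - {j}) a z"]
      by (simp add: algebra_simps)
  qed (use integrable_chi_gform in auto)
  also have "\<dots> = gcdf J a c + 2 * sqrt (\<eta> / lam j)"
    using integrable_chi_gform gaussian.prob_space by (simp add: gcdf_split[OF J(1,2)])
  finally show ?thesis .
qed

text \<open>Anderson's inequality for one coordinate: a centred quadratic form is stochastically
  smallest. Removing shifts one at a time avoids the multivariate statement.\<close>

lemma gcdf_zero_coordinate:
  assumes J: "finite J" "0 \<notin> J"
  shows "gcdf J a c \<le> gcdf J (a(j := 0)) c"
proof (cases "j \<in> J")
  case False
  then have "gcdf J a = gcdf J (a(j := 0))" by (intro gcdf_cong) auto
  then show ?thesis by simp
next
  case True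
  have g: "gform (J - {j}) (a(j := 0)) z = gform (J - {j}) a z" for z
    unfolding gform_def by (intro sum.cong) auto
  have l: "0 < lam j" using True J by (intro lam_pos) (cases j, auto)
  show ?thesis
    unfolding gcdf_split[OF J(1) True] g
    by (rule integral_mono) (use integrable_chi_gform chi_cdf_shift_le[OF l] in auto)
qed

lemma gcdf_zero_coordinates:
  assumes J: "finite J" "0 \<notin> J" and I: "finite I"
  shows "gcdf J a c \<le> gcdf J (\<lambda>j. if j \<in> I then 0 else a j) c"
  using I
proof (induction I rule: finite_induct)
  case (insert i I)
  have "(\<lambda>j. if j \<in> I then 0 else a j)(i := 0) = (\<lambda>j. if j \<in> insert i I then 0 else a j)" by auto
  then show ?case using insert.IH gcdf_zero_coordinate[OF J, of "\<lambda>j. if j \<in> I then 0 else a j" c i] by simp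
qed simp

lemma gaussian_second_moment:
  assumes "j \<in> J"
  shows "integrable (gaussian J) (\<lambda>z. (z j)\<^sup>2)" "(LINT z|gaussian J. (z j)\<^sup>2) = 1"
proof -
  interpret product_prob_space "\<lambda>_. std_normal_distribution" J by unfold_locales
  have d: "distr (gaussian J) std_normal_distribution (\<lambda>z. z j) = std_normal_distribution"
    using PiM_component[OF assms] .
  have m: "(\<lambda>z. z j) \<in> measurable (gaussian J) std_normal_distribution"
    using assms by (rule measurable_component_singleton)
  have i: "integrable std_normal_distribution (\<lambda>x. x\<^sup>2)"
    by (rule integrable_std_normal_distribution_moment)
  show "integrable (gaussian J) (\<lambda>z. (z j)\<^sup>2)"
    using integrable_distr_eq[OF m, of "\<lambda>x. x\<^sup>2"] i unfolding d by simp
  have "(LINT z|gaussian J. (z j)\<^sup>2) = (LINT x|std_normal_distribution. x\<^sup>2)"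
    using integral_distr[OF m, of "\<lambda>x. x\<^sup>2"] unfolding d by simp
  also have "\<dots> = 1" using std_normal_distribution_even_moments(1)[of 1] by simp
  finally show "(LINT z|gaussian J. (z j)\<^sup>2) = 1" .
qed

lemma gcdf_markov:
  assumes J: "finite J" and w: "0 < w"
  shows "1 - (\<Sum>j\<in>J. lam j) / w \<le> gcdf J (\<lambda>_. 0) w"
proof -
  have i: "integrable (gaussian J) (gform J (\<lambda>_. 0))"
    unfolding gform_def using gaussian_second_moment by simp
  have e: "(LINT z|gaussian J. gform J (\<lambda>_. 0) z) = (\<Sum>j\<in>J. lam j)"
    unfolding gform_def using gaussian_second_moment by simp
  have "measure (gaussian J) {z \<in> space (gaussian J). w \<le> gform J (\<lambda>_. 0) z} \<le> (LINT z|gaussian J. gform J (\<lambda>_. 0) z) / w"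
    by (rule integral_Markov_inequality_measure[OF i, of "{}"]) (use gform_nonneg w in auto)
  moreover have "measure (gaussian J) (space (gaussian J)) \<le> measure (gaussian J) ({z \<in> space (gaussian J). gform J (\<lambda>_. 0) z \<le> w} \<union> {z \<in> space (gaussian J). w \<le> gform J (\<lambda>_. 0) z})"
    by (rule gaussian.finite_measure_mono) auto
  moreover have "\<dots> \<le> gcdf J (\<lambda>_. 0) w + measure (gaussian J) {z \<in> space (gaussian J). w \<le> gform J (\<lambda>_. 0) z}"
    unfolding gcdf_def by (rule measure_Un_le) auto
  ultimately show ?thesis using e gaussian.prob_space[of J] by simp
qed

text \<open>The levels \<open>w/2 (1 + 2\<^sup>-\<^sup>m)\<close> leave room to insert the first coordinates one at a time, while
  Markov's inequality covers all remaining ones.\<close>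

lemma gcdf_small_ball:
  assumes w: "0 < w"
  obtains p where "0 < p" "\<And>J. finite J \<Longrightarrow> 0 \<notin> J \<Longrightarrow> p \<le> gcdf J (\<lambda>_. 0) w"
proof -
  define v where "v m = w / 2 * (1 + (1 / 2) ^ m)" for m :: nat
  have v: "w / 2 < v m" "v (Suc m) < v m" for m using w by (auto simp: v_def)
  have "(\<lambda>m. suminf lam - (\<Sum>j<m. lam j)) \<longlonglongrightarrow> suminf lam - suminf lam"
    by (intro tendsto_intros summable_LIMSEQ summable_lam)
  then have "\<forall>\<^sub>F m in sequentially. suminf lam - (\<Sum>j<m. lam j) < w / 4"
    by (rule order_tendstoD) (use w in auto)
  then obtain N where "\<And>n. N \<le> n \<Longrightarrow> suminf lam - (\<Sum>j<n. lam j) < w / 4"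
    unfolding eventually_sequentially by blast
  then obtain m where m: "suminf lam - (\<Sum>j<Suc m. lam j) < w / 4" by (meson le_Suc_eq order_refl)
  have "\<exists>p>0. \<forall>J. finite J \<and> J \<subseteq> {i<..} \<longrightarrow> p \<le> gcdf J (\<lambda>_. 0) (v i)" if "i \<le> m" for i
    using that
  proof (induction i rule: inc_induct)
    case base
    have "1 / 2 \<le> gcdf J (\<lambda>_. 0) (v m)" if J: "finite J" "J \<subseteq> {m<..}" for J
    proof -
      have "(\<Sum>j<Suc m. lam j) + (\<Sum>j\<in>J. lam j) = (\<Sum>j\<in>{..<Suc m} \<union> J. lam j)"
        using J by (intro sum.union_disjoint[symmetric]) auto
      also have "\<dots> \<le> suminf lam" using J by (intro sum_le_suminf summable_lam) (auto simp: lam_nonneg)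
      finally have "(\<Sum>j\<in>J. lam j) < w / 4" using m by simp
      then have "(\<Sum>j\<in>J. lam j) / v m \<le> 1 / 2" using v[of m] w by (simp add: field_simps)
      moreover have "0 < v m" using v(1)[of m] w by linarith
      ultimately show ?thesis using gcdf_markov[OF J(1), of "v m"] by linarith
    qed
    then show ?case by (intro exI[of _ "1 / 2"]) auto
  next
    case (step i)
    then obtain p where p: "0 < p" "\<And>J. finite J \<Longrightarrow> J \<subseteq> {Suc i<..} \<Longrightarrow> p \<le> gcdf J (\<lambda>_. 0) (v (Suc i))" by auto
    define L where "L = v i - v (Suc i)"
    have L: "0 < L" using v(2)[of i] by (simp add: L_def)
    have l: "0 < lam (Suc i)" by (rule lam_pos) simp
    \<comment> \<open>At the single threshold L the increment bound says that the new coordinate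
      stays below L with probability at least d, where L is the room between two consecutive
      levels.\<close>
    obtain d where d: "0 < d" "\<And>t. t \<in> {L..L} \<Longrightarrow> chi_cdf (lam (Suc i)) 0 (t - L) + d \<le> chi_cdf (lam (Suc i)) 0 t"
      using chi_cdf_increment[OF l L order_refl order_refl] by blast
    then have dL: "d \<le> chi_cdf (lam (Suc i)) 0 L"
      using d(2)[of L] chi_cdf_nonneg[of "lam (Suc i)" 0 0] by simp
    have d1: "d \<le> 1" using dL chi_cdf_le_1[of "lam (Suc i)" 0 L] by simp
    have "d * p \<le> gcdf J (\<lambda>_. 0) (v i)" if J: "finite J" "J \<subseteq> {i<..}" for J
    proof (cases "Suc i \<in> J")
      case False
      then have "J \<subseteq> {Suc i<..}" using J by (metis Suc_lessI greaterThan_iff subset_iff)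
      then have "p \<le> gcdf J (\<lambda>_. 0) (v (Suc i))" using p(2) J by blast
      also have "\<dots> \<le> gcdf J (\<lambda>_. 0) (v i)" using v(2)[of i] by (intro gcdf_mono) simp
      finally show ?thesis using mult_right_mono[OF d1, of p] p(1) by linarith
    next
      case True
      define I where "I = J - {Suc i}"
      have I: "finite I" "I \<subseteq> {Suc i<..}" using J by (auto simp: I_def intro!: Suc_lessI)
      let ?A = "{z \<in> space (gaussian I). gform I (\<lambda>_. 0) z \<le> v (Suc i)}"
      have A: "?A \<in> sets (gaussian I)" by measurable
      have "d * p \<le> d * gcdf I (\<lambda>_. 0) (v (Suc i))" using d p(2)[OF I] by (intro mult_left_mono) auto
      also have "\<dots> = (LINT z|gaussian I. d * indicat_real ?A z)"
        unfolding gcdf_def using A by simp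
      also have "\<dots> \<le> (LINT z|gaussian I. chi_cdf (lam (Suc i)) 0 (v i - gform I (\<lambda>_. 0) z))"
      proof (rule integral_mono)
        fix z
        show "d * indicat_real ?A z \<le> chi_cdf (lam (Suc i)) 0 (v i - gform I (\<lambda>_. 0) z)"
          using dL chi_cdf_mono[of L "v i - gform I (\<lambda>_. 0) z" "lam (Suc i)" 0] chi_cdf_nonneg
          by (auto simp: indicator_def L_def)
      qed (use A integrable_chi_gform in \<open>auto simp: less_top[symmetric]\<close>)
      also have "\<dots> = gcdf J (\<lambda>_. 0) (v i)" using gcdf_split[OF J(1) True] by (simp add: I_def)
      finally show ?thesis .
    qed
    then show ?case using d p by (intro exI[of _ "d * p"]) auto
  qed
  from this[of 0] obtain p where p: "0 < p" "\<And>J. finite J \<Longrightarrow> J \<subseteq> {0<..} \<Longrightarrow> p \<le> gcdf J (\<lambda>_. 0) (v 0)" by auto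
  have "v 0 = w" by (simp add: v_def)
  moreover have "J \<subseteq> {0<..}" if "0 \<notin> J" for J :: "nat set" using that by (metis greaterThan_iff gr0I subsetI)
  ultimately show ?thesis using that[OF p(1)] p(2) by simp
qed

lemma integral_gap:
  assumes A: "A \<in> sets (gaussian I)" and f: "integrable (gaussian I) f" and g: "integrable (gaussian I) g"
    and le: "\<And>z. z \<in> space (gaussian I) \<Longrightarrow> f z \<le> (g z :: real)" and gap: "\<And>z. z \<in> A \<Longrightarrow> f z + d \<le> g z"
  shows "(LINT z|gaussian I. f z) + d * measure (gaussian I) A \<le> (LINT z|gaussian I. g z)"
proof -
  have "(LINT z|gaussian I. f z) + d * measure (gaussian I) A = (LINT z|gaussian I. f z + d * indicat_real A z)"
    using A f by (simp add: less_top[symmetric])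
  also have "\<dots> \<le> (LINT z|gaussian I. g z)"
  proof (rule integral_mono)
    show "integrable (gaussian I) (\<lambda>z. f z + d * indicat_real A z)" using A f by (simp add: less_top[symmetric])
    show "f z + d * indicat_real A z \<le> g z" if "z \<in> space (gaussian I)" for z
      using le[OF that] gap by (auto simp: indicator_def)
  qed (rule g)
  finally show ?thesis .
qed

text \<open>On the event that the coordinates other than 1 use up at most t0 / 2, the threshold left
  for coordinate 1 lies in [t0 / 2, t1] and the one-dimensional shell bound applies. That event has
  probability at least p whatever J is, so the gain d is independent of the truncation
  level.\<close>

lemma gcdf_increment:
  assumes t: "0 < L" "L \<le> t0 / 2" "t0 \<le> t1"
  obtains d where "0 < d"
    "\<And>J c. finite J \<Longrightarrow> 0 \<notin> J \<Longrightarrow> 1 \<in> J \<Longrightarrow> c \<in> {t0..t1} \<Longrightarrow> gcdf J (\<lambda>_. 0) (c - L) + d \<le> gcdf J (\<lambda>_. 0) c"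
proof -
  have l: "0 < lam 1" by (rule lam_pos) simp
  obtain d where d: "0 < d" "\<And>t. t \<in> {t0 / 2..t1} \<Longrightarrow> chi_cdf (lam 1) 0 (t - L) + d \<le> chi_cdf (lam 1) 0 t"
    using chi_cdf_increment[OF l t(1,2), of t1] t by auto
  obtain p where p: "0 < p" "\<And>J. finite J \<Longrightarrow> 0 \<notin> J \<Longrightarrow> p \<le> gcdf J (\<lambda>_. 0) (t0 / 2)"
    using gcdf_small_ball[of "t0 / 2"] t by auto
  have "gcdf J (\<lambda>_. 0) (c - L) + d * p \<le> gcdf J (\<lambda>_. 0) c" if J: "finite J" "0 \<notin> J" "1 \<in> J" and c: "c \<in> {t0..t1}" for J c
  proof -
    define I where "I = J - {1}"
    let ?A = "{z \<in> space (gaussian I). gform I (\<lambda>_. 0) z \<le> t0 / 2}"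
    have "gcdf J (\<lambda>_. 0) (c - L) + d * p \<le> gcdf J (\<lambda>_. 0) (c - L) + d * measure (gaussian I) ?A"
      using p(2)[of I] J d unfolding I_def gcdf_def by (intro add_left_mono mult_left_mono) auto
    also have "\<dots> \<le> gcdf J (\<lambda>_. 0) c"
      unfolding gcdf_split[OF J(1,3)] I_def[symmetric]
    proof (rule integral_gap)
      show "?A \<in> sets (gaussian I)" by measurable
      show "chi_cdf (lam 1) 0 (c - L - gform I (\<lambda>_. 0) z) \<le> chi_cdf (lam 1) 0 (c - gform I (\<lambda>_. 0) z)" for z
        using t by (intro chi_cdf_mono) simp
      show "chi_cdf (lam 1) 0 (c - L - gform I (\<lambda>_. 0) z) + d \<le> chi_cdf (lam 1) 0 (c - gform I (\<lambda>_. 0) z)" if "z \<in> ?A" for z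
        using d(2)[of "c - gform I (\<lambda>_. 0) z"] that c gform_nonneg[of I "\<lambda>_. 0" z] by (simp add: algebra_simps)
    qed (rule integrable_chi_gform)+
    finally show ?thesis .
  qed
  then show ?thesis using that[of "d * p"] d p by auto
qed

text \<open>Same event as for the increment, after all shifts other than that of j have been
  removed. The restriction j \<le> M allows a minimum over finitely many one-dimensional gains,
  while J itself may reach arbitrarily far beyond M.\<close>

lemma gcdf_shift_gap:
  assumes t: "0 < t0" "t0 \<le> t1" and A: "0 < A"
  obtains d where "0 < d"
    "\<And>J c a j. finite J \<Longrightarrow> 0 \<notin> J \<Longrightarrow> j \<in> J \<Longrightarrow> j \<le> M \<Longrightarrow> c \<in> {t0..t1} \<Longrightarrow> A \<le> \<bar>a j\<bar> \<Longrightarrow>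
       gcdf J a c + d \<le> gcdf J (\<lambda>_. 0) c"
proof -
  have "\<exists>d>0. \<forall>t a. t \<in> {t0 / 2..t1} \<and> A \<le> \<bar>a\<bar> \<longrightarrow> chi_cdf (lam j) a t + d \<le> chi_cdf (lam j) 0 t" if j: "1 \<le> j" for j
  proof -
    obtain d where d: "0 < d" "\<And>t a. t \<in> {t0 / 2..t1} \<Longrightarrow> A \<le> \<bar>a\<bar> \<Longrightarrow> chi_cdf (lam j) a t + d \<le> chi_cdf (lam j) 0 t"
      using chi_cdf_shift_gap[OF lam_pos[OF j], of "t0 / 2" t1 A] t A by auto
    then show ?thesis by blast
  qed
  then obtain d where d: "\<And>j. 1 \<le> j \<Longrightarrow> 0 < d j"
      "\<And>j t a. 1 \<le> j \<Longrightarrow> t \<in> {t0 / 2..t1} \<Longrightarrow> A \<le> \<bar>a\<bar> \<Longrightarrow> chi_cdf (lam j) a t + d j \<le> chi_cdf (lam j) 0 t"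
    by metis
  \<comment> \<open>The inserted 1 keeps the set nonempty when M = 0.\<close>
  define e where "e = Min (insert 1 (d ` {1..M}))"
  have e: "0 < e" "\<And>j. j \<in> {1..M} \<Longrightarrow> e \<le> d j"
    unfolding e_def using d(1) by (auto intro!: Min_le simp: Min_gr_iff simp del: Min_insert)
  obtain p where p: "0 < p" "\<And>J. finite J \<Longrightarrow> 0 \<notin> J \<Longrightarrow> p \<le> gcdf J (\<lambda>_. 0) (t0 / 2)"
    using gcdf_small_ball[of "t0 / 2"] t by auto
  have "gcdf J a c + e * p \<le> gcdf J (\<lambda>_. 0) c"
    if J: "finite J" "0 \<notin> J" "j \<in> J" "j \<le> M" and c: "c \<in> {t0..t1}" and a: "A \<le> \<bar>a j\<bar>" for J c a j
  proof -
    have j1: "1 \<le> j" using J by (cases j) auto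
    define I where "I = J - {j}"
    define b where "b i = (if i \<in> I then 0 else a i)" for i
    let ?A = "{z \<in> space (gaussian I). gform I (\<lambda>_. 0) z \<le> t0 / 2}"
    have bg: "gform I b z = gform I (\<lambda>_. 0) z" for z unfolding gform_def b_def by simp
    have "gcdf J a c + e * p \<le> gcdf J b c + e * measure (gaussian I) ?A"
    proof (rule add_mono)
      show "gcdf J a c \<le> gcdf J b c"
        unfolding b_def using J by (intro gcdf_zero_coordinates) (auto simp: I_def)
      show "e * p \<le> e * measure (gaussian I) ?A"
        using p(2)[of I] J e unfolding I_def gcdf_def by (intro mult_left_mono) auto
    qed
    also have "\<dots> \<le> gcdf J (\<lambda>_. 0) c"
      unfolding gcdf_split[OF J(1,3)] I_def[symmetric] bg
    proof (rule integral_gap)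
      show "?A \<in> sets (gaussian I)" by measurable
      show "chi_cdf (lam j) (b j) (c - gform I (\<lambda>_. 0) z) \<le> chi_cdf (lam j) 0 (c - gform I (\<lambda>_. 0) z)" for z
        by (rule chi_cdf_shift_le[OF lam_pos[OF j1]])
      show "chi_cdf (lam j) (b j) (c - gform I (\<lambda>_. 0) z) + e \<le> chi_cdf (lam j) 0 (c - gform I (\<lambda>_. 0) z)" if "z \<in> ?A" for z
        using d(2)[OF j1, of "c - gform I (\<lambda>_. 0) z" "b j"] e(2)[of j] that c a J j1 gform_nonneg[of I "\<lambda>_. 0" z]
        by (simp add: b_def I_def)
    qed (rule integrable_chi_gform)+
    finally show ?thesis .
  qed
  then show ?thesis using that[of "e * p"] e p by auto
qed

section \<open>Limit law and truncation of the statistic\<close>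

text \<open>The shifts \<open>a i\<close> are unrestricted. Coordinate 1 is required in J because
  the modulus of continuity of the Gaussian side comes from it.\<close>

lemma cscore_gform_clt:
  assumes law: "\<And>i. cos_law (\<mu> i) (\<theta> i)" and n: "filterlim n at_top sequentially"
    and \<epsilon>: "\<And>i m. 1 \<le> m \<Longrightarrow> \<bar>\<theta> i m\<bar> \<le> \<epsilon> i" "\<epsilon> \<longlonglongrightarrow> 0"
    and J: "finite J" "0 \<notin> J" "1 \<in> J" and c: "\<And>i. c i \<le> C"
  shows "(\<lambda>i. measure (iid (n i) (\<mu> i)) {X \<in> space (iid (n i) (\<mu> i)). gform J (a i) (cscore (\<theta> i) (n i) X) \<le> c i} -
     gcdf J (a i) (c i)) \<longlonglongrightarrow> 0"
  unfolding gcdf_def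
proof (rule cdf_difference_tendsto[OF _ _ _ _ _ _ _ _ c])
  show "prob_space (iid (n i) (\<mu> i))" for i
    using law[of i] by (intro prob_space_iid) (simp add: cos_law_def)
  show "prob_space (gaussian J)" by (rule prob_space_gaussian)
  show "gform J (a i) \<in> borel_measurable (gaussian J)" for i by measurable
  show "(\<lambda>X. gform J (a i) (cscore (\<theta> i) (n i) X)) \<in> borel_measurable (iid (n i) (\<mu> i))" for i
  proof -
    have [measurable]: "(\<lambda>X. cscore (\<theta> i) (n i) X j) \<in> borel_measurable (iid (n i) (\<mu> i))" for j
      by (rule cscore_measurable[OF law])
    show ?thesis unfolding gform_def by measurable
  qed
  show "0 \<le> gform J (a i) (cscore (\<theta> i) (n i) X)" "0 \<le> gform J (a i) z" for i X z
    by (rule gform_nonneg)+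
  show "measure (gaussian J) {z \<in> space (gaussian J). gform J (a i) z \<le> t + \<eta>}
      \<le> measure (gaussian J) {z \<in> space (gaussian J). gform J (a i) z \<le> t} + 2 / sqrt (lam 1) * sqrt \<eta>" if "0 < \<eta>" for i t \<eta>
    using gcdf_anticoncentration[OF J(1,3) _ that, of "a i" t] by (simp add: gcdf_def real_sqrt_divide)
  show "(\<lambda>i. (LINT X|iid (n i) (\<mu> i). exp (- (real k * gform J (a i) (cscore (\<theta> i) (n i) X)))) -
      (LINT z|gaussian J. exp (- (real k * gform J (a i) z)))) \<longlonglongrightarrow> 0" for k
  proof -
    \<comment> \<open>With these weights the k-th power of exp (- form) is the exponential of minus
      half a sum of squares, the shape covered by the Gaussian average.\<close>
    define b where "b j = sqrt (2 * real k * lam j)" for j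
    have "- (\<Sum>j\<in>J. (b j * (z j + a i j))\<^sup>2) / 2 = - (real k * gform J (a i) z)" for i z
    proof -
      have "(b j * (z j + a i j))\<^sup>2 = 2 * (real k * (lam j * (z j + a i j)\<^sup>2))" for j
        unfolding b_def power_mult_distrib using lam_nonneg[of j] by simp
      then show ?thesis unfolding gform_def by (simp add: sum_distrib_left[symmetric])
    qed
    then show ?thesis
      using cscore_laplace_tendsto[OF law n \<epsilon> J(1,2), of b a] by simp
  qed
qed

section \<open>Splitting the statistic at a frequency m\<close>

definition lam_tail :: "nat \<Rightarrow> real" where
  "lam_tail m = (\<Sum>j. if m < j then lam j else 0)"

lemma summable_if_tail:
  fixes f :: "nat \<Rightarrow> real"
  assumes "summable f"
  shows "summable (\<lambda>j. if m < j then f j else 0)"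
  using assms by (subst summable_cong[of _ f]) (auto simp: eventually_at_top_dense)

lemma suminf_split_tail:
  fixes f :: "nat \<Rightarrow> real"
  assumes f: "summable f" "f 0 = 0"
  shows "suminf f = (\<Sum>j\<in>{1..m}. f j) + (\<Sum>j. if m < j then f j else 0)"
proof -
  have "(\<lambda>j. if m < j then f j else 0) sums (suminf f - (\<Sum>j\<in>{1..m}. f j))"
  proof -
    have "(\<lambda>j. if j \<in> {1..m} then f j else 0) sums (\<Sum>j\<in>{1..m}. f j)"
      by (rule sums_If_finite_set) simp
    from sums_diff[OF summable_sums[OF f(1)] this] show ?thesis
      by (rule sums_cong[THEN iffD1, rotated]) (use f(2) in \<open>auto simp: Suc_le_eq\<close>)
  qed
  then show ?thesis by (simp add: sums_iff)
qed

lemma lam_tail_tendsto: "lam_tail \<longlonglongrightarrow> 0"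
proof -
  have "lam_tail m = suminf lam - (\<Sum>j<Suc m. lam j)" for m
  proof -
    have "(\<Sum>j<Suc m. lam j) = (\<Sum>j\<in>{1..m}. lam j)"
      by (rule sum.mono_neutral_right) (auto simp: lam_def not_le)
    then show ?thesis
      unfolding lam_tail_def using suminf_split_tail[OF summable_lam, of m] by (simp add: lam_def)
  qed
  moreover have "(\<lambda>m. suminf lam - (\<Sum>j<Suc m. lam j)) \<longlonglongrightarrow> suminf lam - suminf lam"
    by (intro tendsto_intros LIMSEQ_Suc[OF summable_LIMSEQ] summable_lam)
  ultimately have "(\<lambda>m. lam_tail m) \<longlonglongrightarrow> suminf lam - suminf lam" by (simp only:)
  then show ?thesis by simp
qed

lemma lam_tail_nonneg: "0 \<le> lam_tail m"
  unfolding lam_tail_def by (intro suminf_nonneg summable_if_tail summable_lam) (auto simp: lam_nonneg)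

lemma lam_tail_0: "lam_tail 0 = 1 / 6"
  using suminf_split_tail[OF summable_lam, of 0] lam_sums by (simp add: lam_tail_def lam_def sums_iff)

lemma summable_lam_bounded:
  assumes "\<And>j. 1 \<le> j \<Longrightarrow> \<bar>g j\<bar> \<le> B"
  shows "summable (\<lambda>j. lam j * (g j)\<^sup>2)"
proof (rule summable_comparison_test'[where N = 0])
  show "summable (\<lambda>j. lam j * B\<^sup>2)" using summable_lam by (rule summable_mult2)
  fix j :: nat
  show "norm (lam j * (g j)\<^sup>2) \<le> lam j * B\<^sup>2"
  proof (cases "j = 0")
    case False
    then have "(g j)\<^sup>2 \<le> B\<^sup>2" using power_mono[OF assms[of j], of 2] by simp
    then show ?thesis using lam_nonneg[of j] by (simp add: abs_mult mult_left_mono)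
  qed (simp add: lam_def)
qed

lemma cvm_measurable:
  assumes [measurable_cong]: "sets \<mu> = sets borel"
  shows "cvm n \<in> borel_measurable (iid n \<mu>)"
proof -
  have comp: "(\<lambda>p. fst p i) \<in> borel_measurable (iid n \<mu> \<Otimes>\<^sub>M lborel)" if "i < n" for i
  proof (rule measurable_compose[OF measurable_fst])
    show "(\<lambda>X. X i) \<in> borel_measurable (iid n \<mu>)" using that by (intro measurable_iid_component[of "\<lambda>x. x"]) (auto cong: measurable_cong_sets simp: assms)
  qed
  have proj: "snd \<in> borel_measurable (iid n \<mu> \<Otimes>\<^sub>M lborel)" by simp
  have bool:  "(\<lambda>p. of_bool (fst p i \<le> snd p) :: real) \<in> borel_measurable (iid n \<mu> \<Otimes>\<^sub>M lborel)" if "i < n" for i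
    unfolding of_bool_def by (intro measurable_If borel_measurable_le borel_measurable_const comp[OF that] proj)
  have ms: "(\<lambda>p. \<Sum>i<n. of_bool (fst p i \<le> snd p) :: real) \<in> borel_measurable (iid n \<mu> \<Otimes>\<^sub>M lborel)"
    by (intro borel_measurable_sum bool) simp
  have "(\<lambda>(X, x). indicat_real {0..1} x *\<^sub>R (ecdf n X x - x)\<^sup>2) \<in> borel_measurable (iid n \<mu> \<Otimes>\<^sub>M lborel)"
    unfolding ecdf_sum case_prod_beta
    by (intro borel_measurable_scaleR borel_measurable_power borel_measurable_diff borel_measurable_divide
        borel_measurable_const ms proj measurable_compose[OF proj borel_measurable_indicator]) simp
  then have "(\<lambda>X. LBINT x:{0..1}. (ecdf n X x - x)\<^sup>2) \<in> borel_measurable (iid n \<mu>)"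
    unfolding set_lebesgue_integral_def by (rule lborel.borel_measurable_lebesgue_integral)
  then show ?thesis unfolding cvm_def by measurable
qed

abbreviation drift :: "(nat \<Rightarrow> real) \<Rightarrow> nat \<Rightarrow> nat \<Rightarrow> real" where
  "drift \<theta> n j \<equiv> sqrt (real n) * \<theta> j"

definition score_tail :: "(nat \<Rightarrow> real) \<Rightarrow> nat \<Rightarrow> nat \<Rightarrow> (nat \<Rightarrow> real) \<Rightarrow> real" where
  "score_tail \<theta> n m X = (\<Sum>j. if m < j then lam j * (cscore \<theta> n X j)\<^sup>2 else 0)"

definition drift_tail :: "(nat \<Rightarrow> real) \<Rightarrow> nat \<Rightarrow> nat \<Rightarrow> real" where
  "drift_tail \<theta> n m = (\<Sum>j. if m < j then lam j * (drift \<theta> n j)\<^sup>2 else 0)"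

definition cvm_prob :: "real measure \<Rightarrow> nat \<Rightarrow> real \<Rightarrow> real" where
  "cvm_prob \<mu> n c = measure (iid n \<mu>) {X \<in> space (iid n \<mu>). cvm n X \<le> c}"

definition trunc_prob :: "real measure \<Rightarrow> (nat \<Rightarrow> real) \<Rightarrow> nat \<Rightarrow> nat \<Rightarrow> real \<Rightarrow> real" where
  "trunc_prob \<mu> \<theta> n m c = measure (iid n \<mu>) {X \<in> space (iid n \<mu>). gform {1..m} (drift \<theta> n) (cscore \<theta> n X) \<le> c}"

context
  fixes \<mu> :: "real measure" and \<theta> :: "nat \<Rightarrow> real" and n :: nat
  assumes law: "cos_law \<mu> \<theta>" and n: "0 < n"
begin

interpretation P: prob_space "iid n \<mu>"
  using law by (intro prob_space_iid) (simp add: cos_law_def)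

lemma summable_score: "summable (\<lambda>j. lam j * (cscore \<theta> n X j)\<^sup>2)"
  by (rule summable_lam_bounded[OF abs_cscore_le[OF law]])

lemma summable_drift: "summable (\<lambda>j. lam j * (drift \<theta> n j)\<^sup>2)"
proof (rule summable_lam_bounded)
  show "\<bar>drift \<theta> n j\<bar> \<le> sqrt (real n) * sqrt 2" if "1 \<le> j" for j
    unfolding abs_mult using cos_law_coeff_le[OF law that] by (intro mult_mono) auto
qed

lemma summable_score_drift: "summable (\<lambda>j. lam j * (cscore \<theta> n X j + drift \<theta> n j)\<^sup>2)"
proof (rule summable_lam_bounded)
  show "\<bar>cscore \<theta> n X j + drift \<theta> n j\<bar> \<le> 2 * sqrt 2 * sqrt (real n) + sqrt (real n) * sqrt 2" if "1 \<le> j" for j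
  proof (rule order_trans[OF abs_triangle_ineq add_mono])
    show "\<bar>drift \<theta> n j\<bar> \<le> sqrt (real n) * sqrt 2"
      unfolding abs_mult using cos_law_coeff_le[OF law that] by (intro mult_mono) auto
  qed (rule abs_cscore_le[OF law that])
qed

text \<open>Only second moments of the single scores enter, so no joint information about different
  frequencies is needed and the bound is free of the sample size and of the law.\<close>

lemma score_tail_markov:
  assumes \<eta>: "0 < \<eta>"
  shows "measure (iid n \<mu>) {X \<in> space (iid n \<mu>). \<eta> \<le> score_tail \<theta> n m X} \<le> 2 * lam_tail m / \<eta>"
    and "score_tail \<theta> n m \<in> borel_measurable (iid n \<mu>)"
proof -
  define f where "f j X = (if m < j then lam j * (cscore \<theta> n X j)\<^sup>2 else 0)" for j X
  have [measurable]: "(\<lambda>X. cscore \<theta> n X j) \<in> borel_measurable (iid n \<mu>)" for j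
    by (rule cscore_measurable[OF law])
  have f0: "0 \<le> f j X" for j X unfolding f_def by (simp add: lam_nonneg)
  have fm [measurable]: "f j \<in> borel_measurable (iid n \<mu>)" for j unfolding f_def by measurable
  have si: "integrable (iid n \<mu>) (\<lambda>X. (cscore \<theta> n X j)\<^sup>2)" if "1 \<le> j" for j
  proof (rule P.integrable_const_bound[of _ "(2 * sqrt 2 * sqrt (real n))\<^sup>2"])
    show "AE X in iid n \<mu>. norm ((cscore \<theta> n X j)\<^sup>2) \<le> (2 * sqrt 2 * sqrt (real n))\<^sup>2"
    proof (rule AE_I2)
      fix X show "norm ((cscore \<theta> n X j)\<^sup>2) \<le> (2 * sqrt 2 * sqrt (real n))\<^sup>2"
        using power_mono[OF abs_cscore_le[OF law that, of n X], of 2] by simp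
    qed
  qed simp
  have fi: "integrable (iid n \<mu>) (f j)" for j
    unfolding f_def using si[of j] by (cases "m < j") auto
  have fe: "(LINT X|iid n \<mu>. f j X) \<le> (if m < j then lam j else 0) * 2" for j
    unfolding f_def using cscore_second_moment[OF law, of j n] lam_nonneg[of j]
    by (cases "m < j") (auto intro: mult_left_mono)
  have fs: "summable (\<lambda>j. f j X)" for X unfolding f_def by (rule summable_if_tail[OF summable_score])
  have es: "summable (\<lambda>j. LINT X|iid n \<mu>. f j X)"
  proof (rule summable_comparison_test'[where N = 0])
    show "summable (\<lambda>j. (if m < j then lam j else 0) * 2)"
      by (intro summable_mult2 summable_if_tail summable_lam)
    show "norm (LINT X|iid n \<mu>. f j X) \<le> (if m < j then lam j else 0) * 2" for j
      using fe[of j] Bochner_Integration.integral_nonneg[of "iid n \<mu>" "f j"] f0 by simp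
  qed
  have R: "score_tail \<theta> n m = (\<lambda>X. \<Sum>j. f j X)" by (simp add: fun_eq_iff score_tail_def f_def)
  show "score_tail \<theta> n m \<in> borel_measurable (iid n \<mu>)" unfolding R by measurable
  have Ri: "integrable (iid n \<mu>) (score_tail \<theta> n m)"
    unfolding R by (rule integrable_suminf[OF fi]) (use fs es f0 in auto)
  have "(LINT X|iid n \<mu>. score_tail \<theta> n m X) = (\<Sum>j. LINT X|iid n \<mu>. f j X)"
    unfolding R by (rule integral_suminf[OF fi]) (use fs es f0 in auto)
  also have "\<dots> \<le> (\<Sum>j. (if m < j then lam j else 0) * 2)"
    by (intro suminf_le fe es summable_mult2 summable_if_tail summable_lam)
  also have "\<dots> = 2 * lam_tail m"
    unfolding lam_tail_def by (subst suminf_mult2[symmetric]) (auto intro!: summable_if_tail summable_lam)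
  finally have e: "(LINT X|iid n \<mu>. score_tail \<theta> n m X) \<le> 2 * lam_tail m" .
  have "measure (iid n \<mu>) {X \<in> space (iid n \<mu>). \<eta> \<le> score_tail \<theta> n m X} \<le> (LINT X|iid n \<mu>. score_tail \<theta> n m X) / \<eta>"
    by (rule integral_Markov_inequality_measure[OF Ri, of "{}"]) (use \<eta> fs f0 in \<open>auto simp: R intro!: suminf_nonneg\<close>)
  also have "\<dots> \<le> 2 * lam_tail m / \<eta>" using e \<eta> by (simp add: divide_right_mono)
  finally show "measure (iid n \<mu>) {X \<in> space (iid n \<mu>). \<eta> \<le> score_tail \<theta> n m X} \<le> 2 * lam_tail m / \<eta>" .
qed

text \<open>The high-frequency part is a series of weighted squares of noise plus drift. Dropping it
  gives the first bound; (S + a)^2 \<le> 2 S^2 + 2 a^2 gives the second; a^2 \<le> 2 S^2 + 2 (S +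
  a)^2 gives the third, by which drift beyond m raises the statistic by half its energy, minus
  noise.\<close>

lemma cvm_decomposition:
  assumes X: "\<And>i. i < n \<Longrightarrow> X i \<in> {0..1}"
  shows "gform {1..m} (drift \<theta> n) (cscore \<theta> n X) \<le> cvm n X"
    and "cvm n X \<le> gform {1..m} (drift \<theta> n) (cscore \<theta> n X) + 2 * score_tail \<theta> n m X + 2 * drift_tail \<theta> n m"
    and "gform {1..m} (drift \<theta> n) (cscore \<theta> n X) + drift_tail \<theta> n m / 2 - score_tail \<theta> n m X \<le> cvm n X"
proof -
  define S where "S = cscore \<theta> n X"
  define W where "W = (\<Sum>j. if m < j then lam j * (S j + drift \<theta> n j)\<^sup>2 else 0)"
  have "(\<Sum>i<n. phi j (X i)) / sqrt (real n) = S j + drift \<theta> n j" for j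
    unfolding S_def cscore_def using n by (simp add: sum_subtractf diff_divide_distrib real_div_sqrt flip: times_divide_eq_left)
  then have "cvm n X = (\<Sum>j. lam j * (S j + drift \<theta> n j)\<^sup>2)"
    using cvm_expansion[of n X, OF X n] by (simp add: sums_iff)
  then have Q: "cvm n X = gform {1..m} (drift \<theta> n) S + W"
    unfolding gform_def W_def S_def using suminf_split_tail[OF summable_score_drift, of X m] by (simp add: lam_def)
  have Ws: "summable (\<lambda>j. if m < j then lam j * (S j + drift \<theta> n j)\<^sup>2 else 0)"
    unfolding S_def by (rule summable_if_tail[OF summable_score_drift])
  have Rs: "summable (\<lambda>j. if m < j then lam j * (S j)\<^sup>2 else 0)"
    unfolding S_def by (rule summable_if_tail[OF summable_score])
  have Ts: "summable (\<lambda>j. if m < j then lam j * (drift \<theta> n j)\<^sup>2 else 0)"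
    by (rule summable_if_tail[OF summable_drift])
  have W0: "0 \<le> W" unfolding W_def by (rule suminf_nonneg[OF Ws]) (simp add: lam_nonneg)
  show "gform {1..m} (drift \<theta> n) (cscore \<theta> n X) \<le> cvm n X" using Q W0 unfolding S_def by simp
  have "W \<le> (\<Sum>j. 2 * (if m < j then lam j * (S j)\<^sup>2 else 0) + 2 * (if m < j then lam j * (drift \<theta> n j)\<^sup>2 else 0))"
    unfolding W_def
  proof (rule suminf_le[OF _ Ws])
    fix j
    have "(S j + drift \<theta> n j)\<^sup>2 \<le> 2 * (S j)\<^sup>2 + 2 * (drift \<theta> n j)\<^sup>2"
      using zero_le_power2[of "S j - drift \<theta> n j"] by (simp add: power2_eq_square algebra_simps)
    from mult_left_mono[OF this lam_nonneg[of j]]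
    show "(if m < j then lam j * (S j + drift \<theta> n j)\<^sup>2 else 0) \<le> 2 * (if m < j then lam j * (S j)\<^sup>2 else 0) + 2 * (if m < j then lam j * (drift \<theta> n j)\<^sup>2 else 0)"
      by (simp add: algebra_simps)
  qed (intro summable_add summable_mult Rs Ts)
  also have "\<dots> = 2 * score_tail \<theta> n m X + 2 * drift_tail \<theta> n m"
    using suminf_add[OF summable_mult[OF Rs, of 2] summable_mult[OF Ts, of 2]] suminf_mult[OF Rs, of 2] suminf_mult[OF Ts, of 2]
    unfolding score_tail_def drift_tail_def S_def[symmetric] by simp
  finally show "cvm n X \<le> gform {1..m} (drift \<theta> n) (cscore \<theta> n X) + 2 * score_tail \<theta> n m X + 2 * drift_tail \<theta> n m"
    using Q unfolding S_def by simp
  have "drift_tail \<theta> n m \<le> (\<Sum>j. 2 * (if m < j then lam j * (S j)\<^sup>2 else 0) + 2 * (if m < j then lam j * (S j + drift \<theta> n j)\<^sup>2 else 0))"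
    unfolding drift_tail_def
  proof (rule suminf_le[OF _ Ts])
    fix j
    have "(drift \<theta> n j)\<^sup>2 \<le> 2 * (S j)\<^sup>2 + 2 * (S j + drift \<theta> n j)\<^sup>2"
      using zero_le_power2[of "2 * S j + drift \<theta> n j"] by (simp add: power2_eq_square algebra_simps)
    from mult_left_mono[OF this lam_nonneg[of j]]
    show "(if m < j then lam j * (drift \<theta> n j)\<^sup>2 else 0) \<le> 2 * (if m < j then lam j * (S j)\<^sup>2 else 0) + 2 * (if m < j then lam j * (S j + drift \<theta> n j)\<^sup>2 else 0)"
      by (simp add: algebra_simps)
  qed (intro summable_add summable_mult Rs Ws)
  also have "\<dots> = 2 * score_tail \<theta> n m X + 2 * W"
    using suminf_add[OF summable_mult[OF Rs, of 2] summable_mult[OF Ws, of 2]] suminf_mult[OF Rs, of 2] suminf_mult[OF Ws, of 2]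
    unfolding score_tail_def W_def S_def[symmetric] by simp
  finally show "gform {1..m} (drift \<theta> n) (cscore \<theta> n X) + drift_tail \<theta> n m / 2 - score_tail \<theta> n m X \<le> cvm n X"
    using Q unfolding S_def by simp
qed

lemma AE_unit: "AE X in iid n \<mu>. \<forall>i\<in>{..<n}. X i \<in> {0..1}"
proof (rule AE_finite_allI)
  fix i assume i: "i \<in> {..<n}"
  have "AE x in \<mu>. x \<in> {0<..<1}" using law by (simp add: cos_law_def)
  then have "AE x in \<mu>. x \<in> {0..1}" by eventually_elim auto
  then show "AE X in iid n \<mu>. X i \<in> {0..1}"
    using i law by (intro AE_PiM_component) (auto simp: cos_law_def)
qed simp

lemma measurable_stats [measurable]:
  "cvm n \<in> borel_measurable (iid n \<mu>)"
  "(\<lambda>X. gform {1..m} (drift \<theta> n) (cscore \<theta> n X)) \<in> borel_measurable (iid n \<mu>)"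
  "score_tail \<theta> n m \<in> borel_measurable (iid n \<mu>)"
proof -
  show "cvm n \<in> borel_measurable (iid n \<mu>)" by (rule cvm_measurable[OF cos_law_sets[OF law]])
  show "(\<lambda>X. gform {1..m} (drift \<theta> n) (cscore \<theta> n X)) \<in> borel_measurable (iid n \<mu>)"
  proof -
    have [measurable]: "(\<lambda>X. cscore \<theta> n X j) \<in> borel_measurable (iid n \<mu>)" for j
      by (rule cscore_measurable[OF law])
    show ?thesis unfolding gform_def by measurable
  qed
  show "score_tail \<theta> n m \<in> borel_measurable (iid n \<mu>)" by (rule score_tail_markov(2)[OF zero_less_one])
qed

lemma cvm_prob_le_trunc: "cvm_prob \<mu> n c \<le> trunc_prob \<mu> \<theta> n m c"
  unfolding cvm_prob_def trunc_prob_def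
proof (rule P.finite_measure_mono_AE)
  show "AE X in iid n \<mu>. X \<in> {X \<in> space (iid n \<mu>). cvm n X \<le> c} \<longrightarrow> X \<in> {X \<in> space (iid n \<mu>). gform {1..m} (drift \<theta> n) (cscore \<theta> n X) \<le> c}"
    using AE_unit
  proof eventually_elim
    case (elim X)
    then show ?case using cvm_decomposition(1)[of X m] by auto
  qed
qed measurable

text \<open>The margin \<eta> is spent in halves: twice the tail drift and, outside the exceptional
  event, twice the tail noise each take at most \<eta> / 2.\<close>

lemma trunc_prob_le_cvm:
  assumes \<eta>: "0 < \<eta>" and T: "drift_tail \<theta> n m \<le> \<eta> / 4"
  shows "trunc_prob \<mu> \<theta> n m (c - \<eta>) \<le> cvm_prob \<mu> n c + 8 * lam_tail m / \<eta>"
proof -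
  let ?B = "{X \<in> space (iid n \<mu>). \<eta> / 4 \<le> score_tail \<theta> n m X}"
  have "trunc_prob \<mu> \<theta> n m (c - \<eta>) \<le> measure (iid n \<mu>) ({X \<in> space (iid n \<mu>). cvm n X \<le> c} \<union> ?B)"
    unfolding cvm_prob_def trunc_prob_def
  proof (rule P.finite_measure_mono_AE)
    show "AE X in iid n \<mu>. X \<in> {X \<in> space (iid n \<mu>). gform {1..m} (drift \<theta> n) (cscore \<theta> n X) \<le> c - \<eta>} \<longrightarrow> X \<in> {X \<in> space (iid n \<mu>). cvm n X \<le> c} \<union> ?B"
      using AE_unit
    proof eventually_elim
      case (elim X)
      then have "cvm n X \<le> gform {1..m} (drift \<theta> n) (cscore \<theta> n X) + 2 * score_tail \<theta> n m X + 2 * drift_tail \<theta> n m"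
        by (intro cvm_decomposition(2)) auto
      then show ?case using T by auto
    qed
  qed measurable
  also have "\<dots> \<le> cvm_prob \<mu> n c + measure (iid n \<mu>) ?B"
    unfolding cvm_prob_def trunc_prob_def by (rule measure_Un_le) measurable
  also have "measure (iid n \<mu>) ?B \<le> 2 * lam_tail m / (\<eta> / 4)" using \<eta> by (intro score_tail_markov) simp
  finally show ?thesis by simp
qed

text \<open>Tail drift of energy \<tau> raises the statistic by \<tau> / 2, of which the tail noise
  can undo \<tau> / 4 outside an event of small probability. The gain is a threshold lowered by the
  remaining \<tau> / 4.\<close>

lemma cvm_prob_le_shifted_trunc:
  assumes \<tau>: "0 < \<tau>" and T: "\<tau> \<le> drift_tail \<theta> n m"
  shows "cvm_prob \<mu> n c \<le> trunc_prob \<mu> \<theta> n m (c - \<tau> / 4) + 8 * lam_tail m / \<tau>"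
proof -
  let ?B = "{X \<in> space (iid n \<mu>). \<tau> / 4 \<le> score_tail \<theta> n m X}"
  have "cvm_prob \<mu> n c \<le> measure (iid n \<mu>) ({X \<in> space (iid n \<mu>). gform {1..m} (drift \<theta> n) (cscore \<theta> n X) \<le> c - \<tau> / 4} \<union> ?B)"
    unfolding cvm_prob_def trunc_prob_def
  proof (rule P.finite_measure_mono_AE)
    show "AE X in iid n \<mu>. X \<in> {X \<in> space (iid n \<mu>). cvm n X \<le> c} \<longrightarrow> X \<in> {X \<in> space (iid n \<mu>). gform {1..m} (drift \<theta> n) (cscore \<theta> n X) \<le> c - \<tau> / 4} \<union> ?B"
      using AE_unit
    proof eventually_elim
      case (elim X)
      then have "gform {1..m} (drift \<theta> n) (cscore \<theta> n X) + drift_tail \<theta> n m / 2 - score_tail \<theta> n m X \<le> cvm n X"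
        by (intro cvm_decomposition(3)) auto
      then show ?case using T by auto
    qed
  qed measurable
  also have "\<dots> \<le> trunc_prob \<mu> \<theta> n m (c - \<tau> / 4) + measure (iid n \<mu>) ?B"
    unfolding cvm_prob_def trunc_prob_def by (rule measure_Un_le) measurable
  also have "measure (iid n \<mu>) ?B \<le> 2 * lam_tail m / (\<tau> / 4)" using \<tau> by (intro score_tail_markov) simp
  finally show ?thesis by simp
qed

end

section \<open>Inconsistency for vanishing drift\<close>

lemma alpha_err_eq: "alpha_err n c = 1 - cvm_prob (law (\<lambda>_. 0)) n c"
proof -
  have l: "cos_law (law (\<lambda>_. 0)) (\<lambda>_. 0)" by (rule cos_law_law[OF is_dens_zero])
  interpret P: prob_space "iid n (law (\<lambda>_. 0))"
    using l by (intro prob_space_iid) (simp add: cos_law_def)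
  have [measurable]: "cvm n \<in> borel_measurable (iid n (law (\<lambda>_. 0)))"
    by (rule cvm_measurable[OF cos_law_sets[OF l]])
  have "{X \<in> space (iid n (law (\<lambda>_. 0))). cvm n X > c} =
     space (iid n (law (\<lambda>_. 0))) - {X \<in> space (iid n (law (\<lambda>_. 0))). cvm n X \<le> c}" by auto
  then show ?thesis
    unfolding alpha_err_def cvm_prob_def sample_def by (simp only:) (rule P.prob_compl, measurable)
qed

lemma beta_err_eq: "beta_err n c \<theta> = cvm_prob (law \<theta>) n c"
  unfolding beta_err_def cvm_prob_def sample_def ..

lemma cvm_prob_mono:
  assumes "cos_law \<mu> \<theta>" "c \<le> c'"
  shows "cvm_prob \<mu> n c \<le> cvm_prob \<mu> n c'" "cvm_prob \<mu> n c \<le> 1"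
proof -
  interpret P: prob_space "iid n \<mu>"
    using assms by (intro prob_space_iid) (simp add: cos_law_def)
  have [measurable]: "cvm n \<in> borel_measurable (iid n \<mu>)"
    by (rule cvm_measurable[OF cos_law_sets[OF assms(1)]])
  show "cvm_prob \<mu> n c \<le> cvm_prob \<mu> n c'"
    unfolding cvm_prob_def using assms(2) by (intro P.finite_measure_mono) auto
  show "cvm_prob \<mu> n c \<le> 1" unfolding cvm_prob_def by simp
qed

lemma drift_tail_zero: "drift_tail (\<lambda>_. 0) n m = 0"
  by (simp add: drift_tail_def cong: if_cong)

text \<open>Tightness under the null, valid for each positive n. At truncation level 0 the form is
  an empty sum and the whole statistic is tail noise; \<open>lam_tail 0\<close> = 1/6 produces the
  constant 4/3.\<close>

lemma null_cvm_prob_ge: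
  assumes "0 < n" "0 < K"
  shows "1 - 4 / (3 * K) \<le> cvm_prob (law (\<lambda>_. 0)) n K"
proof -
  have l: "cos_law (law (\<lambda>_. 0)) (\<lambda>_. 0)" by (rule cos_law_law[OF is_dens_zero])
  interpret P: prob_space "iid n (law (\<lambda>_. 0))"
    using l by (intro prob_space_iid) (simp add: cos_law_def)
  have "trunc_prob (law (\<lambda>_. 0)) (\<lambda>_. 0) n 0 (K - K) = 1"
    unfolding trunc_prob_def gform_def using P.prob_space by simp
  then show ?thesis
    using trunc_prob_le_cvm[OF l assms, of 0 K] assms by (simp add: drift_tail_zero lam_tail_0)
qed

lemma abs_le_l2norm:
  assumes "l2seq \<theta>"
  shows "\<bar>\<theta> m\<bar> \<le> l2norm \<theta>"
proof -
  have "(\<Sum>j\<in>{m}. (\<theta> j)\<^sup>2) \<le> (\<Sum>j. (\<theta> j)\<^sup>2)"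
    using assms by (intro sum_le_suminf) (auto simp: l2seq_def)
  then have "sqrt ((\<theta> m)\<^sup>2) \<le> l2norm \<theta>" unfolding l2norm_def by (intro real_sqrt_le_mono) simp
  then show ?thesis by simp
qed

lemma trunc_prob_clt:
  assumes d: "\<And>i. is_dens (\<theta> i)" and n: "filterlim n at_top sequentially" and \<epsilon>: "(\<lambda>i. l2norm (\<theta> i)) \<longlonglongrightarrow> 0"
    and m: "1 \<le> m" and c: "\<And>i. c i \<le> C" and e: "0 < e"
  shows "\<forall>\<^sub>F i in sequentially. \<bar>trunc_prob (law (\<theta> i)) (\<theta> i) (n i) m (c i) - gcdf {1..m} (drift (\<theta> i) (n i)) (c i)\<bar> < e"
proof -
  have "(\<lambda>i. trunc_prob (law (\<theta> i)) (\<theta> i) (n i) m (c i) - gcdf {1..m} (drift (\<theta> i) (n i)) (c i)) \<longlonglongrightarrow> 0"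
    unfolding trunc_prob_def
  proof (rule cscore_gform_clt[OF cos_law_law[OF d] n _ \<epsilon> _ _ _ c])
    show "\<bar>\<theta> i m\<bar> \<le> l2norm (\<theta> i)" for i m
      using d[of i] by (intro abs_le_l2norm) (simp add: is_dens_def)
  qed (use m in auto)
  from tendstoD[OF this e] show ?thesis by (simp add: dist_real_def)
qed

lemma gcdf_one_anticoncentration:
  assumes "1 \<le> m" "0 < \<eta>"
  shows "gcdf {1..m} a c \<le> gcdf {1..m} a (c - \<eta>) + 2 * sqrt (\<eta> / lam 1)"
  using gcdf_anticoncentration[of "{1..m}" 1 \<eta> a "c - \<eta>"] assms by simp

lemma small_root_exists:
  fixes l e :: real
  assumes "0 < l" "0 < e"
  obtains \<eta> where "0 < \<eta>" "2 * sqrt (\<eta> / l) \<le> e"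
proof
  show "0 < l * (e / 2)\<^sup>2" using assms by simp
  show "2 * sqrt (l * (e / 2)\<^sup>2 / l) \<le> e" using assms by simp
qed

lemma lam_tail_small:
  assumes "0 < e"
  obtains m where "M \<le> m" "1 \<le> m" "8 * lam_tail m \<le> e"
proof -
  have "\<forall>\<^sub>F m in sequentially. lam_tail m < e / 8"
    by (rule order_tendstoD(2)[OF lam_tail_tendsto]) (use assms in simp)
  moreover have "\<forall>\<^sub>F m in sequentially. max 1 M \<le> m" by (rule eventually_ge_at_top)
  ultimately have "\<forall>\<^sub>F m in sequentially. lam_tail m < e / 8 \<and> max 1 M \<le> m" by (rule eventually_conj)
  then obtain m where "lam_tail m < e / 8" "max 1 M \<le> m"
    using eventually_happens'[OF sequentially_bot] by blast
  then show ?thesis using that[of m] by simp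
qed

lemma drift_tail_antimono:
  assumes law: "cos_law \<mu> \<theta>" and n: "0 < n"
  shows "drift_tail \<theta> n m \<le> drift_tail \<theta> n 0"
    and "drift_tail \<theta> n 0 = (\<Sum>j\<in>{1..m}. lam j * (drift \<theta> n j)\<^sup>2) + drift_tail \<theta> n m"
proof -
  note s = summable_drift[OF law n]
  have "drift_tail \<theta> n 0 = (\<Sum>j. lam j * (drift \<theta> n j)\<^sup>2)"
    unfolding drift_tail_def using suminf_split_tail[OF s, of 0] by (simp add: lam_def)
  then show *: "drift_tail \<theta> n 0 = (\<Sum>j\<in>{1..m}. lam j * (drift \<theta> n j)\<^sup>2) + drift_tail \<theta> n m"
    unfolding drift_tail_def using suminf_split_tail[OF s, of m] by (simp add: lam_def)
  have "0 \<le> (\<Sum>j\<in>{1..m}. lam j * (drift \<theta> n j)\<^sup>2)" by (intro sum_nonneg mult_nonneg_nonneg lam_nonneg) simp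
  then show "drift_tail \<theta> n m \<le> drift_tail \<theta> n 0" using * by simp
qed

lemma l2norm_zero: "l2norm (\<lambda>_. 0) = 0"
  by (simp add: l2norm_def)

text \<open>At a fixed level m the first m coordinates are eventually 0, so the truncated statistics
  under null and alternative are compared with the very same Gaussian form. Passing from the full
  null statistic to it and back to the full alternative costs only small errors.\<close>

lemma inconsistent_of_vanishing_drift:
  assumes d: "\<And>i. is_dens (\<theta> i)" and n: "strict_mono n" and \<epsilon>: "(\<lambda>i. l2norm (\<theta> i)) \<longlonglongrightarrow> 0"
    and low: "\<And>m. \<forall>\<^sub>F i in sequentially. \<forall>j\<in>{1..m}. \<theta> i j = 0"
    and T: "(\<lambda>i. drift_tail (\<theta> i) (n i) 0) \<longlonglongrightarrow> 0"
  shows "inconsistent n \<theta>"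
  unfolding inconsistent_def
proof (intro allI)
  fix c :: "nat \<Rightarrow> real"
  have nt: "filterlim n at_top sequentially" using n by (rule filterlim_subseq)
  have l0: "cos_law (law (\<lambda>_. 0)) (\<lambda>_. 0)" by (rule cos_law_law[OF is_dens_zero])
  have ev: "\<forall>\<^sub>F i in sequentially. 1 - e < alpha_err (n i) (c i) + beta_err (n i) (c i) (\<theta> i)" if e: "0 < e" for e
  proof -
    define K where "K = 16 / e"
    have K: "0 < K" "4 / (3 * K) < e / 8" using e by (auto simp: K_def field_simps)
    \<comment> \<open>Arbitrary thresholds are capped to meet the upper bound in the limit theorem.
      By tightness the null acceptance probability changes by at most e / 8, and under the
      alternative capping only lowers it.\<close>
    define c' where "c' i = min (c i) K" for i
    obtain \<eta> where \<eta>: "0 < \<eta>" "2 * sqrt (\<eta> / lam 1) \<le> e / 8"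
      using small_root_exists[OF lam_pos, of 1 "e / 8"] e by auto
    obtain m where m: "1 \<le> m" "8 * lam_tail m \<le> \<eta> * (e / 8)"
    proof -
      have "0 < \<eta> * (e / 8)" using \<eta> e by simp
      then show ?thesis using lam_tail_small[of "\<eta> * (e / 8)" 0] that by blast
    qed
    have m': "8 * lam_tail m / \<eta> \<le> e / 8" using m(2) \<eta>(1) by (simp add: field_simps)
    have 1: "\<forall>\<^sub>F i in sequentially. \<bar>trunc_prob (law (\<lambda>_. 0)) (\<lambda>_. 0) (n i) m (c' i) - gcdf {1..m} (drift (\<lambda>_. 0) (n i)) (c' i)\<bar> < e / 8"
      by (rule trunc_prob_clt[of "\<lambda>_ _. 0", OF is_dens_zero nt _ m(1), where C = K]) (use e in \<open>auto simp: c'_def l2norm_zero\<close>)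
    have 2: "\<forall>\<^sub>F i in sequentially. \<bar>trunc_prob (law (\<theta> i)) (\<theta> i) (n i) m (c' i - \<eta>) - gcdf {1..m} (drift (\<theta> i) (n i)) (c' i - \<eta>)\<bar> < e / 8"
      by (rule trunc_prob_clt[OF d nt \<epsilon> m(1), where C = K]) (use e \<eta> in \<open>auto simp: c'_def\<close>)
    have 3: "\<forall>\<^sub>F i in sequentially. drift_tail (\<theta> i) (n i) 0 < \<eta> / 4"
      by (rule order_tendstoD(2)[OF T]) (use \<eta> in simp)
    have 4: "\<forall>\<^sub>F i in sequentially. 1 \<le> n i"
      using nt unfolding filterlim_at_top by blast
    from 1 2 3 4 low[of m] show ?thesis
    proof eventually_elim
      case (elim i)
      note li = cos_law_law[OF d[of i]]
      have n0: "0 < n i" using elim by simp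
      let ?q = "cvm_prob (law (\<lambda>_. 0)) (n i)" and ?p = "cvm_prob (law (\<theta> i)) (n i)"
      have "gcdf {1..m} (drift (\<theta> i) (n i)) = gcdf {1..m} (drift (\<lambda>_. 0) (n i))"
        by (rule gcdf_cong) (use elim in simp)
      then have g: "gcdf {1..m} (drift (\<lambda>_. 0) (n i)) (c' i) \<le> gcdf {1..m} (drift (\<theta> i) (n i)) (c' i - \<eta>) + e / 8"
        using gcdf_one_anticoncentration[OF m(1) \<eta>(1), of "drift (\<lambda>_. 0) (n i)" "c' i"] \<eta>(2) by simp
      have a: "?q (c' i) \<le> trunc_prob (law (\<lambda>_. 0)) (\<lambda>_. 0) (n i) m (c' i)"
        by (rule cvm_prob_le_trunc[OF l0 n0])
      have "drift_tail (\<theta> i) (n i) m \<le> \<eta> / 4" using drift_tail_antimono(1)[OF li n0, of m] elim by simp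
      then have b: "trunc_prob (law (\<theta> i)) (\<theta> i) (n i) m (c' i - \<eta>) \<le> ?p (c' i) + 8 * lam_tail m / \<eta>"
        by (rule trunc_prob_le_cvm[OF li n0 \<eta>(1)])
      \<comment> \<open>Four errors of size e / 8: two limit theorems, one anticoncentration step
        and one noise tail.\<close>
      have "?q (c' i) - ?p (c' i) < e / 2" using elim(1,2) g a b m' by linarith
      moreover have "?q (c i) \<le> ?q (c' i) + e / 8"
      proof (cases "c i \<le> K")
        case False
        have "1 - 4 / (3 * K) \<le> ?q K" by (rule null_cvm_prob_ge[OF n0 K(1)])
        then show ?thesis using cvm_prob_mono(2)[OF l0 order_refl, of "n i" "c i"] K(2) False by (simp add: c'_def)
      qed (use e in \<open>simp add: c'_def\<close>)
      moreover have "?p (c' i) \<le> ?p (c i)" by (rule cvm_prob_mono(1)[OF li]) (simp add: c'_def)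
      ultimately show ?case unfolding alpha_err_eq beta_err_eq using e by simp
    qed
  qed
  show "1 \<le> liminf (\<lambda>i. ereal (alpha_err (n i) (c i) + beta_err (n i) (c i) (\<theta> i)))"
    unfolding le_Liminf_iff
  proof (intro allI impI)
    fix y :: ereal assume "y < 1"
    then obtain r where r: "y < ereal r" "ereal r < 1" using ereal_dense2 by blast
    have "\<forall>\<^sub>F i in sequentially. 1 - (1 - r) < alpha_err (n i) (c i) + beta_err (n i) (c i) (\<theta> i)"
      by (rule ev) (use r(2) in \<open>simp add: one_ereal_def\<close>)
    then show "\<forall>\<^sub>F i in sequentially. y < ereal (alpha_err (n i) (c i) + beta_err (n i) (c i) (\<theta> i))"
      by eventually_elim (use r(1) in \<open>auto intro: less_trans\<close>)
  qed
qed

section \<open>Consistency for separated drift\<close>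

lemma lam_le_1: "lam j \<le> 1"
proof (cases "j = 0")
  case False
  have "1 * 1 \<le> pi * real j" using pi_ge_two False by (intro mult_mono) auto
  then have "1 \<le> (pi * real j)\<^sup>2" using one_le_power[of "pi * real j" 2] by simp
  then show ?thesis by (simp add: lam_def divide_le_eq_1) auto
qed (simp add: lam_def)

text \<open>Pigeonhole: one of the M terms carries at least the average energy, and
  \<open>lam j\<close> is at most 1.\<close>

lemma large_coordinate:
  assumes T: "\<tau> \<le> (\<Sum>j\<in>{1..M}. lam j * (a j)\<^sup>2)" and \<tau>: "0 < \<tau>" and M: "1 \<le> M"
  obtains j where "j \<in> {1..M}" "sqrt (\<tau> / real M) \<le> \<bar>a j\<bar>"
proof -
  have "\<exists>j\<in>{1..M}. \<tau> / real M \<le> lam j * (a j)\<^sup>2"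
  proof (rule ccontr)
    assume "\<not> ?thesis"
    then have "(\<Sum>j\<in>{1..M}. lam j * (a j)\<^sup>2) < (\<Sum>j\<in>{1..M}. \<tau> / real M)"
      using M by (intro sum_strict_mono) (auto simp: not_le)
    then show False using T M by simp
  qed
  then obtain j where j: "j \<in> {1..M}" "\<tau> / real M \<le> lam j * (a j)\<^sup>2" by blast
  have "lam j * (a j)\<^sup>2 \<le> 1 * (a j)\<^sup>2" by (intro mult_right_mono lam_le_1) simp
  then have "sqrt (\<tau> / real M) \<le> sqrt ((a j)\<^sup>2)" using j by (intro real_sqrt_le_mono) simp
  then show ?thesis using that j by simp
qed

text \<open>The drift energy \<open>\<tau>\<close> sits either beyond a fixed frequency \<open>M\<close>, where the noise is negligible and
  the statistic is simply increased by about \<open>\<tau>\<close>, or in one coordinate \<open>j \<le> M\<close>, where the shift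
  of a single normal variable costs a fixed amount of probability. In the second case the
  truncation level has to be raised to \<open>N\<close>, chosen after that amount is known.\<close>

lemma consistent_of_separated_drift:
  assumes d: "\<And>i. is_dens (\<theta> i)" and n: "strict_mono n" and \<epsilon>: "(\<lambda>i. l2norm (\<theta> i)) \<longlonglongrightarrow> 0"
    and \<tau>: "0 < \<tau>" and T: "\<forall>\<^sub>F i in sequentially. 2 * \<tau> \<le> drift_tail (\<theta> i) (n i) 0"
  shows "consistent n \<theta>"
  unfolding consistent_def
proof (intro ballI allI impI)
  fix \<alpha> :: real and c :: "nat \<Rightarrow> real"
  assume "\<alpha> \<in> {0<..<1}" and lim: "(\<lambda>i. alpha_err (n i) (c i)) \<longlonglongrightarrow> \<alpha>"
  then have \<alpha>: "0 < \<alpha>" "\<alpha> < 1" by auto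
  have nt: "filterlim n at_top sequentially" using n by (rule filterlim_subseq)
  have n1: "\<forall>\<^sub>F i in sequentially. 1 \<le> n i" using nt unfolding filterlim_at_top by blast
  have l0: "cos_law (law (\<lambda>_. 0)) (\<lambda>_. 0)" by (rule cos_law_law[OF is_dens_zero])
  define q where "q i = cvm_prob (law (\<lambda>_. 0)) (n i)" for i
  have "(\<lambda>i. 1 - alpha_err (n i) (c i)) \<longlonglongrightarrow> 1 - \<alpha>" by (intro tendsto_intros lim)
  then have qlim: "(\<lambda>i. q i (c i)) \<longlonglongrightarrow> 1 - \<alpha>" by (simp add: alpha_err_eq q_def)
  have null_clt: "\<forall>\<^sub>F i in sequentially. \<bar>trunc_prob (law (\<lambda>_. 0)) (\<lambda>_. 0) (n i) m (b i) - gcdf {1..m} (\<lambda>_. 0) (b i)\<bar> < e"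
    if "1 \<le> m" "\<And>i. b i \<le> C" "0 < e" for m b C e
    using trunc_prob_clt[of "\<lambda>_ _. 0", OF is_dens_zero nt _ that] by (simp add: l2norm_zero)

  \<comment> \<open>A threshold above K would give the null acceptance probability at least 1 -
    \<alpha> / 3, which is incompatible with its limit 1 - \<alpha>.\<close>
  define K where "K = 4 / \<alpha>"
  have K: "0 < K" "4 / (3 * K) < \<alpha> / 2" using \<alpha> by (auto simp: K_def field_simps)
  have "\<forall>\<^sub>F i in sequentially. q i (c i) < 1 - \<alpha> / 2"
    by (rule order_tendstoD(2)[OF qlim]) (use \<alpha> in simp)
  with n1 have upper: "\<forall>\<^sub>F i in sequentially. c i \<le> K"
  proof eventually_elim
    case (elim i)
    show ?case
    proof (rule ccontr)
      assume "\<not> c i \<le> K"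
      then have "q i K \<le> q i (c i)" unfolding q_def by (intro cvm_prob_mono(1)[OF l0]) simp
      moreover have "1 - 4 / (3 * K) \<le> q i K" unfolding q_def using elim by (intro null_cvm_prob_ge K) simp
      ultimately show False using elim K by linarith
    qed
  qed

  \<comment> \<open>Bounds the thresholds away from 0. Near 0 the first coordinate alone keeps the
    acceptance probability small, by anticoncentration from a negative threshold where it is 0; the
    limit 1 - \<alpha> then excludes such thresholds.\<close>
  obtain \<eta>0 where \<eta>0: "0 < \<eta>0" "2 * sqrt (\<eta>0 / lam 1) \<le> (1 - \<alpha>) / 4"
    using small_root_exists[OF lam_pos, of 1 "(1 - \<alpha>) / 4"] \<alpha> by auto
  define t0 where "t0 = min (\<eta>0 / 2) (K / 2)"
  have t0: "0 < t0" "t0 < \<eta>0" "t0 \<le> K" using \<eta>0 K by (auto simp: t0_def)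
  have g0: "gcdf {1..1} (\<lambda>_. 0) t0 \<le> (1 - \<alpha>) / 4"
    using gcdf_one_anticoncentration[of 1 \<eta>0 "\<lambda>_. 0" t0] gcdf_neg[of "t0 - \<eta>0" "{1..1}" "\<lambda>_. 0"] \<eta>0 t0 by simp
  have "\<forall>\<^sub>F i in sequentially. \<bar>trunc_prob (law (\<lambda>_. 0)) (\<lambda>_. 0) (n i) 1 t0 - gcdf {1..1} (\<lambda>_. 0) t0\<bar> < (1 - \<alpha>) / 4"
    by (rule null_clt[where C = t0]) (use \<alpha> in auto)
  moreover have "\<forall>\<^sub>F i in sequentially. (1 - \<alpha>) / 2 < q i (c i)"
    by (rule order_tendstoD(1)[OF qlim]) (use \<alpha> in simp)
  ultimately have lower: "\<forall>\<^sub>F i in sequentially. t0 \<le> c i" using n1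
  proof eventually_elim
    case (elim i)
    show ?case
    proof (rule ccontr)
      assume "\<not> t0 \<le> c i"
      then have "q i (c i) \<le> q i t0" unfolding q_def by (intro cvm_prob_mono(1)[OF l0]) simp
      also have "\<dots> \<le> trunc_prob (law (\<lambda>_. 0)) (\<lambda>_. 0) (n i) 1 t0"
        unfolding q_def using elim by (intro cvm_prob_le_trunc[OF l0]) simp
      finally show False using elim g0 by linarith
    qed
  qed

  \<comment> \<open>The gain \<tau> / 4 in the threshold covers two steps of \<eta>: one is turned
    into the probability gap d0, the other pays for returning from the truncated to the full null
    statistic. The bound t0 / 4 keeps c - \<eta> in the range where d0 applies.\<close>
  define \<eta> where "\<eta> = min (t0 / 4) (\<tau> / 8)"
  have \<eta>: "0 < \<eta>" "\<eta> \<le> t0 / 2 / 2" "2 * \<eta> \<le> \<tau> / 4" using t0 \<tau> by (auto simp: \<eta>_def)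
  obtain d0 where d0: "0 < d0"
    "\<And>J b. finite J \<Longrightarrow> 0 \<notin> J \<Longrightarrow> 1 \<in> J \<Longrightarrow> b \<in> {t0 / 2..K} \<Longrightarrow> gcdf J (\<lambda>_. 0) (b - \<eta>) + d0 \<le> gcdf J (\<lambda>_. 0) b"
    using gcdf_increment[OF \<eta>(1,2), of K] t0 by auto
  obtain M where M: "1 \<le> M" "8 * lam_tail M \<le> \<eta> * (d0 / 8)"
  proof -
    have "0 < \<eta> * (d0 / 8)" using \<eta> d0 by simp
    then show ?thesis using lam_tail_small[of "\<eta> * (d0 / 8)" 0] that by blast
  qed
  have M\<eta>: "8 * lam_tail M / \<eta> \<le> d0 / 8" using M(2) \<eta>(1) by (simp add: field_simps)
  have M\<tau>: "8 * lam_tail M / \<tau> \<le> d0 / 8"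
  proof -
    have "8 * lam_tail M / \<tau> \<le> 8 * lam_tail M / \<eta>"
      using \<eta> \<tau> lam_tail_nonneg[of M] by (intro divide_left_mono) auto
    then show ?thesis using M\<eta> by simp
  qed
  define A where "A = sqrt (\<tau> / real M)"
  have A: "0 < A" using \<tau> M by (simp add: A_def)
  obtain d1 where d1: "0 < d1"
    "\<And>J b a j. finite J \<Longrightarrow> 0 \<notin> J \<Longrightarrow> j \<in> J \<Longrightarrow> j \<le> M \<Longrightarrow> b \<in> {t0..K} \<Longrightarrow> A \<le> \<bar>a j\<bar> \<Longrightarrow>
       gcdf J a b + d1 \<le> gcdf J (\<lambda>_. 0) b"
    using gcdf_shift_gap[OF t0(1,3) A, of M] by blast
  obtain \<eta>1 where \<eta>1: "0 < \<eta>1" "2 * sqrt (\<eta>1 / lam 1) \<le> d1 / 8"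
    using small_root_exists[OF lam_pos, of 1 "d1 / 8"] d1 by auto
  obtain N where N: "M \<le> N" "1 \<le> N" "8 * lam_tail N \<le> \<eta>1 * (d1 / 8)"
  proof -
    have "0 < \<eta>1 * (d1 / 8)" using \<eta>1 d1 by simp
    then show ?thesis using lam_tail_small[of "\<eta>1 * (d1 / 8)" M] that by blast
  qed
  have N\<eta>: "8 * lam_tail N / \<eta>1 \<le> d1 / 8" using N(3) \<eta>1(1) by (simp add: field_simps)
  define \<delta> where "\<delta> = min d0 d1"
  have \<delta>: "0 < \<delta>" "\<delta> \<le> d0" "\<delta> \<le> d1" using d0 d1 by (auto simp: \<delta>_def)
  define c' where "c' i = min (c i) K" for i

  have e1: "\<forall>\<^sub>F i in sequentially. \<bar>trunc_prob (law (\<theta> i)) (\<theta> i) (n i) M (c' i - \<tau> / 4) - gcdf {1..M} (drift (\<theta> i) (n i)) (c' i - \<tau> / 4)\<bar> < \<delta> / 8"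
    by (rule trunc_prob_clt[OF d nt \<epsilon> M(1), where C = K]) (use \<tau> \<delta> in \<open>auto simp: c'_def\<close>)
  have e2: "\<forall>\<^sub>F i in sequentially. \<bar>trunc_prob (law (\<theta> i)) (\<theta> i) (n i) N (c' i) - gcdf {1..N} (drift (\<theta> i) (n i)) (c' i)\<bar> < \<delta> / 8"
    by (rule trunc_prob_clt[OF d nt \<epsilon> N(2), where C = K]) (use \<delta> in \<open>auto simp: c'_def\<close>)
  have e3: "\<forall>\<^sub>F i in sequentially. \<bar>trunc_prob (law (\<lambda>_. 0)) (\<lambda>_. 0) (n i) M (c' i - \<eta>) - gcdf {1..M} (\<lambda>_. 0) (c' i - \<eta>)\<bar> < \<delta> / 8"
    by (rule null_clt[OF M(1), where C = K]) (use \<eta> \<delta> in \<open>auto simp: c'_def\<close>)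
  have e4: "\<forall>\<^sub>F i in sequentially. \<bar>trunc_prob (law (\<lambda>_. 0)) (\<lambda>_. 0) (n i) N (c' i - \<eta>1) - gcdf {1..N} (\<lambda>_. 0) (c' i - \<eta>1)\<bar> < \<delta> / 8"
    by (rule null_clt[OF N(2), where C = K]) (use \<eta>1 \<delta> in \<open>auto simp: c'_def\<close>)

  have gap: "\<forall>\<^sub>F i in sequentially. beta_err (n i) (c i) (\<theta> i) \<le> q i (c i) - \<delta> / 2"
    using e1 e2 e3 e4 upper lower T n1
  proof eventually_elim
    case (elim i)
    note li = cos_law_law[OF d[of i]]
    have n0: "0 < n i" using elim by simp
    have c': "c' i = c i" using elim by (simp add: c'_def)
    let ?p = "cvm_prob (law (\<theta> i)) (n i) (c i)"
    let ?a = "drift (\<theta> i) (n i)"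
    have "?p \<le> q i (c i) - \<delta> / 2"
    proof (cases "\<tau> \<le> drift_tail (\<theta> i) (n i) M")
      case True
      have "?p \<le> trunc_prob (law (\<theta> i)) (\<theta> i) (n i) M (c i - \<tau> / 4) + 8 * lam_tail M / \<tau>"
        by (rule cvm_prob_le_shifted_trunc[OF li n0 \<tau> True])
      moreover have "gcdf {1..M} ?a (c i - \<tau> / 4) \<le> gcdf {1..M} (\<lambda>_. 0) (c i - \<tau> / 4)"
      proof -
        have "gcdf {1..M} ?a (c i - \<tau> / 4) \<le> gcdf {1..M} (\<lambda>j. if j \<in> {1..M} then 0 else ?a j) (c i - \<tau> / 4)"
          by (rule gcdf_zero_coordinates) auto
        also have "gcdf {1..M} (\<lambda>j. if j \<in> {1..M} then 0 else ?a j) = gcdf {1..M} (\<lambda>_. 0)"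
          by (rule gcdf_cong) auto
        finally show ?thesis .
      qed
      moreover have "gcdf {1..M} (\<lambda>_. 0) (c i - \<tau> / 4) \<le> gcdf {1..M} (\<lambda>_. 0) (c i - \<eta> - \<eta>)"
        using \<eta> by (intro gcdf_mono) simp
      moreover have "gcdf {1..M} (\<lambda>_. 0) (c i - \<eta> - \<eta>) + d0 \<le> gcdf {1..M} (\<lambda>_. 0) (c i - \<eta>)"
        by (rule d0(2)) (use M elim \<eta> t0 in auto)
      moreover have "trunc_prob (law (\<lambda>_. 0)) (\<lambda>_. 0) (n i) M (c i - \<eta>) \<le> q i (c i) + 8 * lam_tail M / \<eta>"
        unfolding q_def by (rule trunc_prob_le_cvm[OF l0 n0 \<eta>(1)]) (use \<eta> in \<open>simp add: drift_tail_zero\<close>)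
      ultimately show ?thesis using elim(1,3) M\<eta> M\<tau> \<delta> unfolding c' by linarith
    next
      case False
      \<comment> \<open>Of the total energy, at least 2 * \<tau>, less than \<tau> lies beyond
        M.\<close>
      then have "\<tau> \<le> (\<Sum>j\<in>{1..M}. lam j * (?a j)\<^sup>2)"
        using drift_tail_antimono(2)[OF li n0, of M] elim(7) by linarith
      from large_coordinate[OF this \<tau> M(1)] obtain j where j: "j \<in> {1..M}" "A \<le> \<bar>?a j\<bar>"
        unfolding A_def by blast
      have "?p \<le> trunc_prob (law (\<theta> i)) (\<theta> i) (n i) N (c i)"
        by (rule cvm_prob_le_trunc[OF li n0])
      moreover have "gcdf {1..N} ?a (c i) + d1 \<le> gcdf {1..N} (\<lambda>_. 0) (c i)"
        by (rule d1(2)[where j = j]) (use j N elim in auto)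
      moreover have "gcdf {1..N} (\<lambda>_. 0) (c i) \<le> gcdf {1..N} (\<lambda>_. 0) (c i - \<eta>1) + 2 * sqrt (\<eta>1 / lam 1)"
        by (rule gcdf_one_anticoncentration[OF N(2) \<eta>1(1)])
      moreover have "trunc_prob (law (\<lambda>_. 0)) (\<lambda>_. 0) (n i) N (c i - \<eta>1) \<le> q i (c i) + 8 * lam_tail N / \<eta>1"
        unfolding q_def by (rule trunc_prob_le_cvm[OF l0 n0 \<eta>1(1)]) (use \<eta>1 in \<open>simp add: drift_tail_zero\<close>)
      ultimately show ?thesis using elim(2,4) \<eta>1(2) N\<eta> \<delta> unfolding c' by linarith
    qed
    then show ?case by (simp add: beta_err_eq)
  qed
  \<comment> \<open>Half of the gap \<delta> / 2 absorbs the fluctuation of the level; the other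
    half makes the inequality for the upper limit strict.\<close>
  have "\<forall>\<^sub>F i in sequentially. q i (c i) < 1 - \<alpha> + \<delta> / 4"
    by (rule order_tendstoD(2)[OF qlim]) (use \<delta> in simp)
  with gap have "\<forall>\<^sub>F i in sequentially. ereal (beta_err (n i) (c i) (\<theta> i)) \<le> ereal (1 - \<alpha> - \<delta> / 4)"
    by eventually_elim simp
  then have "limsup (\<lambda>i. ereal (beta_err (n i) (c i) (\<theta> i))) \<le> ereal (1 - \<alpha> - \<delta> / 4)"
    by (rule Limsup_bounded)
  also have "\<dots> < ereal (1 - \<alpha>)" using \<delta> by simp
  finally show "limsup (\<lambda>i. ereal (beta_err (n i) (c i) (\<theta> i))) < ereal (1 - \<alpha>)" .
qed

section \<open>The Besov body\<close>

abbreviation freq_tail :: "real \<Rightarrow> (nat \<Rightarrow> real) \<Rightarrow> real" where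
  "freq_tail x \<theta> \<equiv> (\<Sum>j. if real j > x then (\<theta> j)\<^sup>2 else 0)"

lemma summable_freq_tail:
  assumes "l2seq \<theta>"
  shows "summable (\<lambda>j. if real j > x then (\<theta> j)\<^sup>2 else 0)"
  by (rule summable_comparison_test'[where N = 0 and g = "\<lambda>j. (\<theta> j)\<^sup>2"]) (use assms in \<open>auto simp: l2seq_def\<close>)

lemma l2norm_sq: "l2seq \<theta> \<Longrightarrow> (l2norm \<theta>)\<^sup>2 = (\<Sum>j. (\<theta> j)\<^sup>2)"
  unfolding l2norm_def l2seq_def by (simp add: suminf_nonneg)

lemma l2norm_nonneg: "l2seq \<theta> \<Longrightarrow> 0 \<le> l2norm \<theta>"
  unfolding l2norm_def l2seq_def by (simp add: suminf_nonneg)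

lemma summable_square_add:
  fixes f g :: "nat \<Rightarrow> real"
  assumes "summable (\<lambda>j. (f j)\<^sup>2)" "summable (\<lambda>j. (g j)\<^sup>2)"
  shows "summable (\<lambda>j. (f j + g j)\<^sup>2)"
proof (rule summable_comparison_test'[where N = 0])
  show "summable (\<lambda>j. 2 * (f j)\<^sup>2 + 2 * (g j)\<^sup>2)" using assms by (intro summable_add summable_mult)
  fix j
  have "(f j + g j)\<^sup>2 \<le> 2 * (f j)\<^sup>2 + 2 * (g j)\<^sup>2"
    using zero_le_power2[of "f j - g j"] by (simp add: power2_eq_square algebra_simps)
  then show "norm ((f j + g j)\<^sup>2) \<le> 2 * (f j)\<^sup>2 + 2 * (g j)\<^sup>2" by simp
qed

lemma l2seq_combination:
  assumes "l2seq \<theta>" "l2seq \<eta>"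
  shows "l2seq (\<lambda>j. a * \<theta> j + b * \<eta> j)"
  unfolding l2seq_def
proof
  show "a * \<theta> 0 + b * \<eta> 0 = 0" using assms by (simp add: l2seq_def)
  have "summable (\<lambda>j. (a * \<theta> j)\<^sup>2)" "summable (\<lambda>j. (b * \<eta> j)\<^sup>2)"
    using assms by (auto simp: l2seq_def power_mult_distrib intro: summable_mult)
  then show "summable (\<lambda>j. (a * \<theta> j + b * \<eta> j)\<^sup>2)" by (rule summable_square_add)
qed

text \<open>At \<lambda> = 1/2 the tail is already the whole squared norm, since \<theta> 0 =
  0.\<close>

lemma Bbar_bounded: "l2_bounded (Bbar s P0)"
  unfolding l2_bounded_def
proof (intro exI ballI)
  fix \<theta> assume \<theta>: "\<theta> \<in> Bbar s P0"
  define a where "a = (1 / 2 :: real) powr (2 * s)"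
  have a: "0 < a" by (simp add: a_def)
  have "freq_tail (1 / 2) \<theta> = (\<Sum>j. (\<theta> j)\<^sup>2)"
  proof (rule suminf_cong)
    fix j :: nat
    show "(if real j > 1 / 2 then (\<theta> j)\<^sup>2 else 0) = (\<theta> j)\<^sup>2"
      using \<theta> by (cases "j = 0") (auto simp: Bbar_def l2seq_def)
  qed
  moreover have "a * freq_tail (1 / 2) \<theta> \<le> P0" 
  proof -
    have "\<forall>x>0. x powr (2 * s) * freq_tail x \<theta> \<le> P0" using \<theta> by (simp add: Bbar_def)
    then show ?thesis unfolding a_def by (rule allE[of _ "1 / 2"]) simp
  qed
  ultimately have "(\<Sum>j. (\<theta> j)\<^sup>2) \<le> P0 / a" using a by (simp add: field_simps)
  then show "l2norm \<theta> \<le> sqrt (P0 / (1 / 2) powr (2 * s))"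
    unfolding l2norm_def a_def by (rule real_sqrt_le_mono)
qed

text \<open>Norm convergence gives convergence of each coordinate; the constraint passes to the
  limit on finite partial sums and then to the series.\<close>

lemma Bbar_closed: "l2_closed (Bbar s P0)"
  unfolding l2_closed_def
proof (intro allI impI, elim conjE)
  fix \<theta>s :: "nat \<Rightarrow> nat \<Rightarrow> real" and \<theta>
  assume mem: "\<forall>k. \<theta>s k \<in> Bbar s P0" and \<theta>: "l2seq \<theta>" and lim: "(\<lambda>k. l2norm (\<lambda>j. \<theta>s k j - \<theta> j)) \<longlonglongrightarrow> 0"
  have l2: "l2seq (\<theta>s k)" for k using mem by (simp add: Bbar_def)
  have coord: "(\<lambda>k. \<theta>s k j) \<longlonglongrightarrow> \<theta> j" for j
  proof -
    have "\<bar>\<theta>s k j - \<theta> j\<bar> \<le> l2norm (\<lambda>j. \<theta>s k j - \<theta> j)" for k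
      using abs_le_l2norm[OF l2seq_combination[OF l2[of k] \<theta>, of 1 "-1"], of j] by simp
    then have "(\<lambda>k. \<theta>s k j - \<theta> j) \<longlonglongrightarrow> 0"
      by (intro Lim_null_comparison[OF _ lim]) simp
    then show ?thesis by (simp add: LIM_zero_iff)
  qed
  have "x powr (2 * s) * freq_tail x \<theta> \<le> P0" if x: "0 < x" for x
  proof -
    have a: "0 < x powr (2 * s)" using x by simp
    have "freq_tail x \<theta> \<le> P0 / x powr (2 * s)"
    proof (rule suminf_le_const[OF summable_freq_tail[OF \<theta>]])
      fix N
      have "(\<lambda>k. \<Sum>j<N. if real j > x then (\<theta>s k j)\<^sup>2 else 0) \<longlonglongrightarrow> (\<Sum>j<N. if real j > x then (\<theta> j)\<^sup>2 else 0)"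
      proof (rule tendsto_sum)
        fix j show "(\<lambda>k. if real j > x then (\<theta>s k j)\<^sup>2 else 0) \<longlonglongrightarrow> (if real j > x then (\<theta> j)\<^sup>2 else 0)"
          using tendsto_power[OF coord[of j], of 2] by (cases "real j > x") auto
      qed
      moreover have "(\<Sum>j<N. if real j > x then (\<theta>s k j)\<^sup>2 else 0) \<le> P0 / x powr (2 * s)" for k
      proof -
        have "(\<Sum>j<N. if real j > x then (\<theta>s k j)\<^sup>2 else 0) \<le> freq_tail x (\<theta>s k)"
          by (rule sum_le_suminf[OF summable_freq_tail[OF l2]]) auto
        also have "\<dots> \<le> P0 / x powr (2 * s)"
        proof -
          have "x powr (2 * s) * freq_tail x (\<theta>s k) \<le> P0" using mem x by (simp add: Bbar_def)
          then show ?thesis using a by (simp add: pos_le_divide_eq mult.commute)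
        qed
        finally show ?thesis .
      qed
      ultimately show "(\<Sum>j<N. if real j > x then (\<theta> j)\<^sup>2 else 0) \<le> P0 / x powr (2 * s)"
        by (intro LIMSEQ_le_const2) auto
    qed
    then show ?thesis using a by (simp add: pos_le_divide_eq mult.commute)
  qed
  then show "\<theta> \<in> Bbar s P0" using \<theta> by (simp add: Bbar_def)
qed

lemma Bbar_convex: "seq_convex (Bbar s P0)"
  unfolding seq_convex_def
proof (intro ballI)
  fix \<theta> \<eta> and t :: real
  assume \<theta>: "\<theta> \<in> Bbar s P0" and \<eta>: "\<eta> \<in> Bbar s P0" and t: "t \<in> {0..1}"
  have l2: "l2seq \<theta>" "l2seq \<eta>" using \<theta> \<eta> by (auto simp: Bbar_def)
  have "x powr (2 * s) * freq_tail x (\<lambda>j. t * \<theta> j + (1 - t) * \<eta> j) \<le> P0" if x: "0 < x" for x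
  proof -
    note sf = summable_freq_tail[OF l2(1), of x] summable_freq_tail[OF l2(2), of x]
    have "freq_tail x (\<lambda>j. t * \<theta> j + (1 - t) * \<eta> j) \<le>
       (\<Sum>j. t * (if real j > x then (\<theta> j)\<^sup>2 else 0) + (1 - t) * (if real j > x then (\<eta> j)\<^sup>2 else 0))"
    proof (rule suminf_le[OF _ summable_freq_tail[OF l2seq_combination[OF l2]]])
      fix j
      have "(t * a + (1 - t) * b)\<^sup>2 \<le> t * a\<^sup>2 + (1 - t) * b\<^sup>2" for a b
      proof -
        have "t * a\<^sup>2 + (1 - t) * b\<^sup>2 - (t * a + (1 - t) * b)\<^sup>2 = t * (1 - t) * (a - b)\<^sup>2"
          by (simp add: power2_eq_square algebra_simps)
        moreover have "0 \<le> t * (1 - t) * (a - b)\<^sup>2" using t by (intro mult_nonneg_nonneg) auto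
        ultimately show ?thesis by linarith
      qed
      then show "(if real j > x then (t * \<theta> j + (1 - t) * \<eta> j)\<^sup>2 else 0) \<le>
         t * (if real j > x then (\<theta> j)\<^sup>2 else 0) + (1 - t) * (if real j > x then (\<eta> j)\<^sup>2 else 0)" by simp
    qed (intro summable_add summable_mult sf)
    also have "\<dots> = t * freq_tail x \<theta> + (1 - t) * freq_tail x \<eta>"
      using suminf_add[OF summable_mult[OF sf(1), of t] summable_mult[OF sf(2), of "1 - t"]]
        suminf_mult[OF sf(1), of t] suminf_mult[OF sf(2), of "1 - t"] by simp
    finally have "x powr (2 * s) * freq_tail x (\<lambda>j. t * \<theta> j + (1 - t) * \<eta> j) \<le>
        x powr (2 * s) * (t * freq_tail x \<theta> + (1 - t) * freq_tail x \<eta>)"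
      by (rule mult_left_mono) simp
    also have "\<dots> = t * (x powr (2 * s) * freq_tail x \<theta>) + (1 - t) * (x powr (2 * s) * freq_tail x \<eta>)"
      by (simp add: algebra_simps)
    also have "\<dots> \<le> t * P0 + (1 - t) * P0"
      using \<theta> \<eta> x t by (intro add_mono mult_left_mono) (auto simp: Bbar_def)
    finally show ?thesis by (simp add: algebra_simps)
  qed
  then show "(\<lambda>j. t * \<theta> j + (1 - t) * \<eta> j) \<in> Bbar s P0"
    using l2seq_combination[OF l2] by (simp add: Bbar_def)
qed

lemma Bbar_ortho_sym: "ortho_sym (Bbar s P0)"
  unfolding ortho_sym_def
proof (intro ballI allI impI)
  fix \<theta> and \<epsilon> :: "nat \<Rightarrow> real"
  assume \<theta>: "\<theta> \<in> Bbar s P0" and \<epsilon>: "\<forall>j. \<epsilon> j = 1 \<or> \<epsilon> j = -1"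
  have "(\<epsilon> j)\<^sup>2 = 1" for j using \<epsilon>[rule_format, of j] by auto
  then have "(\<epsilon> j * \<theta> j)\<^sup>2 = (\<theta> j)\<^sup>2" for j by (simp add: power_mult_distrib)
  then show "(\<lambda>j. \<epsilon> j * \<theta> j) \<in> Bbar s P0" using \<theta> by (simp add: Bbar_def l2seq_def cong: if_cong)
qed

section \<open>Drift energy over the Besov body\<close>

lemma in_band_l2norm_tendsto:
  assumes n: "strict_mono n" and r: "0 < r" and b: "\<And>i. in_band r c C (n i) (\<theta> i)" and l2: "\<And>i. l2seq (\<theta> i)"
  shows "(\<lambda>i. l2norm (\<theta> i)) \<longlonglongrightarrow> 0"
proof (rule Lim_null_comparison)
  show "\<forall>\<^sub>F i in sequentially. norm (l2norm (\<theta> i)) \<le> C * real (n i) powr (- r)"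
    using b l2norm_nonneg[OF l2] unfolding in_band_def by (auto intro!: always_eventually less_imp_le)
  have "filterlim (\<lambda>i. real (n i)) at_top sequentially"
    by (rule filterlim_compose[OF filterlim_real_sequentially filterlim_subseq[OF n]])
  then have "(\<lambda>i. real (n i) powr (- r)) \<longlonglongrightarrow> 0" using r by (intro tendsto_neg_powr) auto
  then show "(\<lambda>i. C * real (n i) powr (- r)) \<longlonglongrightarrow> 0" using tendsto_mult_right_zero by blast
qed

lemma drift_tail_eq:
  assumes "is_dens \<theta>"
  shows "drift_tail \<theta> n 0 = real n * (\<Sum>j. lam j * (\<theta> j)\<^sup>2)" "summable (\<lambda>j. lam j * (\<theta> j)\<^sup>2)"
proof -
  show s: "summable (\<lambda>j. lam j * (\<theta> j)\<^sup>2)"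
    by (rule summable_lam_bounded[OF cos_law_coeff_le[OF cos_law_law[OF assms]]])
  have "(if 0 < j then lam j * (drift \<theta> n j)\<^sup>2 else 0) = real n * (lam j * (\<theta> j)\<^sup>2)" for j
    by (auto simp: power_mult_distrib lam_def)
  then show "drift_tail \<theta> n 0 = real n * (\<Sum>j. lam j * (\<theta> j)\<^sup>2)"
    unfolding drift_tail_def using suminf_mult[OF s, of "real n"] by simp
qed

text \<open>The cutoff x of order \<open>n powr ((1 - 2 * r) / 2)\<close> is where the Besov bound
  on the tail drops to half of the energy guaranteed by the band. The other half lies at frequencies
  up to x, with weights at least 1 / (pi * x)^2, and n times energy over x^2 no longer depends on
  n.\<close>

lemma Bbar_drift_lower:
  fixes r s P0 c :: real
  assumes r: "0 < r" "r < 1/2" and s: "s = 2 * r / (1 - 2 * r)" and P0: "0 < P0" and c: "0 < c"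
  obtains \<tau> where "0 < \<tau>"
    "\<And>\<theta> n. \<theta> \<in> Bbar s P0 \<Longrightarrow> is_dens \<theta> \<Longrightarrow> 1 \<le> n \<Longrightarrow> c * real n powr (- r) < l2norm \<theta> \<Longrightarrow> 2 * \<tau> \<le> drift_tail \<theta> n 0"
proof -
  \<comment> \<open>Solves \<open>P0 / x powr (2 * s)\<close> = half of
    \<open>c^2 * n powr (- 2 * r)\<close> for the cutoff x, using (1 - 2 * r) * s = 2 * r.\<close>
  define D where "D = (2 * P0 / c\<^sup>2) powr (1 / (2 * s))"
  have s0: "0 < s" using r s by simp
  have D: "0 < D" using P0 c by (simp add: D_def)
  define \<tau> where "\<tau> = c\<^sup>2 / (4 * (pi * D)\<^sup>2)"
  have "2 * \<tau> \<le> drift_tail \<theta> n 0"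
    if \<theta>: "\<theta> \<in> Bbar s P0" and dens: "is_dens \<theta>" and n: "1 \<le> n" and band: "c * real n powr (- r) < l2norm \<theta>" for \<theta> n
  proof -
    have l2: "l2seq \<theta>" using \<theta> by (simp add: Bbar_def)
    define N where "N = real n"
    have N: "0 < N" using n by (simp add: N_def)
    define x where "x = D * N powr ((1 - 2 * r) / 2)"
    have x: "0 < x" using D N by (simp add: x_def)
    have "D powr (2 * s) = 2 * P0 / c\<^sup>2" using s0 P0 c by (simp add: D_def powr_powr)
    moreover have "(1 - 2 * r) / 2 * (2 * s) = 2 * r" using r s by (simp add: field_simps)
    ultimately have xs: "x powr (2 * s) = 2 * P0 / c\<^sup>2 * N powr (2 * r)"
      using D N by (simp add: x_def powr_mult powr_powr)
    have "x powr (2 * s) * freq_tail x \<theta> \<le> P0" using \<theta> x by (simp add: Bbar_def)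
    then have "freq_tail x \<theta> \<le> P0 / (2 * P0 / c\<^sup>2 * N powr (2 * r))"
      unfolding xs using P0 c N by (subst pos_le_divide_eq) (auto simp: mult.commute)
    also have "\<dots> = c\<^sup>2 / 2 * N powr (- (2 * r))" using P0 c N by (simp add: powr_minus field_simps)
    finally have I: "freq_tail x \<theta> \<le> c\<^sup>2 / 2 * N powr (- (2 * r))" .
    have "(c * N powr (- r))\<^sup>2 \<le> (l2norm \<theta>)\<^sup>2"
      using band c N unfolding N_def by (intro power_mono) auto
    moreover have "(c * N powr (- r))\<^sup>2 = c\<^sup>2 * N powr (- (2 * r))"
      using N by (simp add: power_mult_distrib powr_power)
    ultimately have L: "c\<^sup>2 * N powr (- (2 * r)) \<le> (\<Sum>j. (\<theta> j)\<^sup>2)" using l2norm_sq[OF l2] by simp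
    have s1: "summable (\<lambda>j. (\<theta> j)\<^sup>2)" using l2 by (simp add: l2seq_def)
    note s2 = summable_freq_tail[OF l2, of x]
    have "((\<Sum>j. (\<theta> j)\<^sup>2) - freq_tail x \<theta>) / (pi * x)\<^sup>2 = (\<Sum>j. ((\<theta> j)\<^sup>2 - (if real j > x then (\<theta> j)\<^sup>2 else 0)) / (pi * x)\<^sup>2)"
      using suminf_divide[OF summable_diff[OF s1 s2]] suminf_diff[OF s1 s2] by simp
    also have "\<dots> \<le> (\<Sum>j. lam j * (\<theta> j)\<^sup>2)"
    proof (rule suminf_le[OF _ summable_divide[OF summable_diff[OF s1 s2]] drift_tail_eq(2)[OF dens]])
      fix j
      show "((\<theta> j)\<^sup>2 - (if real j > x then (\<theta> j)\<^sup>2 else 0)) / (pi * x)\<^sup>2 \<le> lam j * (\<theta> j)\<^sup>2"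
      proof (cases "real j > x \<or> j = 0")
        case True
        then show ?thesis using l2 lam_nonneg[of j] by (auto simp: l2seq_def)
      next
        case False
        then have "(pi * real j)\<^sup>2 \<le> (pi * x)\<^sup>2" by (intro power_mono mult_left_mono) auto
        then have "(\<theta> j)\<^sup>2 / (pi * x)\<^sup>2 \<le> (\<theta> j)\<^sup>2 / (pi * real j)\<^sup>2"
          using False x by (intro divide_left_mono) auto
        then show ?thesis using False by (simp add: lam_def)
      qed
    qed
    finally have "((\<Sum>j. (\<theta> j)\<^sup>2) - freq_tail x \<theta>) / (pi * x)\<^sup>2 \<le> (\<Sum>j. lam j * (\<theta> j)\<^sup>2)" .
    moreover have "(c\<^sup>2 / 2 * N powr (- (2 * r))) / (pi * x)\<^sup>2 \<le> ((\<Sum>j. (\<theta> j)\<^sup>2) - freq_tail x \<theta>) / (pi * x)\<^sup>2"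
      using I L by (intro divide_right_mono) auto
    ultimately have "N * ((c\<^sup>2 / 2 * N powr (- (2 * r))) / (pi * x)\<^sup>2) \<le> N * (\<Sum>j. lam j * (\<theta> j)\<^sup>2)"
      using N by (intro mult_left_mono) auto
    moreover have "N * ((c\<^sup>2 / 2 * N powr (- (2 * r))) / (pi * x)\<^sup>2) = 2 * \<tau>"
    proof -
      have "x\<^sup>2 = D\<^sup>2 * N powr (((1 - 2 * r) / 2) * 2)" using N unfolding x_def power_mult_distrib by (subst powr_power) auto
      moreover have "(1 - 2 * r) / 2 * 2 = 1 - 2 * r" by (simp add: field_simps)
      ultimately have "x\<^sup>2 = D\<^sup>2 * N powr (1 - 2 * r)" by (simp only:)
      moreover have "N powr (1 - 2 * r) = N * N powr (- (2 * r))" using N powr_add[of N 1 "- (2 * r)"] by simp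
      ultimately have "(pi * x)\<^sup>2 = (pi * D)\<^sup>2 * (N * N powr (- (2 * r)))" by (simp add: power_mult_distrib)
      then show ?thesis using N D by (simp add: \<tau>_def field_simps)
    qed
    ultimately show ?thesis unfolding drift_tail_eq(1)[OF dens] N_def by simp
  qed
  moreover have "0 < \<tau>" using c D by (simp add: \<tau>_def)
  ultimately show ?thesis using that by blast
qed

section \<open>Inconsistent sequences outside the cone\<close>

abbreviation truncate_low :: "nat \<Rightarrow> (nat \<Rightarrow> real) \<Rightarrow> nat \<Rightarrow> real" where
  "truncate_low l \<theta> \<equiv> (\<lambda>j. if j > l then \<theta> j else 0)"

definition energy_tail :: "(nat \<Rightarrow> real) \<Rightarrow> nat \<Rightarrow> real" where
  "energy_tail \<theta> l = (\<Sum>j. if l < j then (\<theta> j)\<^sup>2 else 0)"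

text \<open>The truncation is the midpoint of \<theta> and of its image under reversing all signs up
  to l.\<close>

lemma truncate_low_mem:
  assumes V: "seq_convex V" "ortho_sym V" and \<theta>: "\<theta> \<in> V"
  shows "truncate_low l \<theta> \<in> V"
proof -
  define \<epsilon> :: "nat \<Rightarrow> real" where "\<epsilon> j = (if j > l then 1 else -1)" for j
  have "(\<lambda>j. \<epsilon> j * \<theta> j) \<in> V" using V(2) \<theta> unfolding ortho_sym_def by (simp add: \<epsilon>_def)
  then have "(\<lambda>j. 1 / 2 * \<theta> j + (1 - 1 / 2) * (\<epsilon> j * \<theta> j)) \<in> V"
    using V(1)[unfolded seq_convex_def, THEN bspec, OF \<theta>, THEN bspec, of "\<lambda>j. \<epsilon> j * \<theta> j", THEN bspec, of "1 / 2"] by simp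
  moreover have "(\<lambda>j. 1 / 2 * \<theta> j + (1 - 1 / 2) * (\<epsilon> j * \<theta> j)) = truncate_low l \<theta>"
    by (auto simp: \<epsilon>_def)
  ultimately show ?thesis by simp
qed

lemma l2norm_truncate_low: "l2norm (truncate_low l \<theta>) = sqrt (energy_tail \<theta> l)"
  unfolding l2norm_def energy_tail_def
  by (rule arg_cong[where f = sqrt], rule suminf_cong) auto

lemma energy_tail_tendsto:
  assumes "l2seq \<theta>"
  shows "energy_tail \<theta> \<longlonglongrightarrow> 0"
proof -
  have s: "summable (\<lambda>j. (\<theta> j)\<^sup>2)" using assms by (simp add: l2seq_def)
  have "energy_tail \<theta> l = (\<Sum>j. (\<theta> j)\<^sup>2) - (\<Sum>j<Suc l. (\<theta> j)\<^sup>2)" for l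
  proof -
    have "(\<Sum>j<Suc l. (\<theta> j)\<^sup>2) = (\<Sum>j\<in>{1..l}. (\<theta> j)\<^sup>2)"
      using assms by (intro sum.mono_neutral_right) (auto simp: l2seq_def not_le)
    then show ?thesis
      unfolding energy_tail_def using suminf_split_tail[OF s, of l] assms by (simp add: l2seq_def)
  qed
  moreover have "(\<lambda>l. (\<Sum>j. (\<theta> j)\<^sup>2) - (\<Sum>j<Suc l. (\<theta> j)\<^sup>2)) \<longlonglongrightarrow> (\<Sum>j. (\<theta> j)\<^sup>2) - (\<Sum>j. (\<theta> j)\<^sup>2)"
    by (intro tendsto_intros LIMSEQ_Suc[OF summable_LIMSEQ] s)
  ultimately have "(\<lambda>l. energy_tail \<theta> l) \<longlonglongrightarrow> (\<Sum>j. (\<theta> j)\<^sup>2) - (\<Sum>j. (\<theta> j)\<^sup>2)" by (simp only:)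
  then show ?thesis by simp
qed

lemma energy_tail_le:
  assumes "l2seq \<theta>"
  shows "energy_tail \<theta> l \<le> (\<Sum>j. (\<theta> j)\<^sup>2)" "0 \<le> energy_tail \<theta> l"
proof -
  have s: "summable (\<lambda>j. (\<theta> j)\<^sup>2)" using assms by (simp add: l2seq_def)
  show "energy_tail \<theta> l \<le> (\<Sum>j. (\<theta> j)\<^sup>2)"
    unfolding energy_tail_def by (rule suminf_le[OF _ summable_if_tail[OF s] s]) simp
  show "0 \<le> energy_tail \<theta> l"
    unfolding energy_tail_def by (rule suminf_nonneg[OF summable_if_tail[OF s]]) simp
qed

text \<open>If all weighted tails were bounded by B, dividing \<theta> by
  \<open>sqrt (B / P0)\<close> would put it into the body, and \<theta> into the cone. A violation
  at a real x passes to the integer part l, where \<open>Suc l\<close> is above x.\<close>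

lemma energy_tail_large:
  assumes \<theta>: "l2seq \<theta>" "\<theta> \<notin> cone (Bbar s P0)" and P0: "0 < P0" and s: "0 < s"
  shows "\<exists>l\<ge>L. K < real (Suc l) powr (2 * s) * energy_tail \<theta> l"
proof -
  \<comment> \<open>The last entry dominates the weighted tails at all l < L, so exceeding B forces
    l \<ge> L; the entry 1 makes B positive.\<close>
  define B where "B = max 1 (max K (real L powr (2 * s) * (\<Sum>j. (\<theta> j)\<^sup>2)))"
  have B: "0 < B" "K \<le> B" "real L powr (2 * s) * (\<Sum>j. (\<theta> j)\<^sup>2) \<le> B" unfolding B_def by auto
  have "\<exists>x>0. B < x powr (2 * s) * freq_tail x \<theta>"
  proof (rule ccontr)
    assume "\<not> ?thesis"
    then have le: "x powr (2 * s) * freq_tail x \<theta> \<le> B" if "0 < x" for x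
      using that by (meson not_less)
    define \<gamma> where "\<gamma> = sqrt (B / P0)"
    have \<gamma>: "0 < \<gamma>" "\<gamma>\<^sup>2 = B / P0" using B P0 by (auto simp: \<gamma>_def)
    define \<eta> where "\<eta> j = \<theta> j / \<gamma>" for j
    have "l2seq \<eta>" using l2seq_combination[OF \<theta>(1) \<theta>(1), of "1 / \<gamma>" 0] by (simp add: \<eta>_def[abs_def])
    moreover have "x powr (2 * s) * freq_tail x \<eta> \<le> P0" if x: "0 < x" for x
    proof -
      have "(if x < real j then (\<eta> j)\<^sup>2 else 0) = (if x < real j then (\<theta> j)\<^sup>2 else 0) / \<gamma>\<^sup>2" for j
        by (simp add: \<eta>_def power_divide)
      then have "freq_tail x \<eta> = freq_tail x \<theta> / \<gamma>\<^sup>2"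
        using suminf_divide[OF summable_freq_tail[OF \<theta>(1), of x], of "\<gamma>\<^sup>2"] by simp
      then have "x powr (2 * s) * freq_tail x \<eta> = (x powr (2 * s) * freq_tail x \<theta>) / \<gamma>\<^sup>2" by simp
      also have "\<dots> \<le> B / \<gamma>\<^sup>2" using le[OF x] by (intro divide_right_mono) auto
      also have "\<dots> = P0" unfolding \<gamma>(2) using B P0 by simp
      finally show ?thesis .
    qed
    ultimately have "\<eta> \<in> Bbar s P0" by (simp add: Bbar_def)
    moreover have "\<theta> = (\<lambda>j. \<gamma> * \<eta> j)" using \<gamma> by (auto simp: \<eta>_def)
    ultimately show False using \<theta>(2) \<gamma>(1) unfolding cone_def by blast
  qed
  then obtain x where x: "0 < x" "B < x powr (2 * s) * freq_tail x \<theta>" by blast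
  define l where "l = nat \<lfloor>x\<rfloor>"
  have "real j > x \<longleftrightarrow> l < j" for j
    unfolding l_def using x(1) by (simp add: nat_less_iff floor_less_iff)
  then have e: "freq_tail x \<theta> = energy_tail \<theta> l" unfolding energy_tail_def by simp
  have "x powr (2 * s) \<le> real (Suc l) powr (2 * s)"
  proof (rule powr_mono2)
    show "x \<le> real (Suc l)" unfolding l_def using x(1) by linarith
  qed (use s x in auto)
  then have "x powr (2 * s) * freq_tail x \<theta> \<le> real (Suc l) powr (2 * s) * energy_tail \<theta> l"
    unfolding e using energy_tail_le(2)[OF \<theta>(1)] by (rule mult_right_mono)
  then have large: "B < real (Suc l) powr (2 * s) * energy_tail \<theta> l" using x(2) by simp
  have "L \<le> l"
  proof (rule ccontr)
    assume "\<not> L \<le> l"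
    then have "real (Suc l) powr (2 * s) \<le> real L powr (2 * s)" using s by (intro powr_mono2) auto
    then have "real (Suc l) powr (2 * s) * energy_tail \<theta> l \<le> real L powr (2 * s) * (\<Sum>j. (\<theta> j)\<^sup>2)"
      using energy_tail_le[OF \<theta>(1), of l] by (intro mult_mono) auto
    then show False using large B by simp
  qed
  then show ?thesis using large B by (intro exI[of _ l]) auto
qed

text \<open>The sample size n, rounded up, at which \<open>n powr (- r)\<close> equals the norm sqrt
  \<tau> of a truncation with energy \<tau>.\<close>

definition sample_size :: "real \<Rightarrow> real \<Rightarrow> nat" where
  "sample_size r \<tau> = nat \<lceil>\<tau> powr (- 1 / (2 * r))\<rceil>"

lemma sample_size_bounds:
  assumes "0 < \<tau>" "\<tau> < 1" "0 < r"
  shows "\<tau> powr (- 1 / (2 * r)) \<le> real (sample_size r \<tau>)" "real (sample_size r \<tau>) \<le> 2 * \<tau> powr (- 1 / (2 * r))"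
proof -
  have "1 powr (- 1 / (2 * r)) < \<tau> powr (- 1 / (2 * r))"
    using assms by (intro powr_less_mono2_neg) auto
  then have x: "1 < \<tau> powr (- 1 / (2 * r))" by simp
  show "\<tau> powr (- 1 / (2 * r)) \<le> real (sample_size r \<tau>)" "real (sample_size r \<tau>) \<le> 2 * \<tau> powr (- 1 / (2 * r))"
    unfolding sample_size_def using x by linarith+
qed

text \<open>Rounding changes the sample size by a factor of at most 2 and thus its power by at most
  \<open>2 powr r\<close>, which is below 2. This is the origin of the band constants 1/2 and
  2.\<close>

lemma sample_size_in_band:
  assumes \<tau>: "0 < \<tau>" "\<tau> < 1" and r: "0 < r" "r < 1/2" and e: "energy_tail \<theta> l = \<tau>"
  shows "in_band r (1 / 2) 2 (sample_size r \<tau>) (truncate_low l \<theta>)"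
proof -
  define x where "x = \<tau> powr (- 1 / (2 * r))"
  define N where "N = real (sample_size r \<tau>)"
  have x0: "0 < x" using \<tau> by (simp add: x_def)
  have xN: "x \<le> N" "N \<le> 2 * x" unfolding x_def N_def using sample_size_bounds[OF \<tau> r(1)] by auto
  have N0: "0 < N" using x0 xN by linarith
  have "x powr (- r) = \<tau> powr (1 / 2)" unfolding x_def powr_powr using r by simp
  then have norm: "l2norm (truncate_low l \<theta>) = x powr (- r)"
    unfolding l2norm_truncate_low e using \<tau> by (simp add: powr_half_sqrt)
  have "N powr (- r) \<le> x powr (- r)" using r x0 xN by (intro powr_mono2') auto
  moreover have "0 < N powr (- r)" using N0 by simp
  ultimately have "1 / 2 * N powr (- r) < l2norm (truncate_low l \<theta>)" unfolding norm by linarith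
  moreover have "x powr (- r) \<le> (N / 2) powr (- r)" using r x0 xN N0 by (intro powr_mono2') auto
  moreover have "(N / 2) powr (- r) = 2 powr r * N powr (- r)"
    using N0 by (simp add: powr_divide powr_minus field_simps)
  moreover have "2 powr r < (2::real)" using powr_less_mono[of r 1 2] r by simp
  then have "2 powr r * N powr (- r) < 2 * N powr (- r)" using N0 by (intro mult_strict_right_mono) auto
  ultimately show ?thesis unfolding in_band_def norm N_def by linarith
qed

text \<open>Only frequencies from \<open>Suc l\<close> on are present, so each weight is at most 1 /
  (pi * Suc l)^2, while sample size times energy is at most
  \<open>2 * \<tau> powr (- 1 / s)\<close>. The lower bound on \<tau> cancels the square of
  \<open>Suc l\<close>, and 2 / pi^2 \<le> 1 absorbs the rounding factor.\<close>

lemma truncate_low_drift_le: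
  assumes dens: "is_dens (truncate_low l \<theta>)" and \<theta>: "l2seq \<theta>"
    and \<tau>: "0 < \<tau>" "\<tau> < 1" and r: "0 < r" "r < 1/2" and s: "s = 2 * r / (1 - 2 * r)"
    and e: "energy_tail \<theta> l = \<tau>" and K: "0 < K" "K < real (Suc l) powr (2 * s) * \<tau>"
  shows "drift_tail (truncate_low l \<theta>) (sample_size r \<tau>) 0 \<le> K powr (- 1 / s)"
proof -
  define N where "N = real (sample_size r \<tau>)"
  define m where "m = real (Suc l)"
  have m: "0 < m" by (simp add: m_def)
  have s0: "0 < s" using r s by simp
  have sq: "summable (\<lambda>j. (\<theta> j)\<^sup>2)" using \<theta> by (simp add: l2seq_def)
  have "(\<Sum>j. lam j * (truncate_low l \<theta> j)\<^sup>2) \<le> (\<Sum>j. (if l < j then (\<theta> j)\<^sup>2 else 0) / (pi * m)\<^sup>2)"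
  proof (rule suminf_le[OF _ drift_tail_eq(2)[OF dens] summable_divide[OF summable_if_tail[OF sq]]])
    fix j
    show "lam j * (truncate_low l \<theta> j)\<^sup>2 \<le> (if l < j then (\<theta> j)\<^sup>2 else 0) / (pi * m)\<^sup>2"
    proof (cases "l < j")
      case True
      then have "(pi * m)\<^sup>2 \<le> (pi * real j)\<^sup>2" by (intro power_mono mult_left_mono) (auto simp: m_def)
      then have "(\<theta> j)\<^sup>2 / (pi * real j)\<^sup>2 \<le> (\<theta> j)\<^sup>2 / (pi * m)\<^sup>2"
        using True m by (intro divide_left_mono) auto
      then show ?thesis using True by (simp add: lam_def)
    qed simp
  qed
  also have "\<dots> = \<tau> / (pi * m)\<^sup>2"
    using suminf_divide[OF summable_if_tail[OF sq, of l], of "(pi * m)\<^sup>2"] e by (simp add: energy_tail_def)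
  finally have "drift_tail (truncate_low l \<theta>) (sample_size r \<tau>) 0 \<le> N * (\<tau> / (pi * m)\<^sup>2)"
    unfolding drift_tail_eq(1)[OF dens] N_def by (intro mult_left_mono) auto
  also have "\<dots> \<le> (2 * \<tau> powr (- 1 / (2 * r))) * (\<tau> / (pi * m)\<^sup>2)"
    unfolding N_def using sample_size_bounds(2)[OF \<tau> r(1)] \<tau> by (intro mult_right_mono) auto
  also have "\<dots> = 2 / pi\<^sup>2 * (\<tau> powr (- 1 / (2 * r)) * \<tau>) / m\<^sup>2"
    by (simp add: power_mult_distrib field_simps)
  also have "\<tau> powr (- 1 / (2 * r)) * \<tau> = \<tau> powr (- 1 / s)"
  proof -
    have "- 1 / s = - 1 / (2 * r) + 1" using r unfolding s by (simp add: field_simps)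
    then have "\<tau> powr (- 1 / s) = \<tau> powr (- 1 / (2 * r)) * \<tau> powr 1" by (simp only: powr_add)
    then show ?thesis using \<tau> by simp
  qed
  also have "2 / pi\<^sup>2 * \<tau> powr (- 1 / s) / m\<^sup>2 \<le> 1 * \<tau> powr (- 1 / s) / m\<^sup>2"
  proof -
    have "2 * 2 \<le> pi * pi" using pi_ge_two by (intro mult_mono) auto
    then have "2 / pi\<^sup>2 \<le> 1" by (simp add: power2_eq_square)
    then show ?thesis by (intro divide_right_mono mult_right_mono) auto
  qed
  also have "1 * \<tau> powr (- 1 / s) / m\<^sup>2 \<le> (K * m powr (- (2 * s))) powr (- 1 / s) / m\<^sup>2"
  proof -
    have "K < m powr (2 * s) * \<tau>" using K(2) by (simp only: m_def)
    then have "K * m powr (- (2 * s)) \<le> \<tau>" using m by (simp add: powr_minus field_simps)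
    then have "\<tau> powr (- 1 / s) \<le> (K * m powr (- (2 * s))) powr (- 1 / s)"
      using K m s0 by (intro powr_mono2') auto
    then show ?thesis by (simp add: divide_right_mono)
  qed
  also have "(K * m powr (- (2 * s))) powr (- 1 / s) / m\<^sup>2 = K powr (- 1 / s)"
  proof -
    have "(K * m powr (- (2 * s))) powr (- 1 / s) = K powr (- 1 / s) * m powr 2"
      using K m s0 by (simp add: powr_mult powr_powr)
    then show ?thesis using m by simp
  qed
  finally show ?thesis .
qed

lemma inconsistent_in_convex_set:
  assumes r: "0 < r" "r < 1/2" and s: "s = 2 * r / (1 - 2 * r)" and P0: "0 < P0"
    and \<theta>: "l2seq \<theta>" "\<theta> \<notin> cone (Bbar s P0)" "condD \<theta>"
    and V: "seq_convex V" "ortho_sym V" "\<theta> \<in> V"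
  shows "\<exists>n \<theta>s. strict_mono n \<and> (\<forall>i. \<theta>s i \<in> V \<and> is_dens (\<theta>s i) \<and> in_band r (1 / 2) 2 (n i) (\<theta>s i)) \<and> inconsistent n \<theta>s"
proof -
  have s0: "0 < s" using r s by simp
  obtain l0 where l0: "\<And>l. l > l0 \<Longrightarrow> is_dens (truncate_low l \<theta>)" using \<theta>(3) unfolding condD_def by blast
  \<comment> \<open>One condition for each need: l0 < l makes the truncation a density, i \<le> l
    clears every fixed coordinate, the growing bound \<open>Suc i\<close> drives the drift energy to
    0, and energy in (0,1) permits the rounding estimates.\<close>
  define P where "P i l \<longleftrightarrow> l0 < l \<and> i \<le> l \<and> real (Suc i) < real (Suc l) powr (2 * s) * energy_tail \<theta> l
     \<and> 0 < energy_tail \<theta> l \<and> energy_tail \<theta> l < 1" for i l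
  define size where "size l = sample_size r (energy_tail \<theta> l)" for l
  have ex: "\<exists>l. P i l \<and> b < size l" for i b
  proof -
    \<comment> \<open>Tail energy below v forces a sample size above b. Dependent choice then makes
      the sample sizes strictly increasing.\<close>
    define v where "v = min 1 (real (Suc b) powr (- (2 * r)))"
    have v: "0 < v" "v \<le> 1" "v \<le> real (Suc b) powr (- (2 * r))" by (auto simp: v_def)
    have "\<forall>\<^sub>F l in sequentially. energy_tail \<theta> l < v"
      by (rule order_tendstoD(2)[OF energy_tail_tendsto[OF \<theta>(1)] v(1)])
    then obtain L where L: "\<And>l. L \<le> l \<Longrightarrow> energy_tail \<theta> l < v" unfolding eventually_sequentially by blast
    obtain l where l: "max L (max (Suc l0) i) \<le> l" "real (Suc i) < real (Suc l) powr (2 * s) * energy_tail \<theta> l"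
      using energy_tail_large[OF \<theta>(1,2) P0 s0, of "max L (max (Suc l0) i)" "real (Suc i)"] by blast
    have et: "0 < energy_tail \<theta> l"
    proof -
      have "energy_tail \<theta> l \<noteq> 0" using l(2) by auto
      then show ?thesis using energy_tail_le(2)[OF \<theta>(1), of l] by simp
    qed
    have "energy_tail \<theta> l < v" using L l(1) by simp
    then have lt: "energy_tail \<theta> l < 1" "energy_tail \<theta> l < real (Suc b) powr (- (2 * r))" using v by auto
    have "real (Suc b) = (real (Suc b) powr (- (2 * r))) powr (- 1 / (2 * r))" using r by (simp add: powr_powr)
    also have "\<dots> < energy_tail \<theta> l powr (- 1 / (2 * r))" using et lt r by (intro powr_less_mono2_neg) auto
    also have "\<dots> \<le> real (size l)" unfolding size_def by (rule sample_size_bounds(1)[OF et lt(1) r(1)])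
    finally have "b < size l" by simp
    then show ?thesis using l et lt unfolding P_def by (intro exI[of _ l]) auto
  qed
  have "\<exists>f. \<forall>i. P i (f i) \<and> size (f i) < size (f (Suc i))"
    by (rule dependent_nat_choice) (use ex in blast)+
  then obtain f where f: "\<And>i. P i (f i)" "\<And>i. size (f i) < size (f (Suc i))" by blast
  define n where "n i = size (f i)" for i
  define \<theta>s where "\<theta>s i = truncate_low (f i) \<theta>" for i
  have n: "strict_mono n" unfolding n_def using f(2) by (simp add: strict_mono_Suc_iff)
  have dens: "is_dens (\<theta>s i)" for i unfolding \<theta>s_def using f(1)[of i] by (intro l0) (simp add: P_def)
  have band: "in_band r (1 / 2) 2 (n i) (\<theta>s i)" for i
    unfolding n_def \<theta>s_def size_def using f(1)[of i] r by (intro sample_size_in_band) (auto simp: P_def)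
  have mem: "\<theta>s i \<in> V" for i unfolding \<theta>s_def by (rule truncate_low_mem[OF V])
  have "inconsistent n \<theta>s"
  proof (rule inconsistent_of_vanishing_drift[OF dens n])
    show "(\<lambda>i. l2norm (\<theta>s i)) \<longlonglongrightarrow> 0"
      by (rule in_band_l2norm_tendsto[OF n r(1) band]) (use dens in \<open>simp add: is_dens_def\<close>)
    show "\<forall>\<^sub>F i in sequentially. \<forall>j\<in>{1..m}. \<theta>s i j = 0" for m
    proof (rule eventually_sequentiallyI[of m])
      fix i assume "m \<le> i"
      moreover have "i \<le> f i" using f(1)[of i] by (simp add: P_def)
      ultimately show "\<forall>j\<in>{1..m}. \<theta>s i j = 0" by (auto simp: \<theta>s_def)
    qed
    have le: "drift_tail (\<theta>s i) (n i) 0 \<le> real (Suc i) powr (- 1 / s)" for i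
      unfolding n_def \<theta>s_def size_def
      by (rule truncate_low_drift_le[OF _ \<theta>(1) _ _ r s refl])
         (use f(1)[of i] dens[of i] in \<open>auto simp: P_def \<theta>s_def\<close>)
    have ge: "0 \<le> drift_tail (\<theta>s i) (n i) 0" for i
      unfolding drift_tail_eq(1)[OF dens] using drift_tail_eq(2)[OF dens[of i]]
      by (intro mult_nonneg_nonneg suminf_nonneg) (auto simp: lam_nonneg)
    show "(\<lambda>i. drift_tail (\<theta>s i) (n i) 0) \<longlonglongrightarrow> 0"
    proof (rule tendsto_sandwich[OF _ _ tendsto_const])
      have "filterlim (\<lambda>i. real (Suc i)) at_top sequentially"
        by (rule filterlim_compose[OF filterlim_real_sequentially filterlim_Suc])
      then show "(\<lambda>i. real (Suc i) powr (- 1 / s)) \<longlonglongrightarrow> 0" using s0 by (intro tendsto_neg_powr) auto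
    qed (use le ge in \<open>auto intro: always_eventually\<close>)
  qed
  then show ?thesis using n mem dens band by blast
qed

theorem theorem17:
  fixes r s P0 :: real
  assumes "0 < r" and "r < 1/2" and "s = 2 * r / (1 - 2 * r)" and "0 < P0"
  shows "maxiset r (Bbar s P0)"
proof -
  have cons: "consistent n \<theta>s"
    if c: "0 < c" and n: "strict_mono n"
      and \<theta>: "\<And>i. \<theta>s i \<in> Bbar s P0" "\<And>i. is_dens (\<theta>s i)" "\<And>i. in_band r c C (n i) (\<theta>s i)" for c C n \<theta>s
  proof -
    obtain \<tau> where \<tau>: "0 < \<tau>"
      "\<And>\<theta> n. \<theta> \<in> Bbar s P0 \<Longrightarrow> is_dens \<theta> \<Longrightarrow> 1 \<le> n \<Longrightarrow> c * real n powr (- r) < l2norm \<theta> \<Longrightarrow> 2 * \<tau> \<le> drift_tail \<theta> n 0"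
      using Bbar_drift_lower[OF assms c] by blast
    show ?thesis
    proof (rule consistent_of_separated_drift[OF \<theta>(2) n _ \<tau>(1)])
      show "(\<lambda>i. l2norm (\<theta>s i)) \<longlonglongrightarrow> 0"
        by (rule in_band_l2norm_tendsto[OF n assms(1) \<theta>(3)]) (use \<theta>(2) in \<open>simp add: is_dens_def\<close>)
      \<comment> \<open>Index 0 is skipped because \<open>n 0\<close> may be 0; afterwards strict
        monotonicity gives a positive sample size.\<close>
      show "\<forall>\<^sub>F i in sequentially. 2 * \<tau> \<le> drift_tail (\<theta>s i) (n i) 0"
      proof (rule eventually_sequentiallyI[of 1])
        fix i :: nat assume "1 \<le> i"
        then have "1 \<le> n i" using seq_suble[OF n, of i] by simp
        then show "2 * \<tau> \<le> drift_tail (\<theta>s i) (n i) 0"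
          using \<theta>(3)[of i] by (intro \<tau>(2) \<theta>) (auto simp: in_band_def)
      qed
    qed
  qed
  have incons: "\<exists>c C n \<theta>s. 0 < c \<and> c < C \<and> strict_mono n \<and>
      (\<forall>i. \<theta>s i \<in> V \<and> is_dens (\<theta>s i) \<and> in_band r c C (n i) (\<theta>s i)) \<and> inconsistent n \<theta>s"
    if "l2seq \<theta>" "\<theta> \<notin> cone (Bbar s P0)" "condD \<theta>" "seq_convex V" "ortho_sym V" "\<theta> \<in> V" for \<theta> V
    using inconsistent_in_convex_set[OF assms that]
    by (intro exI[of _ "1 / 2"] exI[of _ 2]) simp
  have sub: "Bbar s P0 \<subseteq> {\<theta>. l2seq \<theta>}" by (auto simp: Bbar_def)
  show ?thesis
    unfolding maxiset_def
    using sub Bbar_bounded Bbar_closed Bbar_convex Bbar_ortho_sym cons incons by blast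
qed

end
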